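(* The cohomology of the complex $(\hat{\mathcal A}[\lambda],D_\lambda)$, where $D_\lambda=D_2-\lambda D_1$, is $$H(\hat{\mathcal A}[\lambda],D_\lambda)=\mathbb R[\lambda]\ \oplus\ \big(C^\infty(\mathbb R)/\mathbb R[u]\big)\,\theta\theta^1\ \oplus\ C^\infty(\mathbb R)\,\theta\theta^1\theta^2 .$$ Here the cohomology is taken as a bigraded space $\bigoplus_{p,d}H^p_d$, and the three summands sit in bidegrees $(p,d)=(0,0)$, $(2,1)$, $(3,3)$ respectively.
   Context: Let $\hat{\mathcal A}=C^\infty(\mathbb R)[[u^1,u^2,\dots;\theta^0,\theta^1,\theta^2,\dots]]$ be the supercommutative associative algebra over $\mathbb R$ with even formal variables $u^i$ ($i\ge1$) and odd (mutually anticommuting) formal variables $\theta^i$ ($i\ge 0$); elements of $C^\infty(\mathbb R)$ are smooth functions of a coordinate $u=u^0$ on $\mathbb R$, and $\theta=\theta^0$. $\mathbb R[u]\subset C^\infty(\mathbb R)$ is the subspace of polynomial functions. The standard degree is given by $\deg u^i=\deg\theta^i=i$ for $i\ge 1$, and $\deg\theta^0=\deg f=0$ for $f\in C^\infty(\mathbb R)$. The super degree assigns $1$ to each $\theta^i$ ($i\ge0$) and $0$ to all other generators. $\hat{\mathcal A}^p_d$ is the subspace of elements of super degree $p$ and standard degree $d$ (zero if $p<0$ or $d<0$). Let $\partial=\sum_{s\ge0}\big(u^{s+1}\frac{\partial}{\partial u^s}+\theta^{s+1}\frac{\partial}{\partial\theta^s}\big)$ and consider the anticommuting differentials on $\hat{\mathcal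 A}$ of bidegree $(p,d)=(1,1)$ given by the odd derivations $$D_1=\sum_{s\ge0}\theta^{s+1}\frac{\partial}{\partial u^s},\qquad D_2=\sum_{s\ge0}\Big(\partial^s\big(u\theta^1+\tfrac12u^1\theta\big)\frac{\partial}{\partial u^s}+\partial^s\big(\tfrac12\theta\theta^1\big)\frac{\partial}{\partial\theta^s}\Big).$$ $\hat{\mathcal A}[\lambda]$ denotes polynomials in an even formal variable $\lambda$ of bidegree $(0,0)$ with coefficients in $\hat{\mathcal A}$, and $D_1,D_2$ are extended $\lambda$-linearly. $H^p_d(\hat{\mathcal A}[\lambda],D_\lambda)$ is the kernel of $D_\lambda$ on $\hat{\mathcal A}^p_d[\lambda]$ modulo $D_\lambda(\hat{\mathcal A}^{p-1}_{d-1}[\lambda])$. *)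

theory Defs
  imports
    "HOL-Analysis.Analysis"
    "HOL-Library.Multiset"
    "HOL-Library.Groups_Big_Fun"
    "HOL-Library.Set_Algebras"
    "HOL-Computational_Algebra.Polynomial"
begin

section \<open>Smooth functions on the real line\<close>

definition smooth_real :: "(real \<Rightarrow> real) \<Rightarrow> bool"
  where "smooth_real f \<longleftrightarrow> (\<forall>n x. (deriv ^^ n) f differentiable (at x))"

lemma smooth_real_deriv: "smooth_real f \<Longrightarrow> smooth_real (deriv f)"
  unfolding smooth_real_def by (metis comp_apply funpow_Suc_right)

lemma smooth_real_differentiable: "smooth_real f \<Longrightarrow> f differentiable (at x)"
  unfolding smooth_real_def by (metis funpow_0)

context
begin

private definition ntimes :: "nat \<Rightarrow> (real \<Rightarrow> real) \<Rightarrow> bool"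
  where "ntimes n f \<longleftrightarrow> (\<forall>k\<le>n. \<forall>x. (deriv ^^ k) f differentiable (at x))"

private lemma smooth_iff_ntimes: "smooth_real f \<longleftrightarrow> (\<forall>n. ntimes n f)"
  unfolding smooth_real_def ntimes_def by blast

private lemma ntimes_0: "ntimes 0 f \<longleftrightarrow> (\<forall>x. f differentiable (at x))"
  by (simp add: ntimes_def)

private lemma ntimes_Suc:
  "ntimes (Suc n) f \<longleftrightarrow> (\<forall>x. f differentiable (at x)) \<and> ntimes n (deriv f)"
proof
  assume h: "ntimes (Suc n) f"
  have "f differentiable (at x)" for x
    using h unfolding ntimes_def by (metis funpow_0 zero_le)
  moreover have "ntimes n (deriv f)"
    using h unfolding ntimes_def
    by (metis Suc_le_mono comp_apply funpow_Suc_right)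
  ultimately show "(\<forall>x. f differentiable (at x)) \<and> ntimes n (deriv f)" by blast
next
  assume h: "(\<forall>x. f differentiable (at x)) \<and> ntimes n (deriv f)"
  show "ntimes (Suc n) f"
    unfolding ntimes_def
  proof (intro allI impI)
    fix k x assume "k \<le> Suc n"
    then show "(deriv ^^ k) f differentiable (at x)"
      using h by (cases k) (auto simp: ntimes_def funpow_Suc_right simp del: funpow.simps)
  qed
qed

private lemma ntimes_mono: "ntimes (Suc n) f \<Longrightarrow> ntimes n f"
  by (simp add: ntimes_def)

private lemma has_deriv: "f differentiable (at x) \<Longrightarrow> (f has_field_derivative deriv f x) (at x)"
  for f :: "real \<Rightarrow> real"
  by (simp add: DERIV_deriv_iff_real_differentiable)

private lemma ntimes_add: "ntimes n f \<Longrightarrow> ntimes n g \<Longrightarrow> ntimes n (\<lambda>x. f x + g x)"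
proof (induction n arbitrary: f g)
  case 0
  then show ?case by (simp add: ntimes_0)
next
  case (Suc n)
  have "deriv (\<lambda>x. f x + g x) = (\<lambda>x. deriv f x + deriv g x)"
    using Suc.prems
    by (auto simp: ntimes_Suc fun_eq_iff intro!: DERIV_imp_deriv derivative_eq_intros has_deriv)
  with Suc show ?case by (simp add: ntimes_Suc)
qed

private lemma ntimes_mult: "ntimes n f \<Longrightarrow> ntimes n g \<Longrightarrow> ntimes n (\<lambda>x. f x * g x)"
proof (induction n arbitrary: f g)
  case 0
  then show ?case by (simp add: ntimes_0)
next
  case (Suc n)
  have "deriv (\<lambda>x. f x * g x) = (\<lambda>x. f x * deriv g x + deriv f x * g x)"
    using Suc.prems
    by (auto simp: ntimes_Suc fun_eq_iff intro!: DERIV_imp_deriv derivative_eq_intros has_deriv)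
  with Suc ntimes_mono[OF Suc.prems(1)] ntimes_mono[OF Suc.prems(2)] show ?case
    by (simp add: ntimes_Suc ntimes_add)
qed

lemma smooth_real_add: "smooth_real f \<Longrightarrow> smooth_real g \<Longrightarrow> smooth_real (\<lambda>x. f x + g x)"
  by (simp add: smooth_iff_ntimes ntimes_add)

lemma smooth_real_mult: "smooth_real f \<Longrightarrow> smooth_real g \<Longrightarrow> smooth_real (\<lambda>x. f x * g x)"
  by (simp add: smooth_iff_ntimes ntimes_mult)

lemma smooth_real_const: "smooth_real (\<lambda>x. c)"
proof -
  have "ntimes n (\<lambda>x. c)" for n
    by (induction n arbitrary: c) (simp_all add: ntimes_0 ntimes_Suc)
  then show ?thesis by (simp add: smooth_iff_ntimes)
qed

lemma smooth_real_id: "smooth_real (\<lambda>x. x)"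
proof -
  have "ntimes n (\<lambda>x. x)" for n
    using smooth_real_const[of 1]
    by (cases n) (simp_all add: ntimes_0 ntimes_Suc smooth_iff_ntimes)
  then show ?thesis by (simp add: smooth_iff_ntimes)
qed

end

typedef smooth = "{f. smooth_real f}"
  morphisms apply_smooth Smooth
  using smooth_real_const by blast

setup_lifting type_definition_smooth

instantiation smooth :: "{comm_ring_1, real_algebra_1}"
begin

lift_definition zero_smooth :: smooth is "\<lambda>x. 0" by (rule smooth_real_const)
lift_definition one_smooth :: smooth is "\<lambda>x. 1" by (rule smooth_real_const)
lift_definition plus_smooth :: "smooth \<Rightarrow> smooth \<Rightarrow> smooth" is "\<lambda>f g x. f x + g x"
  by (rule smooth_real_add)
lift_definition times_smooth :: "smooth \<Rightarrow> smooth \<Rightarrow> smooth" is "\<lambda>f g x. f x * g x"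
  by (rule smooth_real_mult)
lift_definition scaleR_smooth :: "real \<Rightarrow> smooth \<Rightarrow> smooth" is "\<lambda>r f x. r * f x"
  by (intro smooth_real_mult smooth_real_const)
lift_definition uminus_smooth :: "smooth \<Rightarrow> smooth" is "\<lambda>f x. - f x"
  using smooth_real_mult[OF smooth_real_const[of "-1"]] by simp
lift_definition minus_smooth :: "smooth \<Rightarrow> smooth \<Rightarrow> smooth" is "\<lambda>f g x. f x - g x"
  using smooth_real_add[OF _ smooth_real_mult[OF smooth_real_const[of "-1"]]] by simp

instance
  by standard (transfer; auto simp: fun_eq_iff algebra_simps)+

end

lift_definition smooth_coord :: smooth is "\<lambda>x. x"
  by (rule smooth_real_id)

lift_definition smooth_deriv :: "smooth \<Rightarrow> smooth" is deriv
  by (rule smooth_real_deriv)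

lifting_forget smooth.lifting

lemma smooth_deriv_0: "smooth_deriv 0 = 0"
  by (simp add: smooth_deriv_def zero_smooth_def Smooth_inverse smooth_real_const)

definition polynomial_functions :: "smooth set"
  where "polynomial_functions = {f. \<exists>q. apply_smooth f = poly q}"

section \<open>The supercommutative algebra of formal power series\<close>

text \<open>
  The pair \<open>(m, S)\<close> stands for the monomial \<open>(\<Prod>i\<in>#m. u\<^sup>i) \<theta>\<^bsup>s1\<^esup> \<dots> \<theta>\<^bsup>sk\<^esup>\<close>,
  where \<open>s1 < \<dots> < sk\<close> are the elements of the finite set \<open>S\<close>. As \<open>u\<^sup>0\<close> is the coordinate of
  the smooth coefficients, it does not occur in \<open>m\<close>.
\<close>

definition super_monomials :: "(nat multiset \<times> nat set) set"
  where "super_monomials = {(m, S). 0 \<notin># m \<and> finite S}"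

typedef super_series =
  "{F :: nat multiset \<Rightarrow> nat set \<Rightarrow> smooth. \<forall>m S. (m, S) \<notin> super_monomials \<longrightarrow> F m S = 0}"
  morphisms ss_coeff Super_Series
  by (rule exI[of _ "\<lambda>m S. 0"]) simp

setup_lifting type_definition_super_series

text \<open>
  The product of the increasing \<open>\<theta>\<close>-monomials of disjoint sets \<open>S\<close> and \<open>T\<close> is
  \<open>shuffle_sign S T\<close> times the increasing monomial of \<open>S \<union> T\<close>.
\<close>

definition shuffle_sign :: "nat set \<Rightarrow> nat set \<Rightarrow> real"
  where "shuffle_sign S T = (-1) ^ card {(i, j). i \<in> S \<and> j \<in> T \<and> j < i}"

lemma super_product_support:
  assumes F: "\<And>m S. (m, S) \<notin> super_monomials \<Longrightarrow> F m S = 0"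
    and G: "\<And>m S. (m, S) \<notin> super_monomials \<Longrightarrow> G m S = 0"
    and mS: "(m, S) \<notin> super_monomials"
  shows "(\<Sum>k | k \<subseteq># m. \<Sum>T\<in>Pow S.
    shuffle_sign T (S - T) *\<^sub>R (F k T * G (m - k) (S - T) :: smooth)) = 0"
proof -
  have "F k T * G (m - k) (S - T) = 0"
    if "k \<subseteq># m" "T \<subseteq> S" for k T
  proof -
    have "(k, T) \<notin> super_monomials \<or> (m - k, S - T) \<notin> super_monomials"
    proof (rule ccontr)
      assume "\<not> ?thesis"
      moreover have "m = k + (m - k)" "S = T \<union> (S - T)" using that by auto
      ultimately have "(m, S) \<in> super_monomials"
        by (metis (mono_tags, lifting) case_prodD case_prodI finite_UnI mem_Collect_eq
            super_monomials_def union_iff)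
      with mS show False by blast
    qed
    with F G show ?thesis by auto
  qed
  then show ?thesis
    by (auto intro!: sum.neutral)
qed

instantiation super_series :: "{real_vector, one, times}"
begin

lift_definition zero_super_series :: super_series is "\<lambda>m S. 0" by simp
lift_definition one_super_series :: super_series
  is "\<lambda>m S. if m = {#} \<and> S = {} then 1 else 0" by (auto simp: super_monomials_def)
lift_definition plus_super_series :: "super_series \<Rightarrow> super_series \<Rightarrow> super_series"
  is "\<lambda>F G m S. F m S + G m S" by simp
lift_definition uminus_super_series :: "super_series \<Rightarrow> super_series"
  is "\<lambda>F m S. - F m S" by simp
lift_definition minus_super_series :: "super_series \<Rightarrow> super_series \<Rightarrow> super_series"
  is "\<lambda>F G m S. F m S - G m S" by simp
lift_definition scaleR_super_series :: "real \<Rightarrow> super_series \<Rightarrow> super_series"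
  is "\<lambda>r F m S. r *\<^sub>R F m S" by simp
lift_definition times_super_series :: "super_series \<Rightarrow> super_series \<Rightarrow> super_series"
  is "\<lambda>F G m S. \<Sum>k | k \<subseteq># m. \<Sum>T\<in>Pow S.
        shuffle_sign T (S - T) *\<^sub>R (F k T * G (m - k) (S - T))"
  by (auto intro!: super_product_support)

instance
  by standard (transfer; auto simp: fun_eq_iff ac_simps scaleR_add_right scaleR_add_left)+

end

lemma finite_submultisets: "finite {k. k \<subseteq># (m :: 'a multiset)}"
proof (induction m)
  case (add x m)
  have "k \<in> {k. k \<subseteq># m} \<union> add_mset x ` {k. k \<subseteq># m}" if "k \<subseteq># add_mset x m" for k
  proof (cases "x \<in># k")
    case True
    then obtain l where "k = add_mset x l" by (metis insert_DiffM)
    with that show ?thesis by auto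
  next
    case False
    with that show ?thesis
      by (metis UnI1 add_mset_add_single diff_single_trivial mem_Collect_eq subset_eq_diff_conv)
  qed
  then have "{k. k \<subseteq># add_mset x m} \<subseteq> {k. k \<subseteq># m} \<union> add_mset x ` {k. k \<subseteq># m}" by blast
  with add show ?case by (meson finite_UnI finite_imageI finite_subset)
qed simp

lemma shuffle_sign_Un_left:
  assumes "finite A" "finite B" "finite C" "A \<inter> B = {}"
  shows "shuffle_sign (A \<union> B) C = shuffle_sign A C * shuffle_sign B C"
proof -
  let ?I = "\<lambda>S. {(i, j). i \<in> S \<and> j \<in> C \<and> j < i}"
  have "?I (A \<union> B) = ?I A \<union> ?I B" "?I A \<inter> ?I B = {}" using assms(4) by auto
  moreover have "finite (?I A)" "finite (?I B)"
    using assms by (auto intro: finite_subset[of _ "A \<times> C"] finite_subset[of _ "B \<times> C"])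
  ultimately show ?thesis
    by (simp add: shuffle_sign_def card_Un_disjoint power_add)
qed

lemma shuffle_sign_Un_right:
  assumes "finite A" "finite B" "finite C" "A \<inter> B = {}"
  shows "shuffle_sign C (A \<union> B) = shuffle_sign C A * shuffle_sign C B"
proof -
  let ?I = "\<lambda>S. {(i, j). i \<in> C \<and> j \<in> S \<and> j < i}"
  have "?I (A \<union> B) = ?I A \<union> ?I B" "?I A \<inter> ?I B = {}" using assms(4) by auto
  moreover have "finite (?I A)" "finite (?I B)"
    using assms by (auto intro: finite_subset[of _ "C \<times> A"] finite_subset[of _ "C \<times> B"])
  ultimately show ?thesis
    by (simp add: shuffle_sign_def card_Un_disjoint power_add)
qed

lemma shuffle_sign_empty [simp]: "shuffle_sign {} S = 1" "shuffle_sign S {} = 1"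
  by (simp_all add: shuffle_sign_def)

lemma shuffle_sign_assoc:
  assumes "finite S" "T \<subseteq> S" "R \<subseteq> T"
  shows "shuffle_sign T (S - T) * shuffle_sign R (T - R) =
         shuffle_sign R (S - R) * shuffle_sign (T - R) (S - T)"
proof -
  have "finite T"
    using assms(2,1) by (rule finite_subset)
  moreover from assms(3) this have "finite R"
    by (rule finite_subset)
  ultimately have fin: "finite T" "finite R" .
  have "shuffle_sign (R \<union> (T - R)) (S - T) = shuffle_sign R (S - T) * shuffle_sign (T - R) (S - T)"
    by (rule shuffle_sign_Un_left) (use fin assms in auto)
  moreover have "shuffle_sign R ((T - R) \<union> (S - T)) = shuffle_sign R (T - R) * shuffle_sign R (S - T)"
    by (rule shuffle_sign_Un_right) (use fin assms in auto)
  moreover have "R \<union> (T - R) = T" "(T - R) \<union> (S - T) = S - R"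
    using assms by auto
  ultimately show ?thesis by (simp only: mult.assoc mult.commute mult.left_commute)
qed

lemma coeff_times:
  "ss_coeff (F * G) m S = (\<Sum>(k, T)\<in>{k. k \<subseteq># m} \<times> Pow S.
     shuffle_sign T (S - T) *\<^sub>R (ss_coeff F k T * ss_coeff G (m - k) (S - T)))"
  by (simp add: times_super_series.rep_eq sum.cartesian_product)

lemma ss_eqI: "(\<And>m S. finite S \<Longrightarrow> ss_coeff F m S = ss_coeff G m S) \<Longrightarrow> F = G"
proof -
  assume h: "\<And>m S. finite S \<Longrightarrow> ss_coeff F m S = ss_coeff G m S"
  have "ss_coeff F m S = ss_coeff G m S" for m S
    using ss_coeff[of F] ss_coeff[of G] h by (cases "finite S") (auto simp: super_monomials_def)
  then show ?thesis by (simp add: ss_coeff_inject[symmetric] fun_eq_iff)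
qed

lemma ss_assoc: "(F * G) * H = F * (G * H)" for F G H :: super_series
proof (rule ss_eqI)
  fix m :: "nat multiset" and S :: "nat set"
  assume S: "finite S"
  let ?P = "\<lambda>m S. {k. k \<subseteq># m} \<times> Pow S"
  have fin: "finite (?P m' S')" if "S' \<subseteq> S" for m' :: "nat multiset" and S'
    using that S finite_subset finite_submultisets by blast
  have "ss_coeff ((F * G) * H) m S =
     (\<Sum>x\<in>?P m S. \<Sum>y\<in>?P (fst x) (snd x).
        (shuffle_sign (snd x) (S - snd x) * shuffle_sign (snd y) (snd x - snd y)) *\<^sub>R
        (ss_coeff F (fst y) (snd y) * ss_coeff G (fst x - fst y) (snd x - snd y)
          * ss_coeff H (m - fst x) (S - snd x)))"
    by (simp add: coeff_times sum_distrib_right scaleR_sum_right case_prod_beta)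
  also have "\<dots> = (\<Sum>z\<in>Sigma (?P m S) (\<lambda>x. ?P (fst x) (snd x)). case z of (x, y) \<Rightarrow>
        (shuffle_sign (snd x) (S - snd x) * shuffle_sign (snd y) (snd x - snd y)) *\<^sub>R
        (ss_coeff F (fst y) (snd y) * ss_coeff G (fst x - fst y) (snd x - snd y)
          * ss_coeff H (m - fst x) (S - snd x)))"
    by (rule sum.Sigma) (use fin in auto)
  also have "\<dots> = (\<Sum>z\<in>Sigma (?P m S) (\<lambda>y. ?P (m - fst y) (S - snd y)). case z of (y, w) \<Rightarrow>
        (shuffle_sign (snd y) (S - snd y) * shuffle_sign (snd w) (S - snd y - snd w)) *\<^sub>R
        (ss_coeff F (fst y) (snd y) * (ss_coeff G (fst w) (snd w)
          * ss_coeff H (m - fst y - fst w) (S - snd y - snd w))))"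
  proof (rule sum.reindex_bij_witness[where
        i = "\<lambda>(y, w). ((fst y + fst w, snd y \<union> snd w), y)" and
        j = "\<lambda>(x, y). (y, (fst x - fst y, snd x - snd y))"], goal_cases)
    case (1 z)
    then show ?case by auto
  next
    case (2 z)
    obtain k T j R where z: "z = ((k, T), (j, R))" by (metis surj_pair)
    with 2 have *: "k \<subseteq># m" "T \<subseteq> S" "j \<subseteq># k" "R \<subseteq> T" by auto
    have "k - j \<subseteq># m - j"
      using *(1) by (simp add: subseteq_mset_def diff_le_mono)
    moreover have "j \<subseteq># m"
      using *(1,3) by (rule subset_mset.order_trans[rotated])
    moreover have "R \<subseteq> S" "T - R \<subseteq> S - R"
      using *(2,4) by auto
    ultimately show ?case by (simp add: z)
  next
    case (3 z)
    then show ?case by auto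
  next
    case (4 z)
    have "j + w \<subseteq># m" if "j \<subseteq># m" "w \<subseteq># m - j" for j w
      using that by (metis add.commute subset_mset.le_diff_conv2)
    with 4 show ?case by auto
  next
    case (5 z)
    obtain k T j R where z: "z = ((k, T), (j, R))" by (metis surj_pair)
    with 5 have *: "k \<subseteq># m" "T \<subseteq> S" "j \<subseteq># k" "R \<subseteq> T" by auto
    then have "S - R - (T - R) = S - T" "m - j - (k - j) = m - k"
      by (auto simp: subset_mset.add_diff_inverse diff_diff_add_mset)
    with shuffle_sign_assoc[OF S *(2,4)] z show ?case by (simp add: mult.assoc)
  qed
  also have "\<dots> = (\<Sum>y\<in>?P m S. \<Sum>w\<in>?P (m - fst y) (S - snd y).
        (shuffle_sign (snd y) (S - snd y) * shuffle_sign (snd w) (S - snd y - snd w)) *\<^sub>R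
        (ss_coeff F (fst y) (snd y) * (ss_coeff G (fst w) (snd w)
          * ss_coeff H (m - fst y - fst w) (S - snd y - snd w))))"
    by (rule sum.Sigma[symmetric]) (use fin in auto)
  also have "\<dots> = ss_coeff (F * (G * H)) m S"
    by (simp add: coeff_times sum_distrib_left scaleR_sum_right case_prod_beta)
  finally show "ss_coeff ((F * G) * H) m S = ss_coeff (F * (G * H)) m S" .
qed

lemma one_l: "1 * F = F" for F :: super_series
proof (rule ss_eqI)
  fix m :: "nat multiset" and S :: "nat set"
  assume "finite S"
  have "ss_coeff (1 * F) m S = (\<Sum>(k, T)\<in>{({#}, {})}.
     shuffle_sign T (S - T) *\<^sub>R (ss_coeff 1 k T * ss_coeff F (m - k) (S - T)))"
    unfolding coeff_times
  proof (rule sum.mono_neutral_right)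
    show "finite ({k. k \<subseteq># m} \<times> Pow S)"
      using \<open>finite S\<close> finite_submultisets by blast
    show "\<forall>x\<in>{k. k \<subseteq># m} \<times> Pow S - {({#}, {})}. (case x of (k, T) \<Rightarrow>
        shuffle_sign T (S - T) *\<^sub>R (ss_coeff 1 k T * ss_coeff F (m - k) (S - T))) = 0"
      by (auto simp: one_super_series.rep_eq split: if_split_asm)
  qed simp
  then show "ss_coeff (1 * F) m S = ss_coeff F m S"
    by (simp add: one_super_series.rep_eq)
qed

lemma one_r: "F * 1 = F" for F :: super_series
proof (rule ss_eqI)
  fix m :: "nat multiset" and S :: "nat set"
  assume "finite S"
  have "ss_coeff (F * 1) m S = (\<Sum>(k, T)\<in>{(m, S)}.
     shuffle_sign T (S - T) *\<^sub>R (ss_coeff F k T * ss_coeff 1 (m - k) (S - T)))"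
    unfolding coeff_times
  proof (rule sum.mono_neutral_right)
    show "finite ({k. k \<subseteq># m} \<times> Pow S)"
      using \<open>finite S\<close> finite_submultisets by blast
    show "\<forall>x\<in>{k. k \<subseteq># m} \<times> Pow S - {(m, S)}. (case x of (k, T) \<Rightarrow>
        shuffle_sign T (S - T) *\<^sub>R (ss_coeff F k T * ss_coeff 1 (m - k) (S - T))) = 0"
    proof (intro ballI)
      fix x assume x: "x \<in> {k. k \<subseteq># m} \<times> Pow S - {(m, S)}"
      obtain k T where kT: "x = (k, T)" by (cases x)
      with x have "k \<subseteq># m" "T \<subseteq> S" "k \<noteq> m \<or> T \<noteq> S" by auto
      then have "\<not> (m - k = {#} \<and> S - T = {})"
        by (metis Diff_eq_empty_iff Diff_eq_empty_iff_mset subset_antisym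
            subset_mset.order_antisym)
      then have "ss_coeff 1 (m - k) (S - T) = 0"
        unfolding one_super_series.rep_eq by (rule if_not_P)
      then show "(case x of (k, T) \<Rightarrow>
          shuffle_sign T (S - T) *\<^sub>R (ss_coeff F k T * ss_coeff 1 (m - k) (S - T))) = 0"
        by (simp add: kT)
    qed
  qed simp
  then show "ss_coeff (F * 1) m S = ss_coeff F m S"
    by (simp add: one_super_series.rep_eq)
qed

instance super_series :: real_algebra_1
proof
  fix F G H :: super_series and r :: real
  show "F * G * H = F * (G * H)" by (rule ss_assoc)
  show "1 * F = F" "F * 1 = F" by (rule one_l, rule one_r)
  show "(F + G) * H = F * H + G * H"
    by (rule ss_eqI) (simp add: coeff_times plus_super_series.rep_eq case_prod_beta
        algebra_simps sum.distrib)
  show "F * (G + H) = F * G + F * H"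
    by (rule ss_eqI) (simp add: coeff_times plus_super_series.rep_eq case_prod_beta
        algebra_simps sum.distrib)
  show "(r *\<^sub>R F) * G = r *\<^sub>R (F * G)"
    by (rule ss_eqI) (simp add: coeff_times scaleR_super_series.rep_eq case_prod_beta
        scaleR_sum_right mult.commute)
  show "F * (r *\<^sub>R G) = r *\<^sub>R (F * G)"
    by (rule ss_eqI) (simp add: coeff_times scaleR_super_series.rep_eq case_prod_beta
        scaleR_sum_right mult.commute)
  have "ss_coeff 0 {#} {} \<noteq> ss_coeff 1 {#} {}"
    by (simp add: zero_super_series.rep_eq one_super_series.rep_eq)
  then show "(0::super_series) \<noteq> 1" by metis
qed

lift_definition ss_const :: "smooth \<Rightarrow> super_series"
  is "\<lambda>f m S. if m = {#} \<and> S = {} then f else 0"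
  by (auto simp: super_monomials_def)

lift_definition theta :: "nat \<Rightarrow> super_series"
  is "\<lambda>i m S. if m = {#} \<and> S = {i} then 1 else 0"
  by (auto simp: super_monomials_def)

lift_definition jet_u :: "nat \<Rightarrow> super_series"
  is "\<lambda>i m S. if i = 0 then (if m = {#} \<and> S = {} then smooth_coord else 0)
               else (if m = {#i#} \<and> S = {} then 1 else 0)"
  by (auto simp: super_monomials_def)

text \<open>
  For \<open>s > 0\<close>, the monomial \<open>m\<close> only arises from \<open>u\<^sup>s m\<close>, in which \<open>u\<^sup>s\<close> has exponent
  \<open>count m s + 1\<close>.
\<close>

lift_definition pd_u :: "nat \<Rightarrow> super_series \<Rightarrow> super_series"
  is "\<lambda>s F m S. if s = 0 then smooth_deriv (F m S)
                else real (Suc (count m s)) *\<^sub>R F (add_mset s m) S"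
  by (auto simp: super_monomials_def smooth_deriv_0)

text \<open>The left derivative with respect to \<open>\<theta>\<^sup>s\<close>.\<close>

lift_definition pd_theta :: "nat \<Rightarrow> super_series \<Rightarrow> super_series"
  is "\<lambda>s F m S. if s \<in> S then 0 else shuffle_sign {s} S *\<^sub>R F m (insert s S)"
  by (auto simp: super_monomials_def)

text \<open>
  The vector field \<open>\<Sum>s. X s \<partial>/\<partial>u\<^sup>s + Y s \<partial>/\<partial>\<theta>\<^sup>s\<close>, summed coefficient by coefficient.
  The constant \<open>Sum_any\<close> is \<open>0\<close> on families of infinite support; this never happens below, since
  there \<open>X s\<close> and \<open>Y s\<close> only contain monomials of standard degree \<open>s + 1\<close>.
\<close>

definition vector_field ::
    "(nat \<Rightarrow> super_series) \<Rightarrow> (nat \<Rightarrow> super_series) \<Rightarrow> super_series \<Rightarrow> super_series"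
  where "vector_field X Y F = Super_Series
    (\<lambda>m S. Sum_any (\<lambda>s. ss_coeff (X s * pd_u s F + Y s * pd_theta s F) m S))"

lemma ss_coeff_vector_field:
  "ss_coeff (vector_field X Y F) m S =
    Sum_any (\<lambda>s. ss_coeff (X s * pd_u s F + Y s * pd_theta s F) m S)"
  unfolding vector_field_def using ss_coeff by (subst Super_Series_inverse) auto

definition total_deriv :: "super_series \<Rightarrow> super_series"
  where "total_deriv = vector_field (\<lambda>s. jet_u (Suc s)) (\<lambda>s. theta (Suc s))"

definition D1 :: "super_series \<Rightarrow> super_series"
  where "D1 = vector_field (\<lambda>s. theta (Suc s)) (\<lambda>s. 0)"

definition D2 :: "super_series \<Rightarrow> super_series"
  where "D2 = vector_field
    (\<lambda>s. (total_deriv ^^ s) (jet_u 0 * theta 1 + (1/2) *\<^sub>R (jet_u 1 * theta 0)))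
    (\<lambda>s. (total_deriv ^^ s) ((1/2) *\<^sub>R (theta 0 * theta 1)))"

definition bidegree_part :: "int \<Rightarrow> int \<Rightarrow> super_series set"
  where "bidegree_part p d = {F. \<forall>m S. ss_coeff F m S \<noteq> 0 \<longrightarrow>
    int (card S) = p \<and> int (\<Sum>\<^sub># m + \<Sum>S) = d}"

section \<open>The complex of polynomials in \<open>\<lambda>\<close>\<close>

instantiation poly :: (real_vector) real_vector
begin

definition scaleR_poly :: "real \<Rightarrow> 'a poly \<Rightarrow> 'a poly"
  where "scaleR_poly r = map_poly (\<lambda>a. r *\<^sub>R a)"

instance
  by standard (simp_all add: scaleR_poly_def poly_eq_iff coeff_map_poly algebra_simps)

end

definition D_lambda :: "super_series poly \<Rightarrow> super_series poly"
  where "D_lambda P = map_poly D2 P - pCons 0 (map_poly D1 P)"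

lemma vector_field_0: "vector_field X Y 0 = 0"
proof -
  have "pd_u s 0 = 0" "pd_theta s 0 = 0" for s
    by (transfer, simp add: smooth_deriv_0 fun_eq_iff)+
  then have "ss_coeff (vector_field X Y 0) m S = 0" for m S
    by (simp add: ss_coeff_vector_field zero_super_series.rep_eq)
  then show ?thesis
    by (simp add: ss_coeff_inject[symmetric] fun_eq_iff zero_super_series.rep_eq)
qed

lemma coeff_D_lambda:
  "coeff (D_lambda P) k = D2 (coeff P k) - (case k of 0 \<Rightarrow> 0 | Suc j \<Rightarrow> D1 (coeff P j))"
  by (simp add: D_lambda_def D1_def D2_def coeff_map_poly vector_field_0 coeff_pCons split: nat.split)

definition lambda_bidegree_part :: "int \<Rightarrow> int \<Rightarrow> super_series poly set"
  where "lambda_bidegree_part p d = {P. \<forall>k. coeff P k \<in> bidegree_part p d}"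

definition cocycles :: "int \<Rightarrow> int \<Rightarrow> super_series poly set"
  where "cocycles p d = {P \<in> lambda_bidegree_part p d. D_lambda P = 0}"

definition coboundaries :: "int \<Rightarrow> int \<Rightarrow> super_series poly set"
  where "coboundaries p d = D_lambda ` lambda_bidegree_part (p - 1) (d - 1)"

section \<open>Quotient spaces and cohomology\<close>

definition quotient_space :: "'a::real_vector set \<Rightarrow> 'a set \<Rightarrow> 'a set set"
  where "quotient_space V W = (\<lambda>v. v +o W) ` V"

text \<open>
  The sum of cosets is their elementwise sum. For the scalar multiples of a coset of \<open>W\<close>,
  adding \<open>W\<close> is only needed for the scalar \<open>0\<close>.
\<close>

definition coset_scaleR :: "'a::real_vector set \<Rightarrow> real \<Rightarrow> 'a set \<Rightarrow> 'a set"
  where "coset_scaleR W r X = (\<lambda>x. r *\<^sub>R x) ` X + W"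

definition cohomology :: "int \<Rightarrow> int \<Rightarrow> super_series poly set set"
  where "cohomology p d = quotient_space (cocycles p d) (coboundaries p d)"

text \<open>
  The linear map \<open>\<phi>\<close> chooses representatives: the class of \<open>v\<close> in \<open>V / W\<close> corresponds to the
  cohomology class of \<open>\<phi> v\<close>, and this is an isomorphism of vector spaces.
\<close>

definition represents_cohomology ::
    "int \<Rightarrow> int \<Rightarrow> 'a::real_vector set \<Rightarrow> 'a set \<Rightarrow> ('a \<Rightarrow> super_series poly) \<Rightarrow> bool"
  where "represents_cohomology p d V W \<phi> \<longleftrightarrow>
    (\<exists>\<Phi>. bij_betw \<Phi> (quotient_space V W) (cohomology p d) \<and>
      (\<forall>X\<in>quotient_space V W. \<forall>Y\<in>quotient_space V W. \<Phi> (X + Y) = \<Phi> X + \<Phi> Y) \<and>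
      (\<forall>r. \<forall>X\<in>quotient_space V W.
        \<Phi> (coset_scaleR W r X) = coset_scaleR (coboundaries p d) r (\<Phi> X)) \<and>
      (\<forall>v\<in>V. \<Phi> (v +o W) = \<phi> v +o coboundaries p d))"

end

theory Submission
  imports Defs
begin

text \<open>
  The differential preserves \<open>d - p\<close>, which is at least \<open>-1\<close> on every monomial. For \<open>d \<le> p\<close> only
  eight monomials occur and the cohomology is computed by hand.

  Let \<open>d > p\<close> and \<open>w = u - \<lambda>\<close>. Let the weight of a monomial be twice the number of its factors
  \<open>u\<^sup>i\<close> with \<open>i \<ge> 1\<close> and \<open>\<theta>\<^sup>i\<close> with \<open>i \<ge> 2\<close>, plus one if it contains \<open>\<theta>\<^sup>0\<close>. The part of \<open>D\<^sub>\<lambda>\<close> which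
  preserves the weight is \<open>w K + \<theta>\<^sup>1 T\<close>, and the rest raises it. Here
  \<open>K = \<Sum>s\<ge>1. \<theta>\<^bsup>s+1\<^esup> \<partial>/\<partial>u\<^sup>s\<close> is a Koszul differential and \<open>T = w \<partial>/\<partial>u + c\<close>, where \<open>c\<close> multiplies
  a monomial with \<open>r\<close> factors \<open>u\<^sup>i\<close>, \<open>i \<ge> 1\<close>, by \<open>r + (d - p)/2 > 0\<close>. With the derivation
  \<open>\<nabla> = \<partial>/\<partial>u + \<partial>/\<partial>\<lambda>\<close>, which kills \<open>w\<close>, one has \<open>T = w \<nabla> + E\<close>, and \<open>E = c - w \<partial>/\<partial>\<lambda>\<close> is invertible
  on polynomials in \<open>\<lambda>\<close> and commutes with \<open>w K\<close>. Together with the contracting homotopy of \<open>K\<close> this makes the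
  leading part acyclic. As \<open>D\<^sub>\<lambda>\<close> squares to zero and the weights in a fixed bidegree are bounded, \<open>D\<^sub>\<lambda>\<close> is
  exact as well.
\<close>

section \<open>Derivatives of smooth functions\<close>

text \<open>T contains w d/du, and inverting T itself would mean solving a differential equation in
  u that is singular at u = \<lambda>. Trading d/du for \<nabla> - d/d\<lambda> avoids this:
  \<nabla> only meets K-closed elements, whose \<nabla>-image is K-exact, and the remaining E is
  triangular in the powers of \<lambda> with diagonal entries c + k > 0.

  The weight counts theta^0 because D_2 contains u^(s+1) theta^0 d/du^s and theta^0 theta^(s+1)
  d/dtheta^s, which otherwise keep the number of counted generators and would belong to the leading
  part; no term of D_2 removes a theta^0 without restoring it. The doubling makes weight div 2 equal
  to the number of counted generators, the scalar produced by the Koszul homotopy.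

  The condition d > p enters twice: it makes c positive, and it forces every monomial to contain a
  counted generator, so that one may divide by that scalar.

  Since \<open>Sum_any\<close> is 0 on families of infinite support, additivity and the Leibniz
  rules for vector fields are proved for series of bounded standard degree; elements of a fixed
  bidegree are of this kind.\<close>

lemma smooth_eqI: "(\<And>x. apply_smooth f x = apply_smooth g x) \<Longrightarrow> f = g"
  by (simp add: apply_smooth_inject[symmetric] fun_eq_iff)

lemma smooth_real_apply: "smooth_real (apply_smooth f)"
  using apply_smooth[of f] by simp

lemma DERIV_apply_smooth:
  "(apply_smooth f has_field_derivative apply_smooth (smooth_deriv f) x) (at x)"
  using smooth_real_differentiable[OF smooth_real_apply, of f x]
  by (simp add: smooth_deriv.rep_eq DERIV_deriv_iff_real_differentiable)

lemma smooth_deriv_unique: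
  "(\<And>x. (apply_smooth f has_field_derivative apply_smooth g x) (at x)) \<Longrightarrow> smooth_deriv f = g"
  by (rule smooth_eqI) (metis DERIV_unique DERIV_apply_smooth)

lemma smooth_deriv_add: "smooth_deriv (f + g) = smooth_deriv f + smooth_deriv g"
  by (rule smooth_deriv_unique)
    (auto simp: plus_smooth.rep_eq intro!: derivative_eq_intros DERIV_apply_smooth)

lemma smooth_deriv_mult: "smooth_deriv (f * g) = smooth_deriv f * g + f * smooth_deriv g"
  by (rule smooth_deriv_unique)
    (auto simp: plus_smooth.rep_eq times_smooth.rep_eq algebra_simps
      intro!: derivative_eq_intros DERIV_apply_smooth)

lemma smooth_deriv_scaleR: "smooth_deriv (r *\<^sub>R f) = r *\<^sub>R smooth_deriv f"
  by (rule smooth_deriv_unique)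
    (auto simp: scaleR_smooth.rep_eq intro!: derivative_eq_intros DERIV_apply_smooth)

lemma linear_smooth_deriv: "linear smooth_deriv"
  by (rule linearI) (simp_all add: smooth_deriv_add smooth_deriv_scaleR)

lemma smooth_deriv_1 [simp]: "smooth_deriv 1 = 0"
  by (rule smooth_deriv_unique) (auto simp: one_smooth.rep_eq zero_smooth.rep_eq)

lemma smooth_deriv_coord [simp]: "smooth_deriv smooth_coord = 1"
  by (rule smooth_deriv_unique) (auto simp: one_smooth.rep_eq smooth_coord.rep_eq)

section \<open>Multiplication by generators and partial derivatives\<close>

lemmas coeff_simps [simp] =
  zero_super_series.rep_eq plus_super_series.rep_eq minus_super_series.rep_eq
  uminus_super_series.rep_eq scaleR_super_series.rep_eq

lemma ss_coeff_sum [simp]: "ss_coeff (\<Sum>i\<in>I. f i) m S = (\<Sum>i\<in>I. ss_coeff (f i) m S)"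
  by (induction I rule: infinite_finite_induct) auto

lemma coeff_unsupported: "0 \<in># m \<or> infinite S \<Longrightarrow> ss_coeff F m S = 0"
  using ss_coeff[of F] by (auto simp: super_monomials_def)

lemma super_series_eqI:
  "(\<And>m S. 0 \<notin># m \<Longrightarrow> finite S \<Longrightarrow> ss_coeff F m S = ss_coeff G m S) \<Longrightarrow> F = G"
  by (rule ss_eqI) (metis coeff_unsupported)

text \<open>A single splitting of \<open>(m, S)\<close> survives in the convolution, so multiplying
  by a generator is a signed shift of coefficients. The commutation rules of generators and partial
  derivatives are read off from the instances of this formula.\<close>

lemma coeff_monomial_times:
  assumes M: "\<And>k T. ss_coeff M k T = (if k = k0 \<and> T = T0 then x else 0)"
  shows "ss_coeff (M * F) m S = (if k0 \<subseteq># m \<and> T0 \<subseteq> S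
    then shuffle_sign T0 (S - T0) *\<^sub>R (x * ss_coeff F (m - k0) (S - T0)) else 0)"
proof (cases "finite S")
  case True
  have "ss_coeff (M * F) m S = (\<Sum>y\<in>{k. k \<subseteq># m} \<times> Pow S. if y = (k0, T0)
      then shuffle_sign T0 (S - T0) *\<^sub>R (x * ss_coeff F (m - k0) (S - T0)) else 0)"
    unfolding coeff_times by (rule sum.cong) (auto simp: M split: if_splits)
  also have "\<dots> = (if (k0, T0) \<in> {k. k \<subseteq># m} \<times> Pow S
      then shuffle_sign T0 (S - T0) *\<^sub>R (x * ss_coeff F (m - k0) (S - T0)) else 0)"
    using True finite_submultisets[of m] by (intro sum.delta) auto
  finally show ?thesis by auto
next
  case False
  \<comment> \<open>An infinite \<open>S\<close> carries no coefficient: either \<open>T0\<close> is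
    infinite, and then x = 0, or \<open>S - T0\<close> is infinite and the coefficient of
    \<open>F\<close> vanishes.\<close>
  then have "x = 0 \<or> infinite (S - T0)"
    using M[of k0 T0] coeff_unsupported[of k0 T0 M] by (metis finite_Diff2)
  with False show ?thesis by (auto simp: coeff_unsupported)
qed

lemma coeff_theta_times: "ss_coeff (theta t * F) m S =
  (if t \<in> S then shuffle_sign {t} (S - {t}) *\<^sub>R ss_coeff F m (S - {t}) else 0)"
  by (subst coeff_monomial_times[where ?k0.0 = "{#}" and ?T0.0 = "{t}" and x = 1])
    (auto simp: theta.rep_eq)

lemma coeff_jet_times: "0 < t \<Longrightarrow> ss_coeff (jet_u t * F) m S =
  (if t \<in># m then ss_coeff F (m - {#t#}) S else 0)"
  by (subst coeff_monomial_times[where ?k0.0 = "{#t#}" and ?T0.0 = "{}" and x = 1])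
    (auto simp: jet_u.rep_eq)

lemma coeff_const_times: "ss_coeff (ss_const f * F) m S = f * ss_coeff F m S"
  by (subst coeff_monomial_times[where ?k0.0 = "{#}" and ?T0.0 = "{}" and x = f])
    (auto simp: ss_const.rep_eq)

lemma jet_0: "jet_u 0 = ss_const smooth_coord"
  by (rule ss_eqI) (simp add: jet_u.rep_eq ss_const.rep_eq)

lemma coeff_pd_u: "0 < s \<Longrightarrow>
    ss_coeff (pd_u s F) m S = real (Suc (count m s)) *\<^sub>R ss_coeff F (add_mset s m) S"
  "ss_coeff (pd_u 0 F) m S = smooth_deriv (ss_coeff F m S)"
  by (simp_all add: pd_u.rep_eq)

text \<open>The new element adds the one pair (t, s), which is an inversion exactly when s < t. This
  is the source of all signs below.\<close>

lemma shuffle_sign_insert: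
  assumes "finite S" "s \<notin> S"
  shows "shuffle_sign {t} (insert s S) = (if s < t then -1 else 1) * shuffle_sign {t} S"
proof -
  have "{(i, j). i = t \<and> j = s \<and> j < i} = (if s < t then {(t, s)} else {})"
    by auto
  then have "shuffle_sign {t} {s} = (if s < t then -1 else 1)"
    by (simp add: shuffle_sign_def)
  with shuffle_sign_Un_right[of "{s}" S "{t}"] assms show ?thesis by simp
qed

lemma shuffle_sign_square [simp]: "shuffle_sign S T * shuffle_sign S T = 1"
  by (simp add: shuffle_sign_def flip: power_add mult_2)

lemma linear_pd_u: "linear (pd_u s)"
  by (rule linearI) (auto intro!: ss_eqI simp: pd_u.rep_eq smooth_deriv_add smooth_deriv_scaleR algebra_simps)

lemma linear_pd_theta: "linear (pd_theta s)"
  by (rule linearI) (auto intro!: ss_eqI simp: pd_theta.rep_eq algebra_simps)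

lemma theta_square: "theta s * (theta s * F) = 0"
  by (rule super_series_eqI) (simp add: coeff_theta_times)

lemma theta_anticommute: "theta s * (theta t * F) = - (theta t * (theta s * F))"
proof (cases "s = t")
  case False
  show ?thesis
  proof (rule super_series_eqI)
    fix m S assume S: "finite (S :: nat set)"
    show "ss_coeff (theta s * (theta t * F)) m S = ss_coeff (- (theta t * (theta s * F))) m S"
    proof (cases "s \<in> S \<and> t \<in> S")
      case True
      \<comment> \<open>Relative to \<open>R\<close> both orders carry the same signs, except that
        exactly one of them meets the extra inversion between s and t.\<close>
      define R where "R = S - {s, t}"
      have R: "S - {s} = insert t R" "S - {t} = insert s R" "finite R" "s \<notin> R" "t \<notin> R"
        "S - {s} - {t} = R" "S - {t} - {s} = R" "insert t R - {t} = R" "insert s R - {s} = R"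
        using True S False by (auto simp: R_def)
      show ?thesis using True False
        by (auto simp: coeff_theta_times R shuffle_sign_insert)
    qed (use False in \<open>auto simp: coeff_theta_times\<close>)
  qed
qed (simp add: theta_square)

lemma const_theta: "ss_const f * (theta t * F) = theta t * (ss_const f * F)"
  by (rule super_series_eqI) (simp add: coeff_theta_times coeff_const_times)

lemma const_jet: "ss_const f * (jet_u t * F) = jet_u t * (ss_const f * F)"
  by (cases "t = 0"; rule super_series_eqI)
    (simp_all add: jet_0 coeff_jet_times coeff_const_times mult.left_commute)

lemma jet_theta: "jet_u s * (theta t * F) = theta t * (jet_u s * F)"
  by (cases "s = 0"; rule super_series_eqI)
    (auto simp: const_theta jet_0 coeff_theta_times coeff_jet_times coeff_const_times)

lemma jet_jet: "jet_u s * (jet_u t * F) = jet_u t * (jet_u s * F)"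
proof (cases "s = 0 \<or> t = 0")
  case True
  then show ?thesis by (metis const_jet jet_0)
next
  case False
  then show ?thesis
    by (cases "s = t"; intro super_series_eqI)
      (auto simp: coeff_jet_times add_mset_commute dest: in_diffD simp: in_diff_count)
qed

lemma pd_u_theta: "pd_u s (theta t * F) = theta t * pd_u s F"
  by (cases "s = 0"; rule super_series_eqI)
    (simp_all add: coeff_pd_u coeff_theta_times smooth_deriv_scaleR smooth_deriv_0 mult.commute)

lemma pd_u_const: "pd_u s (ss_const f * F) =
  (if s = 0 then ss_const (smooth_deriv f) * F else 0) + ss_const f * pd_u s F"
  by (cases "s = 0"; rule super_series_eqI)
    (simp_all add: coeff_pd_u coeff_const_times smooth_deriv_mult)

lemma ss_const_1 [simp]: "ss_const 1 = 1"
  by (rule super_series_eqI) (simp add: ss_const.rep_eq one_super_series.rep_eq)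

lemma pd_u_jet: "pd_u s (jet_u t * F) = (if s = t then F else 0) + jet_u t * pd_u s F"
proof (cases "t = 0")
  case True
  then show ?thesis by (auto simp: jet_0 pd_u_const)
next
  case False
  show ?thesis
  proof (rule super_series_eqI)
    fix m :: "nat multiset" and S :: "nat set"
    assume m: "0 \<notin># m"
    consider "s = 0" | "s \<noteq> 0" "s \<noteq> t" | "s \<noteq> 0" "s = t" by blast
    then show "ss_coeff (pd_u s (jet_u t * F)) m S =
        ss_coeff ((if s = t then F else 0) + jet_u t * pd_u s F) m S"
    proof cases
      case 1
      with False show ?thesis
        by (simp add: coeff_jet_times coeff_pd_u smooth_deriv_0)
    next
      case 2
      with False show ?thesis
        by (auto simp: coeff_jet_times coeff_pd_u)
    next
      case 3
      \<comment> \<open>The exponent before removing u^t is one larger than after; this extra 1 is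
        the Leibniz term \<open>F\<close>.\<close>
      have "count m t = Suc (count (m - {#t#}) t)" if "t \<in># m"
        using that by (metis count_add_mset insert_DiffM)
      with False 3 show ?thesis
        by (auto simp: coeff_jet_times coeff_pd_u algebra_simps not_in_iff)
    qed
  qed
qed

lemma pd_theta_theta: "pd_theta s (theta t * F) = (if s = t then F else 0) - theta t * pd_theta s F"
proof (rule super_series_eqI)
  fix m S assume S: "finite (S :: nat set)"
  consider "s = t" "s \<in> S" | "s = t" "s \<notin> S" | "s \<noteq> t" "s \<in> S" | "s \<noteq> t" "s \<notin> S" "t \<notin> S"
    | "s \<noteq> t" "s \<notin> S" "t \<in> S" by blast
  then show "ss_coeff (pd_theta s (theta t * F)) m S =
      ss_coeff ((if s = t then F else 0) - theta t * pd_theta s F) m S"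
  proof cases
    case 5
    define R where "R = S - {t}"
    have R: "S = insert t R" "t \<notin> R" "s \<notin> R" "insert s (insert t R) - {t} = insert s R" "finite R"
      using 5 S by (auto simp: R_def)
    from 5 R show ?thesis
      by (auto simp: coeff_theta_times pd_theta.rep_eq shuffle_sign_insert)
  next
    case 1
    then show ?thesis
      by (auto simp: coeff_theta_times pd_theta.rep_eq insert_absorb)
  qed (auto simp: coeff_theta_times pd_theta.rep_eq)
qed

lemma pd_theta_const: "pd_theta s (ss_const f * F) = ss_const f * pd_theta s F"
  by (rule super_series_eqI) (simp add: coeff_const_times pd_theta.rep_eq)

lemma pd_theta_jet: "pd_theta s (jet_u t * F) = jet_u t * pd_theta s F"
  by (cases "t = 0"; rule super_series_eqI)
    (auto simp: jet_0 coeff_jet_times coeff_const_times pd_theta.rep_eq)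

lemma pd_u_commute: "pd_u s (pd_u t F) = pd_u t (pd_u s F)"
  by (cases "s = 0"; cases "t = 0"; cases "s = t"; rule super_series_eqI)
    (simp_all add: coeff_pd_u smooth_deriv_scaleR add_mset_commute)

lemma pd_u_pd_theta: "pd_u s (pd_theta t F) = pd_theta t (pd_u s F)"
  by (cases "s = 0"; rule super_series_eqI)
    (simp_all add: coeff_pd_u pd_theta.rep_eq smooth_deriv_scaleR smooth_deriv_0)

lemma pd_theta_anticommute: "pd_theta s (pd_theta t F) = - pd_theta t (pd_theta s F)"
proof (rule super_series_eqI)
  fix m S assume S: "finite (S :: nat set)"
  show "ss_coeff (pd_theta s (pd_theta t F)) m S = ss_coeff (- pd_theta t (pd_theta s F)) m S"
  proof (cases "s \<noteq> t \<and> s \<notin> S \<and> t \<notin> S")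
    case True
    with S show ?thesis
      by (auto simp: pd_theta.rep_eq shuffle_sign_insert insert_commute)
  qed (auto simp: pd_theta.rep_eq)
qed

section \<open>Gradings\<close>

definition weight :: "(nat \<Rightarrow> int) \<Rightarrow> (nat \<Rightarrow> int) \<Rightarrow> nat multiset \<Rightarrow> nat set \<Rightarrow> int"
  where "weight \<alpha> \<beta> m S = (\<Sum>i\<in>#m. \<alpha> i) + (\<Sum>s\<in>S. \<beta> s)"

text \<open>A set of admissible weights covers all uses at once: \<open>{v}\<close> for homogeneity,
  \<open>{f..}\<close> for the filtration, \<open>{..<n}\<close> for bounded degree.\<close>

definition graded :: "(nat \<Rightarrow> int) \<Rightarrow> (nat \<Rightarrow> int) \<Rightarrow> int set \<Rightarrow> super_series \<Rightarrow> bool"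
  where "graded \<alpha> \<beta> V F \<longleftrightarrow>
    (\<forall>m S. 0 \<notin># m \<longrightarrow> finite S \<longrightarrow> ss_coeff F m S \<noteq> 0 \<longrightarrow> weight \<alpha> \<beta> m S \<in> V)"

lemma gradedD:
  "graded \<alpha> \<beta> V F \<Longrightarrow> ss_coeff F m S \<noteq> 0 \<Longrightarrow> weight \<alpha> \<beta> m S \<in> V"
  unfolding graded_def by (metis coeff_unsupported)

lemma graded_mono: "graded \<alpha> \<beta> V F \<Longrightarrow> V \<subseteq> V' \<Longrightarrow> graded \<alpha> \<beta> V' F"
  by (auto simp: graded_def)

lemma graded_0 [simp]: "graded \<alpha> \<beta> V 0"
  by (simp add: graded_def)

lemma graded_add: "graded \<alpha> \<beta> V F \<Longrightarrow> graded \<alpha> \<beta> V G \<Longrightarrow> graded \<alpha> \<beta> V (F + G)"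
  unfolding graded_def by (metis add.right_neutral plus_super_series.rep_eq)

lemma graded_scaleR: "graded \<alpha> \<beta> V F \<Longrightarrow> graded \<alpha> \<beta> V (r *\<^sub>R F)"
  by (auto simp: graded_def)

lemma graded_uminus: "graded \<alpha> \<beta> V F \<Longrightarrow> graded \<alpha> \<beta> V (- F)"
  by (auto simp: graded_def)

lemma graded_diff: "graded \<alpha> \<beta> V F \<Longrightarrow> graded \<alpha> \<beta> V G \<Longrightarrow> graded \<alpha> \<beta> V (F - G)"
  using graded_add[OF _ graded_uminus] by simp

lemma graded_sum: "(\<And>i. i \<in> I \<Longrightarrow> graded \<alpha> \<beta> V (f i)) \<Longrightarrow> graded \<alpha> \<beta> V (\<Sum>i\<in>I. f i)"
  by (induction I rule: infinite_finite_induct) (auto intro: graded_add)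

lemma graded_disjoint: "graded \<alpha> \<beta> V F \<Longrightarrow> graded \<alpha> \<beta> V' F \<Longrightarrow> V \<inter> V' = {} \<Longrightarrow> F = 0"
  by (rule super_series_eqI) (metis IntI empty_iff gradedD zero_super_series.rep_eq)

lemma weight_add:
  "finite S \<Longrightarrow> k \<subseteq># m \<Longrightarrow> T \<subseteq> S \<Longrightarrow>
    weight \<alpha> \<beta> m S = weight \<alpha> \<beta> k T + weight \<alpha> \<beta> (m - k) (S - T)"
  by (simp add: weight_def sum.subset_diff[of T S] sum_mset.union[symmetric]
      image_mset_union[symmetric] del: image_mset_union sum_mset.union)

lemma graded_times:
  assumes "graded \<alpha> \<beta> V F" "graded \<alpha> \<beta> V' G" "\<And>x y. x \<in> V \<Longrightarrow> y \<in> V' \<Longrightarrow> x + y \<in> V''"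
  shows "graded \<alpha> \<beta> V'' (F * G)"
  unfolding graded_def
proof (intro allI impI)
  fix m S assume mS: "0 \<notin># m" "finite (S :: nat set)" "ss_coeff (F * G) m S \<noteq> 0"
  from mS(3) obtain y where y: "y \<in> {k. k \<subseteq># m} \<times> Pow S" "(case y of (k, T) \<Rightarrow>
      shuffle_sign T (S - T) *\<^sub>R (ss_coeff F k T * ss_coeff G (m - k) (S - T))) \<noteq> 0"
    unfolding coeff_times by (rule sum.not_neutral_contains_not_neutral)
  obtain k T where "y = (k, T)" by (cases y)
  with y have kT: "k \<subseteq># m" "T \<subseteq> S" "ss_coeff F k T * ss_coeff G (m - k) (S - T) \<noteq> 0"
    by auto
  then have "ss_coeff F k T \<noteq> 0" "ss_coeff G (m - k) (S - T) \<noteq> 0"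
    by auto
  with assms(1,2) have "weight \<alpha> \<beta> k T \<in> V" "weight \<alpha> \<beta> (m - k) (S - T) \<in> V'"
    by (auto dest: gradedD)
  with assms(3) weight_add[OF mS(2) kT(1,2)] show "weight \<alpha> \<beta> m S \<in> V''" by simp
qed

lemma graded_theta: "\<beta> t \<in> V \<Longrightarrow> graded \<alpha> \<beta> V (theta t)"
  by (auto simp: graded_def theta.rep_eq weight_def split: if_splits)

lemma graded_jet: "\<alpha> 0 = 0 \<Longrightarrow> \<alpha> t \<in> V \<Longrightarrow> graded \<alpha> \<beta> V (jet_u t)"
  by (auto simp: graded_def jet_u.rep_eq weight_def split: if_splits)

lemma graded_const: "0 \<in> V \<Longrightarrow> graded \<alpha> \<beta> V (ss_const f)"
  by (auto simp: graded_def ss_const.rep_eq weight_def split: if_splits)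

lemma graded_theta_times:
  "graded \<alpha> \<beta> V F \<Longrightarrow> (\<And>x. x \<in> V \<Longrightarrow> x + \<beta> t \<in> V') \<Longrightarrow> graded \<alpha> \<beta> V' (theta t * F)"
  by (rule graded_times[OF graded_theta[of _ _ "{\<beta> t}"]]) (auto simp: add.commute)

lemma graded_jet_times:
  "graded \<alpha> \<beta> V F \<Longrightarrow> \<alpha> 0 = 0 \<Longrightarrow> (\<And>x. x \<in> V \<Longrightarrow> x + \<alpha> t \<in> V') \<Longrightarrow> graded \<alpha> \<beta> V' (jet_u t * F)"
  by (rule graded_times[OF graded_jet[of _ _ "{\<alpha> t}"]]) (auto simp: add.commute)

lemma graded_const_times: "graded \<alpha> \<beta> V F \<Longrightarrow> graded \<alpha> \<beta> V (ss_const f * F)"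
  by (rule graded_times[OF graded_const[of "{0}"]]) auto

lemma graded_pd_u:
  "graded \<alpha> \<beta> V F \<Longrightarrow> \<alpha> 0 = 0 \<Longrightarrow> (\<And>x. x \<in> V \<Longrightarrow> x - \<alpha> s \<in> V') \<Longrightarrow> graded \<alpha> \<beta> V' (pd_u s F)"
  unfolding graded_def
proof (intro allI impI)
  fix m S assume F: "\<forall>m S. 0 \<notin># m \<longrightarrow> finite S \<longrightarrow> ss_coeff F m S \<noteq> 0 \<longrightarrow> weight \<alpha> \<beta> m S \<in> V"
    and *: "\<alpha> 0 = 0" "\<And>x. x \<in> V \<Longrightarrow> x - \<alpha> s \<in> V'" "0 \<notin># m" "finite S" "ss_coeff (pd_u s F) m S \<noteq> 0"
  show "weight \<alpha> \<beta> m S \<in> V'"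
  proof (cases "s = 0")
    case True
    with * have "ss_coeff F m S \<noteq> 0" by (auto simp: pd_u.rep_eq smooth_deriv_0)
    with F * True show ?thesis by force
  next
    case False
    with * have "ss_coeff F (add_mset s m) S \<noteq> 0" by (auto simp: pd_u.rep_eq)
    with F * False have "weight \<alpha> \<beta> (add_mset s m) S - \<alpha> s \<in> V'" by force
    then show ?thesis by (simp add: weight_def)
  qed
qed

lemma graded_pd_theta:
  "graded \<alpha> \<beta> V F \<Longrightarrow> (\<And>x. x \<in> V \<Longrightarrow> x - \<beta> s \<in> V') \<Longrightarrow> graded \<alpha> \<beta> V' (pd_theta s F)"
  unfolding graded_def
proof (intro allI impI)
  fix m S assume F: "\<forall>m S. 0 \<notin># m \<longrightarrow> finite S \<longrightarrow> ss_coeff F m S \<noteq> 0 \<longrightarrow> weight \<alpha> \<beta> m S \<in> V"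
    and *: "\<And>x. x \<in> V \<Longrightarrow> x - \<beta> s \<in> V'" "0 \<notin># m" "finite S" "ss_coeff (pd_theta s F) m S \<noteq> 0"
  then have s: "s \<notin> S" and "ss_coeff F m (insert s S) \<noteq> 0"
    by (auto simp: pd_theta.rep_eq split: if_splits)
  with F * have "weight \<alpha> \<beta> m (insert s S) - \<beta> s \<in> V'" by force
  with s \<open>finite S\<close> show "weight \<alpha> \<beta> m S \<in> V'" by (simp add: weight_def)
qed

section \<open>Series of bounded standard degree\<close>

definition finite_degree :: "super_series \<Rightarrow> bool"
  where "finite_degree F \<longleftrightarrow> (\<exists>n. graded int int {..<int n} F)"

text \<open>Raising the bound past \<open>N\<close> ensures that a prescribed generator index lies
  within the finite sum that replaces a vector field.\<close>

lemma finite_degree_bound: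
  assumes "finite_degree F"
  obtains n where "graded int int {..<int n} F" "N \<le> n"
proof -
  obtain n where "graded int int {..<int n} F" using assms by (auto simp: finite_degree_def)
  then have "graded int int {..<int (max n N)} F" by (rule graded_mono) auto
  then show ?thesis by (rule that) simp
qed

lemma graded_finite_degree: "graded int int {..<d} F \<Longrightarrow> finite_degree F"
  unfolding finite_degree_def by (rule exI[of _ "nat d"]) (auto elim: graded_mono)

lemma finite_degree_0: "finite_degree 0"
  by (auto simp: finite_degree_def)

lemma finite_degree_add: "finite_degree F \<Longrightarrow> finite_degree G \<Longrightarrow> finite_degree (F + G)"
proof -
  assume F: "finite_degree F" and "finite_degree G"
  then obtain n where n: "graded int int {..<int n} G" by (auto simp: finite_degree_def)
  from F obtain k where k: "graded int int {..<int k} F" "n \<le> k" by (rule finite_degree_bound)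
  from n k(2) have "graded int int {..<int k} G" by (auto elim: graded_mono)
  with k show ?thesis by (auto simp: finite_degree_def intro: graded_add)
qed

lemma finite_degree_scaleR: "finite_degree F \<Longrightarrow> finite_degree (r *\<^sub>R F)"
  by (auto simp: finite_degree_def intro: graded_scaleR)

lemma finite_degree_uminus: "finite_degree F \<Longrightarrow> finite_degree (- F)"
  by (auto simp: finite_degree_def intro: graded_uminus)

lemma finite_degree_diff: "finite_degree F \<Longrightarrow> finite_degree G \<Longrightarrow> finite_degree (F - G)"
  using finite_degree_add[OF _ finite_degree_uminus] by simp

lemma finite_degree_sum: "(\<And>i. i \<in> I \<Longrightarrow> finite_degree (f i)) \<Longrightarrow> finite_degree (\<Sum>i\<in>I. f i)"
  by (induction I rule: infinite_finite_induct) (auto intro: finite_degree_add finite_degree_0)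

lemma finite_degree_times: "finite_degree F \<Longrightarrow> finite_degree G \<Longrightarrow> finite_degree (F * G)"
  unfolding finite_degree_def
proof (elim exE)
  fix k n assume "graded int int {..<int k} F" "graded int int {..<int n} G"
  then have "graded int int {..<int (k + n)} (F * G)" by (rule graded_times) auto
  then show "\<exists>n. graded int int {..<int n} (F * G)" by blast
qed

lemma finite_degree_gens:
  "finite_degree (theta t)" "finite_degree (jet_u t)" "finite_degree (ss_const f)" "finite_degree 1"
proof -
  show "finite_degree (theta t)" "finite_degree (jet_u t)" "finite_degree (ss_const f)" for f
    unfolding finite_degree_def
    by (auto intro!: exI[of _ "Suc t"] graded_theta graded_jet graded_const)
  from this(3)[of 1] show "finite_degree 1" by simp
qed

lemma finite_degree_pd:
  assumes "finite_degree F"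
  shows "finite_degree (pd_u s F)" "finite_degree (pd_theta s F)"
proof -
  from assms obtain n where n: "graded int int {..<int n} F" by (auto simp: finite_degree_def)
  have "graded int int {..<int n} (pd_u s F)" "graded int int {..<int n} (pd_theta s F)"
    by (auto intro!: graded_pd_u[OF n] graded_pd_theta[OF n])
  then show "finite_degree (pd_u s F)" "finite_degree (pd_theta s F)"
    by (auto simp: finite_degree_def)
qed

lemmas finite_degree_intros = finite_degree_0 finite_degree_add finite_degree_scaleR
  finite_degree_uminus finite_degree_diff finite_degree_sum finite_degree_times
  finite_degree_gens finite_degree_pd

section \<open>Vector fields on series of bounded degree\<close>

lemma sum_mset_nonneg_int: "(\<And>i. i \<in># m \<Longrightarrow> 0 \<le> f i) \<Longrightarrow> 0 \<le> (\<Sum>i\<in>#m. f i :: int)"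
  by (induction m) auto

text \<open>A derivative of index s lowers the standard degree by s, here below 0, where there is no
  monomial.\<close>

lemma pd_eq_0:
  assumes F: "graded int int {..<int n} F" and s: "n \<le> s"
  shows "pd_u s F = 0" "pd_theta s F = 0"
proof -
  have nn: "0 \<le> weight int int m S" for m S
    unfolding weight_def by (intro add_nonneg_nonneg sum_mset_nonneg_int sum_nonneg) auto
  have "graded int int {..<0} (pd_u s F)" "graded int int {..<0} (pd_theta s F)"
    using s by (auto intro!: graded_pd_u[OF F] graded_pd_theta[OF F])
  moreover have "graded int int {0..} G" for G
    using nn by (auto simp: graded_def)
  ultimately show "pd_u s F = 0" "pd_theta s F = 0"
    by (auto intro!: graded_disjoint[of int int "{..<0}" _ "{0..}"])
qed

text \<open>On bounded degree \<open>Sum_any\<close> is an honest finite sum; linearity and the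
  Leibniz rules are derived through this form.\<close>

lemma vector_field_eq_sum:
  assumes F: "graded int int {..<int n} F"
  shows "vector_field X Y F = (\<Sum>s<n. X s * pd_u s F + Y s * pd_theta s F)"
proof (rule ss_eqI)
  fix m S
  have "ss_coeff (X s * pd_u s F + Y s * pd_theta s F) m S = 0" if "n \<le> s" for s
    using pd_eq_0[OF F that] by simp
  then have "{s. ss_coeff (X s * pd_u s F + Y s * pd_theta s F) m S \<noteq> 0} \<subseteq> {..<n}"
    unfolding subset_iff mem_Collect_eq lessThan_iff not_le[symmetric] by blast
  then show "ss_coeff (vector_field X Y F) m S =
      ss_coeff (\<Sum>s<n. X s * pd_u s F + Y s * pd_theta s F) m S"
    unfolding ss_coeff_vector_field by (subst Sum_any.expand_superset[of "{..<n}"]) auto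
qed

lemma vector_field_add:
  assumes "finite_degree F" "finite_degree G"
  shows "vector_field X Y (F + G) = vector_field X Y F + vector_field X Y G"
proof -
  from assms(1) obtain n where "graded int int {..<int n} F" by (auto simp: finite_degree_def)
  from finite_degree_bound[OF assms(2), where N = n] obtain k where
    k: "graded int int {..<int k} G" "n \<le> k" by blast
  have "graded int int {..<int k} F"
    using \<open>graded int int {..<int n} F\<close> k(2) by (auto elim: graded_mono)
  with k graded_add[OF this k(1)] show ?thesis
    by (simp add: vector_field_eq_sum[of k] linear_add[OF linear_pd_u] linear_add[OF linear_pd_theta]
        sum.distrib distrib_left)
qed

lemma vector_field_scaleR:
  assumes "finite_degree F"
  shows "vector_field X Y (r *\<^sub>R F) = r *\<^sub>R vector_field X Y F"
proof -
  from assms obtain n where "graded int int {..<int n} F" by (auto simp: finite_degree_def)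
  with graded_scaleR[OF this, of r] show ?thesis
    by (simp add: vector_field_eq_sum[of n] linear_scale[OF linear_pd_u]
        linear_scale[OF linear_pd_theta] scaleR_sum_right scaleR_add_right)
qed

lemma vector_field_uminus:
  "finite_degree F \<Longrightarrow> vector_field X Y (- F) = - vector_field X Y F"
  using vector_field_scaleR[of F X Y "-1"] by simp

lemma vector_field_diff:
  "finite_degree F \<Longrightarrow> finite_degree G \<Longrightarrow>
    vector_field X Y (F - G) = vector_field X Y F - vector_field X Y G"
  using vector_field_add[of F "- G"] by (simp add: vector_field_uminus finite_degree_uminus)

lemma vector_field_sum:
  "(\<And>i. i \<in> I \<Longrightarrow> finite_degree (f i)) \<Longrightarrow>
    vector_field X Y (\<Sum>i\<in>I. f i) = (\<Sum>i\<in>I. vector_field X Y (f i))"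
  by (induction I rule: infinite_finite_induct)
    (auto simp: vector_field_0 vector_field_add finite_degree_sum)

lemmas vector_field_linear =
  vector_field_0 vector_field_add vector_field_scaleR vector_field_uminus
  vector_field_diff vector_field_sum

lemma vector_field_finite_degree:
  assumes "finite_degree F" "\<And>s. finite_degree (X s)" "\<And>s. finite_degree (Y s)"
  shows "finite_degree (vector_field X Y F)"
proof -
  from assms(1) obtain n where "graded int int {..<int n} F" by (auto simp: finite_degree_def)
  with assms show ?thesis
    by (auto simp: vector_field_eq_sum[of n] intro!: finite_degree_intros)
qed

lemma vector_field_const:
  assumes X: "\<And>s g. X s * ss_const g = ss_const g * X s"
    and Y: "\<And>s g. Y s * ss_const g = ss_const g * Y s"
    and G: "finite_degree G"
  shows "vector_field X Y (ss_const f * G) =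
    ss_const (smooth_deriv f) * (X 0 * G) + ss_const f * vector_field X Y G"
proof -
  from finite_degree_bound[OF G, where N = 1] obtain n where
    n: "graded int int {..<int n} G" "1 \<le> n" by blast
  have *: "X s * (ss_const g * H) = ss_const g * (X s * H)"
    "Y s * (ss_const g * H) = ss_const g * (Y s * H)" for s g H
    by (simp_all add: X Y flip: mult.assoc)
  have "vector_field X Y (ss_const f * G) = (\<Sum>s<n. (if s = 0 then ss_const (smooth_deriv f) * (X 0 * G) else 0)
      + ss_const f * (X s * pd_u s G + Y s * pd_theta s G))"
    unfolding vector_field_eq_sum[OF graded_const_times[OF n(1)]]
    by (rule sum.cong) (auto simp: pd_u_const pd_theta_const distrib_left *)
  also have "\<dots> = ss_const (smooth_deriv f) * (X 0 * G) + ss_const f * vector_field X Y G"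
    using n by (simp add: vector_field_eq_sum[OF n(1)] sum.distrib sum_distrib_left distrib_left)
  finally show ?thesis .
qed

lemma vector_field_jet:
  assumes X: "\<And>s. X s * jet_u t = jet_u t * X s" and Y: "\<And>s. Y s * jet_u t = jet_u t * Y s"
    and G: "finite_degree G"
  shows "vector_field X Y (jet_u t * G) = X t * G + jet_u t * vector_field X Y G"
proof -
  from finite_degree_bound[OF G, where N = "Suc t"] obtain k where
    k: "graded int int {..<int k} G" "Suc t \<le> k" by blast
  \<comment> \<open>The final bound \<open>n\<close> has to serve both \<open>G\<close> and the
    product, and to exceed \<open>t\<close>, so that the Leibniz term of index \<open>t\<close> is
    among the summands.\<close>
  from finite_degree_bound[OF finite_degree_times[OF finite_degree_gens(2)[of t] G], where N = k] obtain n where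
    n: "graded int int {..<int n} (jet_u t * G)" "k \<le> n" by blast
  have k': "graded int int {..<int n} G"
    using k(1) n(2) by (auto elim: graded_mono)
  have *: "X s * (jet_u t * H) = jet_u t * (X s * H)" "Y s * (jet_u t * H) = jet_u t * (Y s * H)" for s H
    by (simp_all add: X Y flip: mult.assoc)
  have "vector_field X Y (jet_u t * G) = (\<Sum>s<n. (if s = t then X t * G else 0)
      + jet_u t * (X s * pd_u s G + Y s * pd_theta s G))"
    unfolding vector_field_eq_sum[OF n(1)]
    by (rule sum.cong) (auto simp: pd_u_jet pd_theta_jet distrib_left *)
  also have "\<dots> = X t * G + jet_u t * vector_field X Y G"
    using k n by (simp add: vector_field_eq_sum[OF k'] sum.distrib sum_distrib_left distrib_left)
  finally show ?thesis .
qed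

text \<open>The sign \<open>\<epsilon>\<close> is \<open>1\<close> for an even and \<open>-1\<close> for an odd vector field.\<close>

lemma vector_field_theta:
  assumes X: "\<And>s. X s * theta t = \<epsilon> *\<^sub>R (theta t * X s)"
    and Y: "\<And>s. Y s * theta t = - (\<epsilon> *\<^sub>R (theta t * Y s))"
    and G: "finite_degree G"
  shows "vector_field X Y (theta t * G) = Y t * G + \<epsilon> *\<^sub>R (theta t * vector_field X Y G)"
proof -
  from finite_degree_bound[OF G, where N = "Suc t"] obtain k where
    k: "graded int int {..<int k} G" "Suc t \<le> k" by blast
  from finite_degree_bound[OF finite_degree_times[OF finite_degree_gens(1)[of t] G], where N = k] obtain n where
    n: "graded int int {..<int n} (theta t * G)" "k \<le> n" by blast
  have k': "graded int int {..<int n} G"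
    using k(1) n(2) by (auto elim: graded_mono)
  have *: "X s * (theta t * H) = \<epsilon> *\<^sub>R (theta t * (X s * H))"
    "Y s * (theta t * H) = - (\<epsilon> *\<^sub>R (theta t * (Y s * H)))" for s H
    by (simp_all add: X Y flip: mult.assoc)
  have "vector_field X Y (theta t * G) = (\<Sum>s<n. (if s = t then Y t * G else 0)
      + \<epsilon> *\<^sub>R (theta t * (X s * pd_u s G + Y s * pd_theta s G)))"
    unfolding vector_field_eq_sum[OF n(1)]
    by (rule sum.cong) (auto simp: pd_u_theta pd_theta_theta distrib_left right_diff_distrib * scaleR_add_right)
  also have "\<dots> = Y t * G + \<epsilon> *\<^sub>R (theta t * vector_field X Y G)"
    using k n by (simp add: vector_field_eq_sum[OF k'] sum.distrib sum_distrib_left distrib_left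
        scaleR_sum_right scaleR_add_right)
  finally show ?thesis .
qed

section \<open>Prolonged components of the second differential\<close>

lemma total_deriv_jet:
  "finite_degree G \<Longrightarrow> total_deriv (jet_u t * G) = jet_u (Suc t) * G + jet_u t * total_deriv G"
  unfolding total_deriv_def
  using jet_jet[of _ t 1] jet_theta[of t _ 1]
  by (subst vector_field_jet) auto

lemma total_deriv_theta:
  assumes "finite_degree G"
  shows "total_deriv (theta t * G) = theta (Suc t) * G + theta t * total_deriv G"
proof -
  have "vector_field (\<lambda>s. jet_u (Suc s)) (\<lambda>s. theta (Suc s)) (theta t * G) =
      theta (Suc t) * G + 1 *\<^sub>R (theta t * vector_field (\<lambda>s. jet_u (Suc s)) (\<lambda>s. theta (Suc s)) G)"
    using jet_theta[of _ t 1] theta_anticommute[of _ t 1]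
    by (intro vector_field_theta[OF _ _ assms]) auto
  then show ?thesis by (simp add: total_deriv_def)
qed

lemmas total_deriv_linear = vector_field_linear[where X = "\<lambda>s. jet_u (Suc s)" and
    Y = "\<lambda>s. theta (Suc s)", folded total_deriv_def]

lemma finite_degree_total_deriv: "finite_degree F \<Longrightarrow> finite_degree (total_deriv F)"
  unfolding total_deriv_def by (rule vector_field_finite_degree) (auto intro: finite_degree_intros)

lemma vector_field_1 [simp]: "vector_field X Y 1 = 0"
proof -
  have "pd_u s 1 = 0" "pd_theta s 1 = 0" for s
    by (rule super_series_eqI, simp add: pd_u.rep_eq pd_theta.rep_eq one_super_series.rep_eq smooth_deriv_0)+
  then show ?thesis
    using graded_const[of "{..<int 1}" int int 1] by (subst vector_field_eq_sum[of 1]) auto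
qed

lemma total_deriv_gens:
  "total_deriv (jet_u t) = jet_u (Suc t)" "total_deriv (theta t) = theta (Suc t)"
  using total_deriv_jet[of 1 t] total_deriv_theta[of 1 t]
  by (simp_all add: finite_degree_gens total_deriv_def)

definition D2_u :: "nat \<Rightarrow> super_series"
  where "D2_u s = (total_deriv ^^ s) (jet_u 0 * theta 1 + (1/2) *\<^sub>R (jet_u 1 * theta 0))"

definition D2_theta :: "nat \<Rightarrow> super_series"
  where "D2_theta s = (total_deriv ^^ s) ((1/2) *\<^sub>R (theta 0 * theta 1))"

lemma D2_alt: "D2 = vector_field D2_u D2_theta"
  by (simp add: D2_def D2_u_def[abs_def] D2_theta_def[abs_def])

text \<open>Coefficient of u^j theta^(s+1-j) in the s-th total derivative of u theta^1 + u^1 theta^0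
  / 2; the two binomials come from the Leibniz rule on the two summands.\<close>

definition D2_u_coeff :: "nat \<Rightarrow> nat \<Rightarrow> real"
  where "D2_u_coeff s j = real (s choose j) + (if j = 0 then 0 else real (s choose (j - 1)) / 2)"

text \<open>The total derivative raises either index of a bilinear term; collecting equal terms adds
  neighbouring coefficients as in Pascal's rule. The hypothesis allows the range to be extended by
  one.\<close>

lemma leibniz_sum:
  fixes c :: "nat \<Rightarrow> real" and g :: "nat \<Rightarrow> nat \<Rightarrow> 'a::real_vector"
  assumes "c (Suc n) = 0"
  shows "(\<Sum>j\<le>n. c j *\<^sub>R (g (Suc j) (n - j) + g j (Suc (n - j)))) =
    (\<Sum>j\<le>Suc n. (c j + (if j = 0 then 0 else c (j - 1))) *\<^sub>R g j (Suc n - j))"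
proof -
  have "(\<Sum>j\<le>Suc n. (c j + (if j = 0 then 0 else c (j - 1))) *\<^sub>R g j (Suc n - j)) =
      (\<Sum>j\<le>Suc n. c j *\<^sub>R g j (Suc n - j)) +
      (\<Sum>j\<le>Suc n. (if j = 0 then 0 else c (j - 1)) *\<^sub>R g j (Suc n - j))"
    by (simp only: scaleR_add_left sum.distrib)
  moreover have "(\<Sum>j\<le>Suc n. c j *\<^sub>R g j (Suc n - j)) = (\<Sum>j\<le>n. c j *\<^sub>R g j (Suc (n - j)))"
    using assms by (simp add: Suc_diff_le)
  moreover have "(\<Sum>j\<le>Suc n. (if j = 0 then 0 else c (j - 1)) *\<^sub>R g j (Suc n - j)) =
      (\<Sum>j\<le>n. c j *\<^sub>R g (Suc j) (n - j))"
    by (subst sum.atMost_Suc_shift) simp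
  ultimately show ?thesis
    by (simp add: scaleR_add_right sum.distrib add.commute)
qed

lemma total_deriv_jet_theta:
  "total_deriv (jet_u i * theta k) = jet_u (Suc i) * theta k + jet_u i * theta (Suc k)"
  "total_deriv (theta i * theta k) = theta (Suc i) * theta k + theta i * theta (Suc k)"
  by (simp_all add: total_deriv_jet total_deriv_theta total_deriv_gens finite_degree_gens)

lemma D2_u_Suc: "D2_u (Suc s) = total_deriv (D2_u s)"
  and D2_theta_Suc: "D2_theta (Suc s) = total_deriv (D2_theta s)"
  by (simp_all add: D2_u_def D2_theta_def)

lemma D2_u_eq: "D2_u s = (\<Sum>j\<le>Suc s. D2_u_coeff s j *\<^sub>R (jet_u j * theta (Suc s - j)))"
proof (induction s)
  case 0
  show ?case by (simp add: D2_u_def D2_u_coeff_def)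
next
  case (Suc s)
  have coeff: "D2_u_coeff s j + (if j = 0 then 0 else D2_u_coeff s (j - 1)) = D2_u_coeff (Suc s) j" for j
  proof (cases j)
    case (Suc i)
    then show ?thesis by (cases i) (auto simp: D2_u_coeff_def field_simps)
  qed (simp add: D2_u_coeff_def)
  have "D2_u (Suc s) = (\<Sum>j\<le>Suc s. D2_u_coeff s j *\<^sub>R
      (jet_u (Suc j) * theta (Suc s - j) + jet_u j * theta (Suc (Suc s - j))))"
    unfolding D2_u_Suc Suc
    by (simp only: total_deriv_linear finite_degree_intros total_deriv_jet_theta)
  also have "\<dots> = (\<Sum>j\<le>Suc (Suc s). (D2_u_coeff s j + (if j = 0 then 0 else D2_u_coeff s (j - 1))) *\<^sub>R
      (jet_u j * theta (Suc (Suc s) - j)))"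
    by (rule leibniz_sum) (simp add: D2_u_coeff_def binomial_eq_0)
  finally show ?case by (simp only: coeff)
qed

lemma D2_theta_eq: "D2_theta s = (\<Sum>j\<le>s. (real (s choose j) / 2) *\<^sub>R (theta j * theta (Suc s - j)))"
proof (induction s)
  case 0
  show ?case by (simp add: D2_theta_def)
next
  case (Suc s)
  have "D2_theta (Suc s) = (\<Sum>j\<le>s. (real (s choose j) / 2) *\<^sub>R
      (theta (Suc j) * theta (Suc (s - j)) + theta j * theta (Suc (Suc (s - j)))))"
    unfolding D2_theta_Suc Suc
    by (simp add: total_deriv_linear finite_degree_intros total_deriv_jet_theta Suc_diff_le)
  also have "\<dots> = (\<Sum>j\<le>Suc s. (real (s choose j) / 2 + (if j = 0 then 0 else real (s choose (j - 1)) / 2)) *\<^sub>R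
      (theta j * theta (Suc (Suc s - j))))"
    by (rule leibniz_sum) simp
  also have "\<dots> = (\<Sum>j\<le>Suc s. (real (Suc s choose j) / 2) *\<^sub>R (theta j * theta (Suc (Suc s) - j)))"
  proof (rule sum.cong)
    fix j assume "j \<in> {..Suc s}"
    then show "(real (s choose j) / 2 + (if j = 0 then 0 else real (s choose (j - 1)) / 2)) *\<^sub>R
      (theta j * theta (Suc (Suc s - j))) = (real (Suc s choose j) / 2) *\<^sub>R (theta j * theta (Suc (Suc s) - j))"
      by (cases j) (auto simp: Suc_diff_le field_simps)
  qed simp
  finally show ?case .
qed

lemma finite_degree_D2_gens: "finite_degree (D2_u s)" "finite_degree (D2_theta s)"
  unfolding D2_u_eq D2_theta_eq by (intro finite_degree_intros)+

lemma D2_u_times: "D2_u s * G = (\<Sum>j\<le>Suc s. D2_u_coeff s j *\<^sub>R (jet_u j * (theta (Suc s - j) * G)))"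
  by (simp only: D2_u_eq sum_distrib_right mult_scaleR_left mult.assoc)

lemma D2_theta_times:
  "D2_theta s * G = (\<Sum>j\<le>s. (real (s choose j) / 2) *\<^sub>R (theta j * (theta (Suc s - j) * G)))"
  by (simp only: D2_theta_eq sum_distrib_right mult_scaleR_left mult.assoc)

lemma theta_theta_theta: "theta i * (theta j * (theta k * G)) = theta k * (theta i * (theta j * G))"
  by (simp add: theta_anticommute[of _ k])

text \<open>\<open>D2_u s\<close> is linear and \<open>D2_theta s\<close> quadratic in the odd
  generators; this parity fixes the signs here and in the rules that follow.\<close>

lemma D2_u_theta: "D2_u s * (theta t * G) = - (theta t * (D2_u s * G))"
  by (simp only: D2_u_times sum_distrib_left mult_scaleR_right theta_anticommute[of _ t]
      jet_theta mult_minus_right scaleR_minus_right sum_negf)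

lemma D2_u_jet: "D2_u s * (jet_u t * G) = jet_u t * (D2_u s * G)"
  by (simp only: D2_u_times sum_distrib_left mult_scaleR_right jet_theta[of t, symmetric] jet_jet[of _ t])

lemma D2_u_const: "D2_u s * (ss_const f * G) = ss_const f * (D2_u s * G)"
  by (simp only: D2_u_times sum_distrib_left mult_scaleR_right const_jet const_theta)

lemma D2_theta_theta: "D2_theta s * (theta t * G) = theta t * (D2_theta s * G)"
  by (simp only: D2_theta_times sum_distrib_left mult_scaleR_right theta_theta_theta[of _ _ t])

lemma D2_theta_jet: "D2_theta s * (jet_u t * G) = jet_u t * (D2_theta s * G)"
  by (simp only: D2_theta_times sum_distrib_left mult_scaleR_right jet_theta)

lemma D2_theta_const: "D2_theta s * (ss_const f * G) = ss_const f * (D2_theta s * G)"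
  by (simp only: D2_theta_times sum_distrib_left mult_scaleR_right const_theta)

lemma D2_u_D2_u: "D2_u s * (D2_u t * G) = - (D2_u t * (D2_u s * G))"
  by (simp only: D2_u_times[of t] sum_distrib_left mult_scaleR_right D2_u_theta D2_u_jet
      mult_minus_right scaleR_minus_right sum_negf)

lemma D2_theta_D2_u: "D2_theta s * (D2_u t * G) = D2_u t * (D2_theta s * G)"
  by (simp only: D2_u_times[of t] sum_distrib_left mult_scaleR_right D2_theta_theta D2_theta_jet)

lemma D2_theta_D2_theta: "D2_theta s * (D2_theta t * G) = D2_theta t * (D2_theta s * G)"
  by (simp only: D2_theta_times[of t] sum_distrib_left mult_scaleR_right D2_theta_theta)

lemmas D2_linear = vector_field_linear[where X = D2_u and Y = D2_theta, folded D2_alt]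

lemma finite_degree_D2: "finite_degree F \<Longrightarrow> finite_degree (D2 F)"
  unfolding D2_alt by (rule vector_field_finite_degree) (auto intro: finite_degree_D2_gens)

lemma D2_jet_times: "finite_degree G \<Longrightarrow> D2 (jet_u t * G) = D2_u t * G + jet_u t * D2 G"
  unfolding D2_alt using D2_u_jet[of _ t 1] D2_theta_jet[of _ t 1]
  by (subst vector_field_jet) auto

lemma D2_const_times: "finite_degree G \<Longrightarrow>
  D2 (ss_const f * G) = ss_const (smooth_deriv f) * (D2_u 0 * G) + ss_const f * D2 G"
  unfolding D2_alt using D2_u_const[of _ _ 1] D2_theta_const[of _ _ 1]
  by (subst vector_field_const) auto

lemma D2_theta_mult: "finite_degree G \<Longrightarrow> D2 (theta t * G) = D2_theta t * G - theta t * D2 G"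
  unfolding D2_alt using D2_u_theta[of _ t 1] D2_theta_theta[of _ t 1]
  by (subst vector_field_theta[where \<epsilon> = "-1"]) auto

lemma D2_gens: "D2 (jet_u t) = D2_u t" "D2 (theta t) = D2_theta t"
  using D2_jet_times[of 1 t] D2_theta_mult[of 1 t]
  by (simp_all add: finite_degree_gens D2_alt)

lemma total_deriv_D2_u: "finite_degree G \<Longrightarrow>
  total_deriv (D2_u s * G) = D2_u (Suc s) * G + D2_u s * total_deriv G"
  by (simp add: D2_u_times[of s] D2_u_Suc D2_u_eq[of s] total_deriv_linear finite_degree_intros
      total_deriv_jet total_deriv_theta total_deriv_gens sum_distrib_right distrib_left distrib_right
      sum.distrib scaleR_add_right mult.assoc add_ac del: sum.atMost_Suc)

lemma total_deriv_D2_theta: "finite_degree G \<Longrightarrow>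
  total_deriv (D2_theta s * G) = D2_theta (Suc s) * G + D2_theta s * total_deriv G"
  by (simp add: D2_theta_times[of s] D2_theta_Suc D2_theta_eq[of s] total_deriv_linear finite_degree_intros
      total_deriv_jet total_deriv_theta total_deriv_gens sum_distrib_right distrib_left distrib_right
      sum.distrib scaleR_add_right mult.assoc add_ac)

text \<open>Commutation of \<open>D2\<close> with the total derivative is checked on products of two
  generators. \<open>D2_u s\<close> and \<open>D2_theta s\<close> are combinations of such products,
  so \<open>D2 (D2_u s) = 0\<close> and \<open>D2 (D2_theta s) = 0\<close> propagate from s = 0 to
  all s.\<close>

lemma D2_total_deriv_jet_theta:
  "D2 (total_deriv (jet_u i * theta k)) = total_deriv (D2 (jet_u i * theta k))"
  by (simp add: total_deriv_jet_theta D2_linear finite_degree_intros finite_degree_D2_gens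
      D2_jet_times D2_gens total_deriv_linear total_deriv_D2_u total_deriv_jet total_deriv_gens
      D2_theta_Suc algebra_simps)

lemma D2_total_deriv_theta_theta:
  "D2 (total_deriv (theta i * theta k)) = total_deriv (D2 (theta i * theta k))"
  by (simp add: total_deriv_jet_theta D2_linear finite_degree_intros finite_degree_D2_gens
      D2_theta_mult D2_gens total_deriv_linear total_deriv_D2_theta total_deriv_theta total_deriv_gens
      D2_theta_Suc algebra_simps)

lemma D2_total_deriv_D2_u: "D2 (total_deriv (D2_u s)) = total_deriv (D2 (D2_u s))"
  unfolding D2_u_eq[of s]
  by (simp only: D2_linear total_deriv_linear finite_degree_intros finite_degree_total_deriv
      finite_degree_D2 D2_total_deriv_jet_theta)

lemma D2_total_deriv_D2_theta: "D2 (total_deriv (D2_theta s)) = total_deriv (D2 (D2_theta s))"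
  unfolding D2_theta_eq[of s]
  by (simp only: D2_linear total_deriv_linear finite_degree_intros finite_degree_total_deriv
      finite_degree_D2 D2_total_deriv_theta_theta)

lemma D2_D2_u: "D2 (D2_u s) = 0"
proof (induction s)
  case 0
  have *: "D2_u 0 = jet_u 0 * theta 1 + (1/2) *\<^sub>R (jet_u 1 * theta 0)"
    "D2_u (Suc 0) = jet_u 0 * theta 2 + (3/2) *\<^sub>R (jet_u 1 * theta 1) + (1/2) *\<^sub>R (jet_u 2 * theta 0)"
    "D2_theta 0 = (1/2) *\<^sub>R (theta 0 * theta 1)" "D2_theta (Suc 0) = (1/2) *\<^sub>R (theta 0 * theta 2)"
    using theta_square[of 1 1]
    by (simp_all add: D2_u_eq D2_theta_eq D2_u_coeff_def numeral_2_eq_2)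
  have "D2 (D2_u 0) = D2_u 0 * theta 1 + jet_u 0 * D2_theta 1
      + (1/2) *\<^sub>R (D2_u 1 * theta 0 + jet_u 1 * D2_theta 0)"
    unfolding *(1) by (simp add: D2_linear finite_degree_intros D2_jet_times D2_gens * )
  also have "\<dots> = 0"
    using theta_square[of 1 1] theta_square[of 0 1] theta_anticommute[of 1 0 1] theta_anticommute[of 2 0 1]
    by (simp add: * algebra_simps flip: scaleR_add_left scaleR_diff_left)
  finally show ?case .
next
  case (Suc s)
  then show ?case by (simp add: D2_u_Suc D2_total_deriv_D2_u total_deriv_linear)
qed

lemma D2_D2_theta: "D2 (D2_theta s) = 0"
proof (induction s)
  case 0
  have *: "D2_theta 0 = (1/2) *\<^sub>R (theta 0 * theta 1)" "D2_theta (Suc 0) = (1/2) *\<^sub>R (theta 0 * theta 2)"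
    using theta_square[of 1 1] by (simp_all add: D2_theta_eq numeral_2_eq_2)
  have "D2 (D2_theta 0) = (1/2) *\<^sub>R (D2_theta 0 * theta 1 - theta 0 * D2_theta 1)"
    unfolding *(1) by (simp add: D2_linear finite_degree_intros D2_theta_mult D2_gens * )
  also have "\<dots> = 0"
    using theta_square[of 1 1] by (simp add: * mult.assoc theta_square)
  finally show ?case .
next
  case (Suc s)
  then show ?case by (simp add: D2_theta_Suc D2_total_deriv_D2_theta total_deriv_linear)
qed

lemma D2_D2_u_times:
  assumes "finite_degree G"
  shows "D2 (D2_u s * G) = - (D2_u s * D2 G)"
proof -
  have "D2 (D2_u s * G) = D2 (D2_u s) * G - D2_u s * D2 G"
    by (simp add: assms D2_u_times[of s] D2_u_eq[of s] D2_linear finite_degree_intros finite_degree_D2_gens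
      D2_jet_times D2_theta_mult D2_gens sum_distrib_right distrib_left distrib_right right_diff_distrib
      sum.distrib sum_subtractf scaleR_add_right scaleR_diff_right mult.assoc del: sum.atMost_Suc)
  then show ?thesis by (simp add: D2_D2_u)
qed

lemma D2_D2_theta_times:
  assumes "finite_degree G"
  shows "D2 (D2_theta s * G) = D2_theta s * D2 G"
proof -
  have "D2 (D2_theta s * G) = D2 (D2_theta s) * G + D2_theta s * D2 G"
    by (simp add: assms D2_theta_times[of s] D2_theta_eq[of s] D2_linear finite_degree_intros finite_degree_D2_gens
      D2_theta_mult D2_gens sum_distrib_right left_diff_distrib right_diff_distrib
      sum.distrib sum_subtractf scaleR_add_right scaleR_diff_right mult.assoc)
  then show ?thesis by (simp add: D2_D2_theta)
qed

section \<open>The differentials anticommute\<close>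

lemma sum_antisymmetric:
  fixes f :: "'a \<Rightarrow> 'a \<Rightarrow> 'b::real_vector"
  assumes "\<And>s t. f s t = - f t s"
  shows "(\<Sum>s\<in>A. \<Sum>t\<in>A. f s t) = 0"
proof -
  have "(\<Sum>s\<in>A. \<Sum>t\<in>A. f s t) = (\<Sum>s\<in>A. \<Sum>t\<in>A. f t s)"
    by (rule sum.swap)
  also have "\<dots> = - (\<Sum>s\<in>A. \<Sum>t\<in>A. f s t)"
    by (subst assms) (simp add: sum_negf)
  finally have "2 *\<^sub>R (\<Sum>s\<in>A. \<Sum>t\<in>A. f s t) = 0"
    by (simp add: scaleR_2 eq_neg_iff_add_eq_0)
  then show ?thesis by simp
qed

lemma D2_eq_sum: "graded int int {..<int n} F \<Longrightarrow>
    D2 F = (\<Sum>s<n. D2_u s * pd_u s F + D2_theta s * pd_theta s F)"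
  unfolding D2_alt by (rule vector_field_eq_sum)

lemma D1_eq_sum: "graded int int {..<int n} F \<Longrightarrow> D1 F = (\<Sum>s<n. theta (Suc s) * pd_u s F)"
  unfolding D1_def by (subst vector_field_eq_sum) auto

text \<open>\<open>D2\<close> kills its own components, so only second derivatives remain.
  Components and derivatives have opposite symmetry: the \<open>D2_u\<close> anticommute while the
  \<open>pd_u\<close> commute, and conversely for theta. The double sum is therefore
  antisymmetric.\<close>

lemma D2_D2:
  assumes "finite_degree F"
  shows "D2 (D2 F) = 0"
proof -
  from assms obtain n where F: "graded int int {..<int n} F" by (auto simp: finite_degree_def)
  have *: "graded int int {..<int n} (pd_u s F)" "graded int int {..<int n} (pd_theta s F)" for s
    using F by (auto intro!: graded_pd_u[OF F] graded_pd_theta[OF F])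
  let ?h = "\<lambda>s t. (D2_theta s * (D2_theta t * pd_theta t (pd_theta s F)) -
      D2_u s * (D2_u t * pd_u t (pd_u s F))) +
      (D2_theta s * (D2_u t * pd_u t (pd_theta s F)) - D2_u s * (D2_theta t * pd_theta t (pd_u s F)))"
  have "D2 (D2 F) = (\<Sum>s<n. D2_theta s * D2 (pd_theta s F) - D2_u s * D2 (pd_u s F))"
    by (simp add: D2_eq_sum[OF F] D2_linear finite_degree_intros finite_degree_D2_gens assms
        D2_D2_u_times D2_D2_theta_times)
  also have "\<dots> = (\<Sum>s<n. \<Sum>t<n. ?h s t)"
    by (simp add: D2_eq_sum[OF *(1)] D2_eq_sum[OF *(2)] sum_distrib_left distrib_left
        sum.distrib sum_subtractf)
  also have "\<dots> = 0"
  proof (rule sum_antisymmetric)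
    fix s t
    show "?h s t = - ?h t s"
      by (simp add: D2_u_D2_u[of t s] D2_theta_D2_theta[of t s] D2_theta_D2_u
          pd_theta_anticommute[of t s] pd_u_commute[of t s] pd_u_pd_theta)
  qed
  finally show ?thesis .
qed

lemmas D1_linear = vector_field_linear[where X = "\<lambda>s. theta (Suc s)" and Y = "\<lambda>s. 0", folded D1_def]

lemma finite_degree_D1: "finite_degree F \<Longrightarrow> finite_degree (D1 F)"
  unfolding D1_def by (rule vector_field_finite_degree) (auto intro: finite_degree_intros)

lemma D1_jet_times: "finite_degree G \<Longrightarrow> D1 (jet_u t * G) = theta (Suc t) * G + jet_u t * D1 G"
  unfolding D1_def using jet_theta[of t _ 1] by (subst vector_field_jet) auto

lemma D1_const_times: "finite_degree G \<Longrightarrow>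
  D1 (ss_const f * G) = ss_const (smooth_deriv f) * (theta 1 * G) + ss_const f * D1 G"
  unfolding D1_def using const_theta[of _ _ 1] by (subst vector_field_const) auto

lemma D1_theta_times: "finite_degree G \<Longrightarrow> D1 (theta t * G) = - (theta t * D1 G)"
  unfolding D1_def using theta_anticommute[of _ t 1]
  by (subst vector_field_theta[where \<epsilon> = "-1"]) auto

text \<open>The coordinate u enters \<open>D2_u s\<close> only through u theta^(s+1), with
  coefficient 1; this is why the commutator of d/du with D_2 is D_1.\<close>

lemma pd_u_0_D2_u: "pd_u 0 (D2_u s * G) = theta (Suc s) * G + D2_u s * pd_u 0 G"
proof -
  have "pd_u 0 (D2_u s * G) = (\<Sum>j\<le>Suc s. if j = 0 then theta (Suc s) * G else 0) + D2_u s * pd_u 0 G"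
    unfolding D2_u_times linear_sum[OF linear_pd_u] linear_scale[OF linear_pd_u] sum.distrib[symmetric]
    by (rule sum.cong) (auto simp: pd_u_jet pd_u_theta scaleR_add_right D2_u_coeff_def)
  then show ?thesis by simp
qed

lemma pd_u_0_D2_theta: "pd_u 0 (D2_theta s * G) = D2_theta s * pd_u 0 G"
  unfolding D2_theta_times linear_sum[OF linear_pd_u] linear_scale[OF linear_pd_u] pd_u_theta ..

text \<open>
  Since \<open>\<partial>/\<partial>u\<close> commutes with \<open>D\<^sub>1\<close>, commuting \<open>D\<^sub>2\<^sup>2 = 0\<close> with \<open>\<partial>/\<partial>u\<close> once and twice yields
  \<open>D\<^sub>1 D\<^sub>2 + D\<^sub>2 D\<^sub>1 = 0\<close> and \<open>D\<^sub>1\<^sup>2 = 0\<close>.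
\<close>

lemma pd_u_0_D2:
  assumes "finite_degree F"
  shows "pd_u 0 (D2 F) = D1 F + D2 (pd_u 0 F)"
proof -
  from assms obtain n where F: "graded int int {..<int n} F" by (auto simp: finite_degree_def)
  then have "graded int int {..<int n} (pd_u 0 F)"
    by (auto intro: graded_pd_u)
  with F show ?thesis
    by (simp add: D2_eq_sum[of n] D1_eq_sum[of n] linear_sum[OF linear_pd_u] linear_add[OF linear_pd_u]
        pd_u_0_D2_u pd_u_0_D2_theta pd_u_commute[of 0] pd_u_pd_theta[of 0] sum.distrib)
qed

lemma pd_u_0_D1:
  assumes "finite_degree F"
  shows "pd_u 0 (D1 F) = D1 (pd_u 0 F)"
proof -
  from assms obtain n where F: "graded int int {..<int n} F" by (auto simp: finite_degree_def)
  then have "graded int int {..<int n} (pd_u 0 F)"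
    by (auto intro: graded_pd_u)
  with F show ?thesis
    by (simp add: D1_eq_sum[of n] linear_sum[OF linear_pd_u] pd_u_theta pd_u_commute[of 0])
qed

lemma D1_D2:
  assumes F: "finite_degree F"
  shows "D1 (D2 F) = - D2 (D1 F)"
proof -
  have "0 = pd_u 0 (D2 (D2 F))"
    by (simp add: D2_D2 F linear_0[OF linear_pd_u])
  also have "\<dots> = D1 (D2 F) + D2 (D1 F)"
    by (subst pd_u_0_D2)
      (simp_all add: pd_u_0_D2 D2_D2 D2_linear F finite_degree_D2 finite_degree_D1 finite_degree_pd)
  finally show ?thesis by (simp add: eq_neg_iff_add_eq_0)
qed

lemma D1_D1:
  assumes F: "finite_degree F"
  shows "D1 (D1 F) = 0"
proof -
  have "0 = pd_u 0 (D1 (D2 F) + D2 (D1 F))"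
    by (simp add: D1_D2 F linear_0[OF linear_pd_u])
  also have "\<dots> = 2 *\<^sub>R D1 (D1 F)"
    by (simp only: linear_add[OF linear_pd_u] pd_u_0_D2 pd_u_0_D1 F finite_degree_D2 finite_degree_D1)
      (simp add: D1_D2 D1_linear F finite_degree_D2 finite_degree_D1 finite_degree_pd scaleR_2)
  finally show ?thesis by simp
qed

lemma D_lambda_D_lambda:
  assumes "\<And>k. finite_degree (coeff P k)"
  shows "D_lambda (D_lambda P) = 0"
proof (rule poly_eqI)
  fix k
  show "coeff (D_lambda (D_lambda P)) k = coeff 0 k"
    by (cases k) (auto simp: coeff_D_lambda D2_linear D1_linear D2_D2 D1_D1 D1_D2 assms
        finite_degree_D2 finite_degree_D1 finite_degree_uminus finite_degree_diff split: nat.split)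
qed

section \<open>The leading part of the differential\<close>

text \<open>
  Truncating the sums at \<open>n\<close> makes them linear on all series; on series of degree below \<open>n\<close> nothing
  is lost.
\<close>

definition koszul_d :: "nat \<Rightarrow> super_series \<Rightarrow> super_series"
  where "koszul_d n F = (\<Sum>s = 1..<n. theta (Suc s) * pd_u s F)"

definition koszul_h :: "nat \<Rightarrow> super_series \<Rightarrow> super_series"
  where "koszul_h n F = (\<Sum>s = 1..<n. jet_u s * pd_theta (Suc s) F)"

lift_definition weight_op :: "(nat \<Rightarrow> int) \<Rightarrow> (nat \<Rightarrow> int) \<Rightarrow> super_series \<Rightarrow> super_series"
  is "\<lambda>\<alpha> \<beta> F m S. of_int (weight \<alpha> \<beta> m S) *\<^sub>R F m S"
  by simp

lemma linear_koszul_d: "linear (koszul_d n)" and linear_koszul_h: "linear (koszul_h n)"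
  unfolding koszul_d_def koszul_h_def
  by (auto intro!: linear_compose_sum linearI simp: linear_add[OF linear_pd_u] linear_scale[OF linear_pd_u]
    linear_add[OF linear_pd_theta] linear_scale[OF linear_pd_theta] distrib_left)

lemma linear_weight_op: "linear (weight_op \<alpha> \<beta>)"
  by (rule linearI) (auto intro!: ss_eqI simp: weight_op.rep_eq algebra_simps)

lemma weight_op_homogeneous: "graded \<alpha> \<beta> {v} F \<Longrightarrow> weight_op \<alpha> \<beta> F = of_int v *\<^sub>R F"
  by (rule super_series_eqI) (auto simp: graded_def weight_op.rep_eq)

lemma sum_mset_eq_sum_count:
  assumes "finite A" "set_mset m \<subseteq> A"
  shows "(\<Sum>i\<in>#m. \<alpha> i) = (\<Sum>i\<in>A. int (count m i) * \<alpha> i)"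
  using assms(2)
proof (induction m)
  case (add x m)
  have "(\<Sum>i\<in>A. int (count (add_mset x m) i) * \<alpha> i) =
      (\<Sum>i\<in>A. (if i = x then \<alpha> x else 0) + int (count m i) * \<alpha> i)"
    by (rule sum.cong) (auto simp: algebra_simps)
  with add assms(1) show ?case by (simp add: sum.distrib)
qed simp

lemma coeff_jet_pd_u:
  assumes "0 < s"
  shows "ss_coeff (jet_u s * pd_u s F) m S = real (count m s) *\<^sub>R ss_coeff F m S"
proof (cases "s \<in># m")
  case True
  then have "Suc (count (m - {#s#}) s) = count m s"
    by (metis count_add_mset insert_DiffM)
  with True assms show ?thesis by (simp add: coeff_jet_times coeff_pd_u)
next
  case False
  then have "count m s = 0" by (simp add: not_in_iff)
  with False assms show ?thesis by (simp add: coeff_jet_times)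
qed

lemma coeff_theta_pd_theta:
  "ss_coeff (theta s * pd_theta s F) m S = (if s \<in> S then ss_coeff F m S else 0)"
  by (auto simp: coeff_theta_times pd_theta.rep_eq insert_absorb)

text \<open>A diagonal operator is written as an Euler vector field. The weight of index 0 has to
  vanish because u d/du acts on the smooth coefficients and is not diagonal.\<close>

lemma weight_op_eq_sum:
  assumes F: "graded int int {..<int n} F" and \<alpha>: "\<alpha> 0 = 0"
  shows "weight_op \<alpha> \<beta> F = (\<Sum>s<n. of_int (\<alpha> s) *\<^sub>R (jet_u s * pd_u s F)
    + of_int (\<beta> s) *\<^sub>R (theta s * pd_theta s F))"
proof (rule super_series_eqI)
  fix m :: "nat multiset" and S :: "nat set"
  assume S: "finite S"
  have "ss_coeff (\<Sum>s<n. of_int (\<alpha> s) *\<^sub>R (jet_u s * pd_u s F) + of_int (\<beta> s) *\<^sub>R (theta s * pd_theta s F)) m S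
      = (\<Sum>s<n. of_int (int (count m s) * \<alpha> s + (if s \<in> S then \<beta> s else 0)) *\<^sub>R ss_coeff F m S)"
    unfolding ss_coeff_sum
  proof (rule sum.cong)
    fix s
    show "ss_coeff (of_int (\<alpha> s) *\<^sub>R (jet_u s * pd_u s F) + of_int (\<beta> s) *\<^sub>R (theta s * pd_theta s F)) m S =
        of_int (int (count m s) * \<alpha> s + (if s \<in> S then \<beta> s else 0)) *\<^sub>R ss_coeff F m S"
      using \<alpha> by (cases "s = 0") (auto simp: coeff_jet_pd_u coeff_theta_pd_theta algebra_simps)
  qed simp
  also have "\<dots> = of_int (\<Sum>s<n. int (count m s) * \<alpha> s + (if s \<in> S then \<beta> s else 0)) *\<^sub>R ss_coeff F m S"
    by (simp only: scaleR_sum_left of_int_sum)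
  also have "\<dots> = of_int (weight \<alpha> \<beta> m S) *\<^sub>R ss_coeff F m S"
  proof (cases "ss_coeff F m S = 0")
    case False
    with F have w: "weight int int m S < int n" by (auto dest: gradedD)
    \<comment> \<open>Every index occurring in a monomial is at most its standard degree, so the
      truncated sum sees all factors.\<close>
    have "i < n" if "i \<in># m" for i
    proof -
      from that obtain m' where "m = add_mset i m'" by (metis insert_DiffM)
      with w have "int i + ((\<Sum>i\<in>#m'. int i) + (\<Sum>s\<in>S. int s)) < int n"
        by (simp add: weight_def)
      moreover have "0 \<le> (\<Sum>i\<in>#m'. int i) + (\<Sum>s\<in>S. int s)"
        by (intro add_nonneg_nonneg sum_mset_nonneg_int sum_nonneg) auto
      ultimately show ?thesis by linarith
    qed
    moreover have "i < n" if "i \<in> S" for i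
    proof -
      have "int i \<le> (\<Sum>s\<in>S. int s)"
        using that S by (intro member_le_sum) auto
      moreover have "0 \<le> (\<Sum>i\<in>#m. int i)" by (intro sum_mset_nonneg_int) auto
      ultimately show ?thesis using w by (simp add: weight_def)
    qed
    ultimately have "set_mset m \<subseteq> {..<n}" "{..<n} \<inter> S = S" by auto
    then show ?thesis
      by (simp add: weight_def sum_mset_eq_sum_count[of "{..<n}"] sum.distrib
          sum.inter_restrict[symmetric])
  qed simp
  finally show "ss_coeff (weight_op \<alpha> \<beta> F) m S = ss_coeff (\<Sum>s<n. of_int (\<alpha> s) *\<^sub>R (jet_u s * pd_u s F)
      + of_int (\<beta> s) *\<^sub>R (theta s * pd_theta s F)) m S"
    by (simp add: weight_op.rep_eq)
qed

lemma weight_op_theta: "weight_op \<alpha> \<beta> (theta t * F) = theta t * (weight_op \<alpha> \<beta> F + of_int (\<beta> t) *\<^sub>R F)"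
proof (rule super_series_eqI)
  fix m :: "nat multiset" and S :: "nat set"
  assume S: "finite S"
  have "weight \<alpha> \<beta> m S = weight \<alpha> \<beta> m (S - {t}) + \<beta> t" if "t \<in> S"
    using that S by (simp add: weight_def sum.remove[of S t])
  then show "ss_coeff (weight_op \<alpha> \<beta> (theta t * F)) m S =
      ss_coeff (theta t * (weight_op \<alpha> \<beta> F + of_int (\<beta> t) *\<^sub>R F)) m S"
    by (simp add: weight_op.rep_eq coeff_theta_times algebra_simps)
qed

lemma weight_op_pd_theta: "weight_op \<alpha> \<beta> (pd_theta t F) = pd_theta t (weight_op \<alpha> \<beta> F - of_int (\<beta> t) *\<^sub>R F)"
  by (rule super_series_eqI)
    (auto simp: weight_op.rep_eq pd_theta.rep_eq weight_def algebra_simps)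

lemma weight_op_pd_u:
  "weight_op \<alpha> \<beta> (pd_u t F) = pd_u t (weight_op \<alpha> \<beta> F - (if t = 0 then 0 else of_int (\<alpha> t)) *\<^sub>R F)"
  by (cases "t = 0"; rule super_series_eqI)
    (auto simp: weight_op.rep_eq coeff_pd_u weight_def smooth_deriv_scaleR smooth_deriv_add
      linear_diff[OF linear_smooth_deriv] algebra_simps)

lemma weight_op_const: "weight_op \<alpha> \<beta> (ss_const f * F) = ss_const f * weight_op \<alpha> \<beta> F"
  by (rule super_series_eqI) (auto simp: weight_op.rep_eq coeff_const_times)

section \<open>Weights and the leading part of the second differential\<close>

definition euler_u :: "nat \<Rightarrow> int"
  where "euler_u i = (if i = 0 then 0 else 2 + int i)"

definition euler_theta :: "nat \<Rightarrow> int"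
  where "euler_theta s = int s - 1"

definition leading_u :: "nat \<Rightarrow> int"
  where "leading_u i = (if i = 0 then 0 else 2)"

definition leading_theta :: "nat \<Rightarrow> int"
  where "leading_theta s = (if s = 0 then 1 else if s = 1 then 0 else 2)"

text \<open>Half the weights are coefficients in D_2: theta^1 u^s d/du^s has coefficient 1 + s/2,
  and theta^1 theta^s d/dtheta^s has s/2 - 1/2, where -1/2 comes from reordering theta^s
  theta^1.\<close>

definition euler :: "super_series \<Rightarrow> super_series"
  where "euler F = (1/2) *\<^sub>R weight_op euler_u euler_theta F"

definition D2_leading :: "nat \<Rightarrow> super_series \<Rightarrow> super_series"
  where "D2_leading n F = jet_u 0 * koszul_d n F + theta 1 * (jet_u 0 * pd_u 0 F + euler F)"

lemma D1_leading:
  assumes "graded int int {..<int n} F" "0 < n"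
  shows "D1 F = koszul_d n F + theta 1 * pd_u 0 F"
  using assms by (simp add: D1_eq_sum koszul_d_def sum.atLeast_Suc_lessThan lessThan_atLeast0 add.commute)

lemma sum_if_two:
  fixes f :: "nat \<Rightarrow> 'a::comm_monoid_add"
  assumes "finite A" "a \<in> A" "b \<in> A"
  shows "(\<Sum>j\<in>A. if j = a \<or> j = b then f j else 0) = (if a = b then f a else f a + f b)"
proof -
  have "(\<Sum>j\<in>A. if j = a \<or> j = b then f j else 0) = (\<Sum>j\<in>{a, b}. f j)"
    using assms by (intro sum.mono_neutral_cong_right) auto
  then show ?thesis by simp
qed

text \<open>The leading terms have j = 0 or j = s in \<open>D2_u s\<close>, and j = 1 or j = s in
  \<open>D2_theta s\<close>. Each other term creates an additional generator of weight 2, or a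
  theta^0, or both.\<close>

lemma D2_remainder:
  assumes F: "graded int int {..<int n} F" and n: "0 < n"
    and f: "graded leading_u leading_theta {f..} F"
  shows "graded leading_u leading_theta {f + 1..} (D2 F - D2_leading n F)"
proof -
  define A where "A s j = D2_u_coeff s j *\<^sub>R (jet_u j * (theta (Suc s - j) * pd_u s F))" for s j
  define B where "B s j = (real (s choose j) / 2) *\<^sub>R (theta j * (theta (Suc s - j) * pd_theta s F))" for s j
  have D2: "D2 F = (\<Sum>s<n. (\<Sum>j\<le>Suc s. A s j) + (\<Sum>j\<le>s. B s j))"
    by (simp add: D2_eq_sum[OF F] D2_u_times D2_theta_times A_def B_def del: sum.atMost_Suc)
  \<comment> \<open>At s = 0 the two indices coincide and give theta^1 u d/du; for s > 0 the
    coefficient at j = s is 1 + s/2, which is half of \<open>euler_u s\<close>.\<close>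
  have A: "(\<Sum>j\<le>Suc s. if j = 0 \<or> j = s then A s j else 0) =
    jet_u 0 * (if s = 0 then 0 else theta (Suc s) * pd_u s F) +
    theta 1 * (if s = 0 then jet_u 0 * pd_u 0 F else (of_int (euler_u s) / 2) *\<^sub>R (jet_u s * pd_u s F))" for s
  proof -
    have "s choose (s - Suc 0) = s" if "0 < s" using that by (cases s) auto
    then show ?thesis
      by (subst sum_if_two)
        (auto simp: A_def D2_u_coeff_def jet_theta[of s] jet_theta[of 0 "Suc 0"] euler_u_def add_divide_distrib)
  qed
  \<comment> \<open>For s at least 2, turning theta^s theta^1 into theta^1 theta^s subtracts 1 from
    the binomial s. For s = 0 only j = 0 occurs, and for s = 1 both sides vanish.\<close>
  have B: "(\<Sum>j\<le>s. if j = 1 \<or> j = s then B s j else 0) =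
      theta 1 * ((of_int (euler_theta s) / 2) *\<^sub>R (theta s * pd_theta s F))" for s
  proof -
    consider "s = 0" | "s = 1" | "2 \<le> s" by linarith
    then show ?thesis
    proof cases
      case 3
      then have "(\<Sum>j\<le>s. if j = 1 \<or> j = s then B s j else 0) = B s 1 + B s s"
        by (subst sum_if_two) auto
      also have "\<dots> = theta 1 * ((of_int (euler_theta s) / 2) *\<^sub>R (theta s * pd_theta s F))"
        using 3 theta_anticommute[of s 1 "pd_theta s F"]
        by (simp add: B_def euler_theta_def of_nat_diff diff_divide_distrib scaleR_diff_left right_diff_distrib)
      finally show ?thesis .
    qed (auto simp: B_def euler_theta_def theta_square theta_anticommute[of 0 "Suc 0"])
  qed
  have "D2_leading n F = (\<Sum>s<n. (\<Sum>j\<le>Suc s. if j = 0 \<or> j = s then A s j else 0) +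
      (\<Sum>j\<le>s. if j = 1 \<or> j = s then B s j else 0))"
  proof -
    have "koszul_d n F = (\<Sum>s<n. if s = 0 then 0 else theta (Suc s) * pd_u s F)"
      unfolding koszul_d_def by (rule sum.mono_neutral_cong_left) auto
    moreover have "jet_u 0 * pd_u 0 F + euler F = (\<Sum>s<n. (if s = 0 then jet_u 0 * pd_u 0 F
        else (of_int (euler_u s) / 2) *\<^sub>R (jet_u s * pd_u s F)) +
        (of_int (euler_theta s) / 2) *\<^sub>R (theta s * pd_theta s F))"
    proof -
      have "(\<Sum>s<n. (if s = 0 then jet_u 0 * pd_u 0 F
        else (of_int (euler_u s) / 2) *\<^sub>R (jet_u s * pd_u s F)) +
        (of_int (euler_theta s) / 2) *\<^sub>R (theta s * pd_theta s F)) =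
        (\<Sum>s<n. (if s = 0 then jet_u 0 * pd_u 0 F else 0) +
          (1/2) *\<^sub>R (of_int (euler_u s) *\<^sub>R (jet_u s * pd_u s F) +
           of_int (euler_theta s) *\<^sub>R (theta s * pd_theta s F)))"
        by (rule sum.cong) (auto simp: euler_u_def scaleR_add_right)
      also have "\<dots> = jet_u 0 * pd_u 0 F + euler F"
        using n by (simp add: sum.distrib scaleR_sum_right[symmetric] euler_def
          weight_op_eq_sum[of n F euler_u, OF F] euler_u_def[of 0] del: scaleR_add_right)
      finally show ?thesis ..
    qed
    ultimately show ?thesis
      unfolding A B D2_leading_def
      by (simp only: sum_distrib_left sum.distrib[symmetric]) (simp add: distrib_left add.assoc)
  qed
  then have eq: "D2 F - D2_leading n F = (\<Sum>s<n. (\<Sum>j\<le>Suc s. if j = 0 \<or> j = s then 0 else A s j) +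
      (\<Sum>j\<le>s. if j = 1 \<or> j = s then 0 else B s j))"
    unfolding D2 by (simp only: sum_subtractf[symmetric] add_diff_add)
      (intro sum.cong arg_cong2[where f = "(+)"]; simp)
  have gA: "graded leading_u leading_theta {f + 1..} (A s j)" if "\<not> (j = 0 \<or> j = s)" "j \<le> Suc s" for s j
  proof -
    have "graded leading_u leading_theta {f - leading_u s..} (pd_u s F)"
      by (rule graded_pd_u[OF f]) (auto simp: leading_u_def)
    then have "graded leading_u leading_theta {f - leading_u s + leading_theta (Suc s - j)..}
        (theta (Suc s - j) * pd_u s F)"
      by (rule graded_theta_times) auto
    then have "graded leading_u leading_theta {f + 1..} (jet_u j * (theta (Suc s - j) * pd_u s F))"
      by (rule graded_jet_times)
        (use that in \<open>auto simp: leading_u_def leading_theta_def split: if_splits\<close>)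
    then show ?thesis unfolding A_def by (rule graded_scaleR)
  qed
  have gB: "graded leading_u leading_theta {f + 1..} (B s j)" if "\<not> (j = 1 \<or> j = s)" "j \<le> s" for s j
  proof -
    have "graded leading_u leading_theta {f - leading_theta s..} (pd_theta s F)"
      by (rule graded_pd_theta[OF f]) auto
    then have "graded leading_u leading_theta {f - leading_theta s + leading_theta (Suc s - j)..}
        (theta (Suc s - j) * pd_theta s F)"
      by (rule graded_theta_times) auto
    then have "graded leading_u leading_theta {f + 1..} (theta j * (theta (Suc s - j) * pd_theta s F))"
      by (rule graded_theta_times)
        (use that in \<open>auto simp: leading_theta_def split: if_splits\<close>)
    then show ?thesis unfolding B_def by (rule graded_scaleR)
  qed
  show ?thesis
    unfolding eq using gA gB by (auto intro!: graded_sum graded_add simp del: sum.atMost_Suc)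
qed

lemma linear_euler: "linear euler"
  unfolding euler_def by (intro linear_compose_scale_right linear_weight_op)

lemma koszul_d_jet_0: "koszul_d n (jet_u 0 * F) = jet_u 0 * koszul_d n F"
  by (simp add: koszul_d_def pd_u_jet jet_theta sum_distrib_left)

lemma pd_u_0_koszul_d: "pd_u 0 (koszul_d n F) = koszul_d n (pd_u 0 F)"
  by (simp add: koszul_d_def linear_sum[OF linear_pd_u] pd_u_theta pd_u_commute[of 0])

lemma koszul_d_theta_1: "koszul_d n (theta 1 * F) = - (theta 1 * koszul_d n F)"
  by (simp add: koszul_d_def pd_u_theta theta_anticommute[of _ "Suc 0"] sum_distrib_left sum_negf)

lemma koszul_d_pd_theta_1: "koszul_d n (pd_theta 1 F) = - pd_theta 1 (koszul_d n F)"
  by (simp add: koszul_d_def pd_theta_theta linear_sum[OF linear_pd_theta] pd_u_pd_theta sum_negf)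

text \<open>K trades u^s of Euler weight s + 2 for theta^(s+1) of Euler weight s; the drop by 2 is a
  drop by 1 for \<open>euler\<close>.\<close>

lemma euler_koszul_d: "euler (koszul_d n F) = koszul_d n (euler F) - koszul_d n F"
proof -
  have "weight_op euler_u euler_theta (theta (Suc s) * pd_u s F) =
      theta (Suc s) * pd_u s (weight_op euler_u euler_theta F) - 2 *\<^sub>R (theta (Suc s) * pd_u s F)"
    if "1 \<le> s" for s
    using that
    by (simp add: weight_op_theta weight_op_pd_u linear_diff[OF linear_pd_u] linear_scale[OF linear_pd_u]
        linear_add[OF linear_pd_u]
        euler_u_def euler_theta_def distrib_left right_diff_distrib scaleR_left_distrib)
  then show ?thesis
    by (simp add: koszul_d_def euler_def linear_sum[OF linear_weight_op] sum_subtractf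
        linear_scale[OF linear_pd_u] scaleR_sum_right[symmetric] scaleR_diff_right)
qed

definition number_u :: "nat \<Rightarrow> int"
  where "number_u i = (if i = 0 then 0 else 1)"

definition number_theta :: "nat \<Rightarrow> int"
  where "number_theta s = (if s \<le> 1 then 0 else 1)"

text \<open>The mixed second-order terms of the two products cancel, since theta factors and theta
  derivatives anticommute up to the diagonal. What remains at s = t counts the factors u^s with s at
  least 1 and theta^s with s at least 2.\<close>

lemma koszul_homotopy:
  assumes F: "graded int int {..<int n} F"
  shows "koszul_d n (koszul_h n F) + koszul_h n (koszul_d n F) = weight_op number_u number_theta F"
proof -
  let ?A = "{1..<n}"
  have "koszul_d n (koszul_h n F) = (\<Sum>s\<in>?A. \<Sum>t\<in>?A. (if s = t then theta (Suc s) * pd_theta (Suc s) F else 0)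
      + jet_u t * (theta (Suc s) * pd_u s (pd_theta (Suc t) F)))"
    unfolding koszul_d_def koszul_h_def linear_sum[OF linear_pd_u] sum_distrib_left
    by (intro sum.cong) (auto simp: pd_u_jet distrib_left jet_theta)
  moreover have "koszul_h n (koszul_d n F) = (\<Sum>t\<in>?A. \<Sum>s\<in>?A. (if s = t then jet_u s * pd_u s F else 0)
      - jet_u t * (theta (Suc s) * pd_u s (pd_theta (Suc t) F)))"
    unfolding koszul_d_def koszul_h_def linear_sum[OF linear_pd_theta] sum_distrib_left
    by (intro sum.cong) (auto simp: pd_theta_theta right_diff_distrib pd_u_pd_theta)
  moreover have "(\<Sum>t\<in>?A. \<Sum>s\<in>?A. jet_u t * (theta (Suc s) * pd_u s (pd_theta (Suc t) F))) =
      (\<Sum>s\<in>?A. \<Sum>t\<in>?A. jet_u t * (theta (Suc s) * pd_u s (pd_theta (Suc t) F)))"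
    by (rule sum.swap)
  ultimately have "koszul_d n (koszul_h n F) + koszul_h n (koszul_d n F) =
      (\<Sum>s\<in>?A. jet_u s * pd_u s F) + (\<Sum>s\<in>?A. theta (Suc s) * pd_theta (Suc s) F)"
    by (simp add: sum.distrib sum_subtractf)
  also have "(\<Sum>s\<in>?A. theta (Suc s) * pd_theta (Suc s) F) = (\<Sum>s = 2..<Suc n. theta s * pd_theta s F)"
    unfolding numeral_2_eq_2 One_nat_def by (rule sum.shift_bounds_Suc_ivl[symmetric])
  \<comment> \<open>The shifted range reaches s = n, where d/dtheta^n annihilates \<open>F\<close>
    because its degree is below n; at s = 0 and s = 1 the weight is 0.\<close>
  also have "\<dots> = (\<Sum>s<n. of_int (number_theta s) *\<^sub>R (theta s * pd_theta s F))"
    using pd_eq_0[OF F, of n] by (intro sum.mono_neutral_cong) (auto simp: number_theta_def not_less less_Suc_eq)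
  also have "(\<Sum>s\<in>?A. jet_u s * pd_u s F) = (\<Sum>s<n. of_int (number_u s) *\<^sub>R (jet_u s * pd_u s F))"
    by (intro sum.mono_neutral_cong) (auto simp: number_u_def)
  finally show ?thesis
    using weight_op_eq_sum[OF F, of number_u number_theta] by (simp add: number_u_def[of 0] sum.distrib)
qed

section \<open>Polynomials in \<open>\<lambda>\<close>\<close>

lemma MOST_shift_scale:
  assumes "\<forall>\<^sub>\<infinity>n. (p :: nat \<Rightarrow> 'a::real_vector) n = 0"
  shows "\<forall>\<^sub>\<infinity>n. real (Suc n) *\<^sub>R p (Suc n) = 0"
  using assms by (auto simp: MOST_nat dest: less_SucI)

definition lam_deriv :: "'a::real_vector poly \<Rightarrow> 'a poly"
  where "lam_deriv P = Abs_poly (\<lambda>k. real (Suc k) *\<^sub>R coeff P (Suc k))"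

lemma coeff_lam_deriv: "coeff (lam_deriv P) k = real (Suc k) *\<^sub>R coeff P (Suc k)"
  unfolding lam_deriv_def using MOST_shift_scale[OF MOST_coeff_eq_0[of P]]
  by (subst Abs_poly_inverse) auto

lemma coeff_scaleR_poly: "coeff (r *\<^sub>R P) k = r *\<^sub>R coeff P k"
  by (simp add: scaleR_poly_def coeff_map_poly)

definition lam_w :: "super_series poly \<Rightarrow> super_series poly"
  where "lam_w P = map_poly ((*) (jet_u 0)) P - pCons 0 P"

text \<open>The derivation \<open>\<partial>\<^sub>u + \<partial>\<^sub>\<lambda>\<close>, which annihilates \<open>u - \<lambda>\<close>.\<close>

definition lam_grad :: "super_series poly \<Rightarrow> super_series poly"
  where "lam_grad P = map_poly (pd_u 0) P + lam_deriv P"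

definition lam_E :: "super_series poly \<Rightarrow> super_series poly"
  where "lam_E P = map_poly euler P - lam_w (lam_deriv P)"

definition lam_T :: "super_series poly \<Rightarrow> super_series poly"
  where "lam_T P = lam_w (map_poly (pd_u 0) P) + map_poly euler P"

definition lam_leading :: "nat \<Rightarrow> super_series poly \<Rightarrow> super_series poly"
  where "lam_leading n P = lam_w (map_poly (koszul_d n) P) + map_poly ((*) (theta 1)) (lam_T P)"

lemma linear_mult_left: "linear ((*) (a :: super_series))"
  by (rule linearI) (simp_all add: distrib_left)

lemma linear_map_poly: "linear L \<Longrightarrow> linear (map_poly L)"
  for L :: "'a::real_vector \<Rightarrow> 'b::real_vector"
  by (rule linearI) (auto intro!: poly_eqI simp: coeff_map_poly linear_0 linear_add linear_scale coeff_scaleR_poly)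

lemmas linear_base = linear_mult_left linear_pd_u linear_pd_theta linear_koszul_d linear_koszul_h linear_euler

lemma linear_lam_deriv: "linear (lam_deriv :: 'a::real_vector poly \<Rightarrow> _)"
  by (rule linearI) (auto intro!: poly_eqI simp: coeff_lam_deriv coeff_scaleR_poly scaleR_add_right)

lemma linear_lam_w: "linear lam_w"
  unfolding lam_w_def
  by (intro linear_compose_sub linear_map_poly linear_mult_left linearI)
    (simp, rule poly_eqI, simp add: coeff_scaleR_poly coeff_pCons split: nat.split)

lemma linear_lam_E: "linear lam_E"
  unfolding lam_E_def
  using linear_compose[OF linear_lam_deriv linear_lam_w]
  by (intro linear_compose_sub linear_map_poly linear_euler) (simp add: o_def)

lemma linear_lam_grad: "linear lam_grad"
  unfolding lam_grad_def
  by (intro linear_compose_add linear_map_poly linear_pd_u linear_lam_deriv)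

lemma linear_lam_T: "linear lam_T"
  unfolding lam_T_def
  using linear_compose[OF linear_map_poly[OF linear_pd_u] linear_lam_w]
  by (intro linear_compose_add linear_map_poly linear_euler) (simp add: o_def)

lemma coeff_map_linear: "linear L \<Longrightarrow> coeff (map_poly L P) k = L (coeff P k)"
  by (simp add: coeff_map_poly linear_0)

lemma coeff_lam_w: "coeff (lam_w P) k = jet_u 0 * coeff P k - (case k of 0 \<Rightarrow> 0 | Suc j \<Rightarrow> coeff P j)"
  by (simp add: lam_w_def coeff_map_linear[OF linear_mult_left] coeff_pCons split: nat.split)

lemmas coeff_lam_simps = coeff_map_linear[OF linear_mult_left] coeff_map_linear[OF linear_pd_u]
  coeff_map_linear[OF linear_pd_theta] coeff_map_linear[OF linear_koszul_d]
  coeff_map_linear[OF linear_koszul_h] coeff_map_linear[OF linear_euler]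
  coeff_lam_w coeff_lam_deriv coeff_scaleR_poly

lemmas linear_base_simps = linear_base[THEN linear_0] linear_base[THEN linear_add]
  linear_base[THEN linear_diff] linear_base[THEN linear_scale] linear_base[THEN linear_neg]

lemma lam_T_eq: "lam_T P = lam_w (lam_grad P) + lam_E P"
  by (rule poly_eqI) (simp add: lam_T_def lam_grad_def lam_E_def coeff_lam_simps linear_base_simps
      split: nat.split)

text \<open>The top coefficient of P reappears negated one power of \<lambda> higher in w P.\<close>

lemma lam_w_inject: "lam_w P = 0 \<Longrightarrow> P = 0"
  using coeff_lam_w[of P "Suc (degree P)"] by (simp add: coeff_eq_0)

lemma lam_w_map:
  assumes "linear L" "\<And>F. L (jet_u 0 * F) = jet_u 0 * L F"
  shows "map_poly L (lam_w P) = lam_w (map_poly L P)"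
  by (rule poly_eqI) (simp add: coeff_lam_simps coeff_map_linear[OF assms(1)] assms(2)
      linear_diff[OF assms(1)] linear_0[OF assms(1)] split: nat.split)

text \<open>Two unit shifts cancel: E w = w (E + 1), because w d/d\<lambda> sends w to -w, while E K
  = K (E - 1).\<close>

lemma lam_E_w_koszul: "lam_E (lam_w (map_poly (koszul_d n) P)) = lam_w (map_poly (koszul_d n) (lam_E P))"
proof (rule poly_eqI)
  fix k
  have *: "euler (jet_u 0 * F) = jet_u 0 * euler F" for F
    by (simp add: euler_def jet_0 weight_op_const)
  show "coeff (lam_E (lam_w (map_poly (koszul_d n) P))) k = coeff (lam_w (map_poly (koszul_d n) (lam_E P))) k"
    by (simp add: lam_E_def coeff_lam_simps linear_base_simps euler_koszul_d koszul_d_jet_0 *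
        algebra_simps split: nat.split)
qed

text \<open>The same cancellation; here w d/du sends w to w and supplies the +1.\<close>

lemma lam_T_w_koszul: "lam_T (lam_w (map_poly (koszul_d n) P)) = lam_w (map_poly (koszul_d n) (lam_T P))"
proof (rule poly_eqI)
  fix k
  have *: "euler (jet_u 0 * F) = jet_u 0 * euler F" for F
    by (simp add: euler_def jet_0 weight_op_const)
  show "coeff (lam_T (lam_w (map_poly (koszul_d n) P))) k = coeff (lam_w (map_poly (koszul_d n) (lam_T P))) k"
    by (simp add: lam_T_def coeff_lam_simps linear_base_simps euler_koszul_d koszul_d_jet_0 *
        pd_u_0_koszul_d pd_u_jet algebra_simps split: nat.split)
qed

lemma lam_grad_koszul: "lam_grad (map_poly (koszul_d n) P) = map_poly (koszul_d n) (lam_grad P)"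
  by (rule poly_eqI) (simp add: lam_grad_def coeff_lam_simps linear_base_simps pd_u_0_koszul_d)

text \<open>theta^1 has Euler weight 0, so T does not notice it and respects the splitting into
  parts with and without theta^1.\<close>

lemma lam_T_theta: "lam_T (map_poly ((*) (theta 1)) P) = map_poly ((*) (theta 1)) (lam_T P)"
  by (rule poly_eqI) (simp add: lam_T_def coeff_lam_simps linear_base_simps pd_u_theta jet_theta
      euler_def weight_op_theta euler_theta_def right_diff_distrib distrib_left split: nat.split)

lemma lam_T_pd_theta: "lam_T (map_poly (pd_theta 1) P) = map_poly (pd_theta 1) (lam_T P)"
  by (rule poly_eqI) (simp add: lam_T_def coeff_lam_simps linear_base_simps pd_theta_jet pd_u_pd_theta
      euler_def weight_op_pd_theta euler_theta_def split: nat.split)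

section \<open>Homogeneous sectors\<close>

text \<open>The leading differential keeps the leading weight, so it can be studied for one f at a
  time; there the Koszul homotopy yields the scalar f div 2.\<close>

definition sector :: "int \<Rightarrow> int \<Rightarrow> int \<Rightarrow> super_series set"
  where "sector p d f = {F. graded (\<lambda>_. 0) (\<lambda>_. 1) {p} F \<and> graded int int {d} F \<and>
    graded leading_u leading_theta {f} F}"

lemma weight_int: "weight int int m S = int (\<Sum>\<^sub># m + \<Sum>S)"
proof -
  have "(\<Sum>i\<in>#m. int i) = int (\<Sum>\<^sub># m)" by (induction m) auto
  then show ?thesis by (simp add: weight_def)
qed

lemma weight_super: "weight (\<lambda>_. 0) (\<lambda>_. 1) m S = int (card S)"
  by (simp add: weight_def)

lemma bidegree_part_iff:
  "F \<in> bidegree_part p d \<longleftrightarrow> graded (\<lambda>_. 0) (\<lambda>_. 1) {p} F \<and> graded int int {d} F"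
  unfolding bidegree_part_def graded_def weight_int weight_super
  by (auto, (metis coeff_unsupported)+)

lemma sector_0: "0 \<in> sector p d f"
  by (simp add: sector_def)

lemma sector_add: "F \<in> sector p d f \<Longrightarrow> G \<in> sector p d f \<Longrightarrow> F + G \<in> sector p d f"
  by (simp add: sector_def graded_add)

lemma sector_diff: "F \<in> sector p d f \<Longrightarrow> G \<in> sector p d f \<Longrightarrow> F - G \<in> sector p d f"
  by (simp add: sector_def graded_diff)

lemma sector_scaleR: "F \<in> sector p d f \<Longrightarrow> r *\<^sub>R F \<in> sector p d f"
  by (simp add: sector_def graded_scaleR)

lemma sector_jet_0: "F \<in> sector p d f \<Longrightarrow> jet_u 0 * F \<in> sector p d f"
  by (auto simp: sector_def leading_u_def intro: graded_jet_times)

lemma sector_pd_u_0: "F \<in> sector p d f \<Longrightarrow> pd_u 0 F \<in> sector p d f"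
  by (auto simp: sector_def leading_u_def intro: graded_pd_u)

lemma graded_weight_op: "graded \<alpha> \<beta> V F \<Longrightarrow> graded \<alpha> \<beta> V (weight_op \<alpha>' \<beta>' F)"
  by (auto simp: graded_def weight_op.rep_eq)

lemma sector_euler: "F \<in> sector p d f \<Longrightarrow> euler F \<in> sector p d f"
  by (auto simp: sector_def euler_def intro: graded_scaleR graded_weight_op)

lemma sector_theta_1: "F \<in> sector (p - 1) (d - 1) f \<Longrightarrow> theta 1 * F \<in> sector p d f"
  by (auto simp: sector_def leading_theta_def intro: graded_theta_times)

lemma sector_pd_theta_1: "F \<in> sector p d f \<Longrightarrow> pd_theta 1 F \<in> sector (p - 1) (d - 1) f"
  by (auto simp: sector_def leading_theta_def intro: graded_pd_theta)

lemma sector_koszul_d: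
  assumes "F \<in> sector (p - 1) (d - 1) f"
  shows "koszul_d n F \<in> sector p d f"
proof -
  have "theta (Suc s) * pd_u s F \<in> sector p d f" if "1 \<le> s" for s
  proof -
    have "graded (\<lambda>_. 0) (\<lambda>_. 1) {p - 1} (pd_u s F)" "graded int int {d - 1 - int s} (pd_u s F)"
      "graded leading_u leading_theta {f - 2} (pd_u s F)"
      using assms that by (auto simp: sector_def leading_u_def intro: graded_pd_u)
    then show ?thesis
      using that by (auto simp: sector_def leading_theta_def intro: graded_theta_times)
  qed
  then show ?thesis by (auto simp: sector_def koszul_d_def intro!: graded_sum)
qed

lemma sector_koszul_h:
  assumes "F \<in> sector p d f"
  shows "koszul_h n F \<in> sector (p - 1) (d - 1) f"
proof -
  have "jet_u s * pd_theta (Suc s) F \<in> sector (p - 1) (d - 1) f" if "1 \<le> s" for s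
  proof -
    have "graded (\<lambda>_. 0) (\<lambda>_. 1) {p - 1} (pd_theta (Suc s) F)"
      "graded int int {d - 1 - int s} (pd_theta (Suc s) F)"
      "graded leading_u leading_theta {f - 2} (pd_theta (Suc s) F)"
      using assms that by (auto simp: sector_def leading_theta_def intro: graded_pd_theta)
    then show ?thesis
      using that by (auto simp: sector_def leading_u_def intro: graded_jet_times)
  qed
  then show ?thesis by (auto simp: sector_def koszul_h_def intro!: graded_sum)
qed

lemma sum_mset_mono_int: "(\<And>i. i \<in># m \<Longrightarrow> f i \<le> g i) \<Longrightarrow> (\<Sum>i\<in>#m. f i :: int) \<le> (\<Sum>i\<in>#m. g i)"
  by (induction m) (auto intro: add_mono)

text \<open>d - p is the sum of i over the u^i and of s - 1 over the theta^s, while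
  \<open>euler_u i\<close> is at least i.\<close>

lemma weight_euler_ge:
  assumes "F \<in> sector p d f" "ss_coeff F m S \<noteq> 0"
  shows "d - p \<le> weight euler_u euler_theta m S"
proof -
  have m: "0 \<notin># m" "finite S"
    using assms(2) coeff_unsupported by blast+
  have "p = weight (\<lambda>_. 0) (\<lambda>_. 1) m S" "d = weight int int m S"
    using assms by (auto simp: sector_def dest: gradedD)
  moreover have "(\<Sum>i\<in>#m. int i) \<le> (\<Sum>i\<in>#m. euler_u i)"
    using m by (intro sum_mset_mono_int) (auto simp: euler_u_def)
  ultimately show ?thesis
    by (simp add: weight_def euler_theta_def sum_subtractf)
qed

lemma weight_leading:
  assumes "finite S"
  shows "weight leading_u leading_theta m S div 2 = weight number_u number_theta m S"
proof -
  have "(\<Sum>i\<in>#m. leading_u i) = 2 * (\<Sum>i\<in>#m. number_u i)"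
    by (induction m) (auto simp: leading_u_def number_u_def)
  moreover have "(\<Sum>s\<in>S. leading_theta s) = (\<Sum>s\<in>S. 2 * number_theta s + (if s = 0 then 1 else 0))"
    by (rule sum.cong) (auto simp: leading_theta_def number_theta_def)
  ultimately have "weight leading_u leading_theta m S =
      2 * weight number_u number_theta m S + (if 0 \<in> S then 1 else 0)"
    using assms by (simp add: weight_def sum.distrib sum_distrib_left)
  then show ?thesis by simp
qed

text \<open>Without a counted factor only theta^0 and theta^1 can occur, and these contribute -1 and
  0 to d - p.\<close>

lemma weight_number_pos:
  assumes F: "F \<in> sector p d f" "ss_coeff F m S \<noteq> 0" and pd: "p < d"
  shows "0 < weight number_u number_theta m S"
proof (rule ccontr)
  assume neg: "\<not> ?thesis"
  have m: "0 \<notin># m" "finite S"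
    using F(2) coeff_unsupported by blast+
  have "(\<Sum>i\<in>#m. int i) = 0 \<and> (\<Sum>s\<in>S. int s - 1) \<le> 0"
  proof -
    have size: "(\<Sum>i\<in>#m. number_u i) = int (size m)"
      using m(1) by (induction m) (auto simp: number_u_def)
    have nn: "0 \<le> (\<Sum>s\<in>S. number_theta s)"
      by (intro sum_nonneg) (simp add: number_theta_def)
    from neg size nn have "size m = 0 \<and> (\<Sum>s\<in>S. number_theta s) = 0"
      unfolding weight_def by linarith
    then have "m = {#}" "\<forall>s\<in>S. number_theta s = 0"
      using m(2) sum_nonneg_eq_0_iff[of S number_theta] by (auto simp: number_theta_def)
    then show ?thesis
      by (auto intro!: sum_nonpos simp: number_theta_def split: if_splits)
  qed
  moreover have "p = weight (\<lambda>_. 0) (\<lambda>_. 1) m S" "d = weight int int m S"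
    using F by (auto simp: sector_def dest: gradedD)
  ultimately show False
    using pd by (simp add: weight_def sum_subtractf)
qed

lemma koszul_homotopy_sector:
  assumes F: "F \<in> sector p d f" and n: "d < int n"
  shows "koszul_d n (koszul_h n F) + koszul_h n (koszul_d n F) = of_int (f div 2) *\<^sub>R F"
proof -
  have "graded int int {..<int n} F"
    using F n by (auto simp: sector_def elim: graded_mono)
  moreover have "graded number_u number_theta {f div 2} F"
    using F unfolding sector_def graded_def by (auto simp flip: weight_leading)
  ultimately show ?thesis
    by (simp add: koszul_homotopy weight_op_homogeneous)
qed

lemma sector_eq_0:
  assumes "F \<in> sector p d f" "p < d" "f div 2 \<le> 0"
  shows "F = 0"
proof (rule super_series_eqI)
  fix m :: "nat multiset" and S :: "nat set"
  assume "finite S"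
  show "ss_coeff F m S = ss_coeff 0 m S"
  proof (rule ccontr)
    assume "\<not> ?thesis"
    then have nz: "ss_coeff F m S \<noteq> 0" by simp
    with assms(1) have "weight leading_u leading_theta m S = f"
      by (auto simp: sector_def dest: gradedD)
    with weight_number_pos[OF assms(1) nz assms(2)] weight_leading[OF \<open>finite S\<close>, of m] assms(3)
    show False by simp
  qed
qed

definition lam_sector :: "int \<Rightarrow> int \<Rightarrow> int \<Rightarrow> super_series poly set"
  where "lam_sector p d f = {P. \<forall>k. coeff P k \<in> sector p d f}"

lemma lam_sector_map:
  assumes "P \<in> lam_sector p d f" "linear L" "\<And>F. F \<in> sector p d f \<Longrightarrow> L F \<in> sector p' d' f"
  shows "map_poly L P \<in> lam_sector p' d' f"
  using assms by (auto simp: lam_sector_def coeff_map_linear)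

lemma lam_sector_add: "P \<in> lam_sector p d f \<Longrightarrow> Q \<in> lam_sector p d f \<Longrightarrow> P + Q \<in> lam_sector p d f"
  by (simp add: lam_sector_def sector_add)

lemma lam_sector_diff: "P \<in> lam_sector p d f \<Longrightarrow> Q \<in> lam_sector p d f \<Longrightarrow> P - Q \<in> lam_sector p d f"
  by (simp add: lam_sector_def sector_diff)

lemma lam_sector_scaleR: "P \<in> lam_sector p d f \<Longrightarrow> r *\<^sub>R P \<in> lam_sector p d f"
  by (simp add: lam_sector_def coeff_scaleR_poly sector_scaleR)

lemma lam_sector_deriv: "P \<in> lam_sector p d f \<Longrightarrow> lam_deriv P \<in> lam_sector p d f"
  by (simp add: lam_sector_def coeff_lam_deriv sector_scaleR)

lemma lam_sector_w: "P \<in> lam_sector p d f \<Longrightarrow> lam_w P \<in> lam_sector p d f"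
  by (auto simp: lam_sector_def coeff_lam_w intro!: sector_diff sector_jet_0 sector_0 split: nat.split)

lemma lam_sector_E: "P \<in> lam_sector p d f \<Longrightarrow> lam_E P \<in> lam_sector p d f"
  unfolding lam_E_def
  by (intro lam_sector_diff lam_sector_w lam_sector_deriv lam_sector_map[OF _ linear_euler sector_euler])

lemma lam_sector_T: "P \<in> lam_sector p d f \<Longrightarrow> lam_T P \<in> lam_sector p d f"
  unfolding lam_T_def
  by (intro lam_sector_add lam_sector_w lam_sector_map[OF _ linear_euler sector_euler]
      lam_sector_map[OF _ linear_pd_u sector_pd_u_0])

lemma lam_sector_grad: "P \<in> lam_sector p d f \<Longrightarrow> lam_grad P \<in> lam_sector p d f"
  unfolding lam_grad_def
  by (intro lam_sector_add lam_sector_deriv lam_sector_map[OF _ linear_pd_u sector_pd_u_0])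

lemma lam_sector_koszul_d:
  "P \<in> lam_sector (p - 1) (d - 1) f \<Longrightarrow> map_poly (koszul_d n) P \<in> lam_sector p d f"
  by (rule lam_sector_map[OF _ linear_koszul_d sector_koszul_d])

lemma lam_sector_koszul_h:
  "P \<in> lam_sector p d f \<Longrightarrow> map_poly (koszul_h n) P \<in> lam_sector (p - 1) (d - 1) f"
  by (rule lam_sector_map[OF _ linear_koszul_h sector_koszul_h])

lemma lam_sector_theta:
  "P \<in> lam_sector (p - 1) (d - 1) f \<Longrightarrow> map_poly ((*) (theta 1)) P \<in> lam_sector p d f"
  by (rule lam_sector_map[OF _ linear_mult_left sector_theta_1])

lemma lam_sector_pd_theta:
  "P \<in> lam_sector p d f \<Longrightarrow> map_poly (pd_theta 1) P \<in> lam_sector (p - 1) (d - 1) f"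
  by (rule lam_sector_map[OF _ linear_pd_theta sector_pd_theta_1])

section \<open>Inverting E on polynomials in \<lambda>\<close>

lift_definition euler_inv :: "real \<Rightarrow> super_series \<Rightarrow> super_series"
  is "\<lambda>r F m S. inverse (of_int (weight euler_u euler_theta m S) / 2 + r) *\<^sub>R F m S"
  by simp

text \<open>On the monomials that occur, the Euler weight is at least d - p > 0, so the divisor is
  positive; on all others the coefficient is 0.\<close>

lemma euler_inv:
  assumes F: "F \<in> sector p d f" and pd: "p < d" and r: "0 \<le> r"
  shows "euler (euler_inv r F) + r *\<^sub>R euler_inv r F = F" "euler_inv r F \<in> sector p d f"
proof -
  show "euler (euler_inv r F) + r *\<^sub>R euler_inv r F = F"
  proof (rule super_series_eqI)
    fix m :: "nat multiset" and S :: "nat set"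
    let ?c = "of_int (weight euler_u euler_theta m S) / 2 + r"
    show "ss_coeff (euler (euler_inv r F) + r *\<^sub>R euler_inv r F) m S = ss_coeff F m S"
    proof (cases "ss_coeff F m S = 0")
      case False
      with weight_euler_ge[OF F False] pd r have "0 < ?c" by auto
      moreover have "ss_coeff (euler (euler_inv r F) + r *\<^sub>R euler_inv r F) m S =
          (?c * inverse ?c) *\<^sub>R ss_coeff F m S"
        by (simp add: euler_def weight_op.rep_eq euler_inv.rep_eq distrib_right flip: scaleR_left_distrib)
      ultimately show ?thesis by simp
    qed (simp add: euler_def weight_op.rep_eq euler_inv.rep_eq)
  qed
  show "euler_inv r F \<in> sector p d f"
    using F by (auto simp: sector_def graded_def euler_inv.rep_eq)
qed

text \<open>On the top coefficient, -w d/d\<lambda> contributes just the degree, so E acts there by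
  c + degree > 0.\<close>

lemma lam_E_injective:
  assumes P: "P \<in> lam_sector p d f" and pd: "p < d" and E: "lam_E P = 0"
  shows "P = 0"
proof (rule ccontr)
  assume "P \<noteq> 0"
  let ?n = "degree P"
  let ?F = "coeff P ?n"
  have "coeff (lam_E P) ?n = euler ?F + real ?n *\<^sub>R ?F"
    by (cases "degree P") (auto simp: lam_E_def coeff_lam_simps coeff_eq_0)
  then have eq: "euler ?F + real ?n *\<^sub>R ?F = 0" using E by simp
  have "?F = 0"
  proof (rule super_series_eqI)
    fix m :: "nat multiset" and S :: "nat set"
    show "ss_coeff ?F m S = ss_coeff 0 m S"
    proof (rule ccontr)
      assume "\<not> ?thesis"
      then have nz: "ss_coeff ?F m S \<noteq> 0" by simp
      moreover have "?F \<in> sector p d f" using P by (simp add: lam_sector_def)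
      ultimately have "0 < weight euler_u euler_theta m S"
        using weight_euler_ge pd by fastforce
      then have "of_int (weight euler_u euler_theta m S) / 2 + real ?n \<noteq> 0" by (simp add: add_pos_nonneg less_imp_neq[symmetric])
      moreover have "(of_int (weight euler_u euler_theta m S) / 2 + real ?n) *\<^sub>R ss_coeff ?F m S = 0"
        using arg_cong[OF eq, of "\<lambda>G. ss_coeff G m S"]
        by (simp add: euler_def weight_op.rep_eq scaleR_left_distrib)
      ultimately show False using nz by simp
    qed
  qed
  with \<open>P \<noteq> 0\<close> show False by simp
qed

text \<open>E maps X \<lambda>^n to (c + n) X \<lambda>^n plus a multiple of \<lambda>^(n-1), so the
  equation is solved from the top power downwards.\<close>

lemma lam_E_surjective:
  assumes "P \<in> lam_sector p d f" and pd: "p < d"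
  shows "\<exists>X \<in> lam_sector p d f. lam_E X = P"
proof -
  have "\<exists>X \<in> lam_sector p d f. lam_E X = P" if "P \<in> lam_sector p d f" "\<And>k. n \<le> k \<Longrightarrow> coeff P k = 0" for n P
    using that
  proof (induction n arbitrary: P)
    case 0
    then have "P = 0" by (auto intro: poly_eqI)
    then show ?case
      by (intro bexI[of _ 0]) (auto simp: linear_0[OF linear_lam_E] lam_sector_def sector_0)
  next
    case (Suc n)
    define Y where "Y = monom (euler_inv (real n) (coeff P n)) n"
    have Pn: "coeff P n \<in> sector p d f" using Suc.prems by (simp add: lam_sector_def)
    have Y: "Y \<in> lam_sector p d f"
      using euler_inv(2)[OF Pn pd] by (simp add: Y_def lam_sector_def sector_0)
    have "coeff (P - lam_E Y) k = 0" if "n \<le> k" for k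
    proof (cases "k = n")
      case True
      have "coeff (lam_E Y) n = euler (euler_inv (real n) (coeff P n)) + real n *\<^sub>R euler_inv (real n) (coeff P n)"
        by (cases n) (auto simp: Y_def lam_E_def coeff_lam_simps)
      with True euler_inv(1)[OF Pn pd] show ?thesis by simp
    next
      case False
      with that obtain j where j: "k = Suc j" "n \<le> j" by (cases k) auto
      with False Suc.prems(2)[of k] show ?thesis
        by (simp add: Y_def lam_E_def coeff_lam_simps linear_0[OF linear_euler])
    qed
    with Suc.IH[of "P - lam_E Y"] obtain X where "X \<in> lam_sector p d f" "lam_E X = P - lam_E Y"
      using Suc.prems Y by (auto intro: lam_sector_diff lam_sector_E)
    with Y show ?case
      by (intro bexI[of _ "X + Y"]) (auto simp: linear_add[OF linear_lam_E] intro: lam_sector_add)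
  qed
  from this[OF assms(1), of "Suc (degree P)"] show ?thesis
    by (simp add: coeff_eq_0)
qed

text \<open>Write P = A + theta^1 B; closedness says K A = 0 and T A = w K B. The primitive is C +
  Q1 + theta^1 Q2 with w K C = A, K Q1 = 0, E Q1 = B - T C and K Q2 = \<nabla> Q1. The last equation
  makes theta^1 Q2 cancel the term w \<nabla> Q1 of T Q1.\<close>

lemma leading_acyclic:
  assumes P: "P \<in> lam_sector p d f" and pd: "p < d" and n: "d < int n"
    and closed: "lam_leading n P = 0"
  obtains Q where "Q \<in> lam_sector (p - 1) (d - 1) f" "lam_leading n Q = P"
proof (cases "f div 2 \<le> 0")
  case True
  \<comment> \<open>Division by f div 2 may be impossible here, but then the sector itself is
    zero.\<close>
  have "P = 0"
    using P sector_eq_0[OF _ pd True] by (auto intro!: poly_eqI simp: lam_sector_def)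
  moreover have "lam_leading n 0 = 0"
    by (simp add: lam_leading_def linear_0[OF linear_lam_w] linear_0[OF linear_lam_T])
  ultimately show ?thesis using that[of 0] by (simp add: lam_sector_def sector_0)
next
  case False
  define \<nu> where "\<nu> = real_of_int (f div 2)"
  have \<nu>: "\<nu> \<noteq> 0" using False by (auto simp: \<nu>_def)
  let ?K = "map_poly (koszul_d n)" and ?k = "map_poly (koszul_h n)"
    and ?t = "map_poly ((*) (theta 1))" and ?h = "map_poly (pd_theta 1)"
  have lin: "linear ?K" "linear ?k" "linear ?t" "linear ?h"
    by (intro linear_map_poly linear_base)+
  note lins = lin linear_lam_w linear_lam_E linear_lam_T linear_lam_grad
  note lin_simps = lins[THEN linear_0] lins[THEN linear_add] lins[THEN linear_diff]
    lins[THEN linear_scale] lins[THEN linear_neg]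
  have Kw: "?K (lam_w X) = lam_w (?K X)" and tw: "?t (lam_w X) = lam_w (?t X)"
    and hw: "?h (lam_w X) = lam_w (?h X)" for X
    by (rule lam_w_map; simp add: linear_base koszul_d_jet_0 pd_theta_jet jet_theta)+
  have Kt: "?K (?t X) = - ?t (?K X)" and hK: "?h (?K X) = - ?K (?h X)"
    and tt: "?t (?t X) = 0" and hh: "?h (?h X) = 0" and ht: "?h (?t X) = X - ?t (?h X)" for X
    using koszul_d_theta_1 pd_theta_anticommute[of 1 1]
    by (auto intro!: poly_eqI simp: coeff_lam_simps linear_base_simps koszul_d_pd_theta_1[simplified]
        theta_square pd_theta_theta eq_neg_iff_add_eq_0 simp flip: scaleR_2)
  have homotopy: "\<nu> *\<^sub>R X = ?K (?k X)" if "?K X = 0" "X \<in> lam_sector p' d' f" "d' < int n" for X p' d'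
  proof (rule poly_eqI)
    fix i
    have "koszul_d n (coeff X i) = 0"
      using arg_cong[OF that(1), of "\<lambda>Y. coeff Y i"] by (simp add: coeff_lam_simps)
    then show "coeff (\<nu> *\<^sub>R X) i = coeff (?K (?k X)) i"
      using koszul_homotopy_sector[of "coeff X i" p' d' f n] that
      by (simp add: coeff_lam_simps lam_sector_def \<nu>_def linear_base_simps)
  qed
  have leading_eq: "lam_leading n X = lam_w (?K X) + ?t (lam_T X)" for X
    by (simp add: lam_leading_def)
  note One_nat_def [simp del]
  define B where "B = ?h P"
  define A where "A = P - ?t B"
  have B: "B \<in> lam_sector (p - 1) (d - 1) f" unfolding B_def by (rule lam_sector_pd_theta[OF P])
  have A: "A \<in> lam_sector p d f" unfolding A_def by (intro lam_sector_diff P lam_sector_theta B)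
  have hB: "?h B = 0" by (simp only: B_def hh)
  have hA: "?h A = 0" by (simp only: A_def lin_simps ht hB) (simp add: B_def)
  have hT: "?h (lam_T X) = lam_T (?h X)" for X by (rule lam_T_pd_theta[symmetric])
  have D: "lam_w (?K A) + ?t (lam_T A - lam_w (?K B)) = 0"
  proof -
    have "lam_leading n P = lam_leading n (A + ?t B)" by (simp add: A_def)
    also have "\<dots> = lam_w (?K A) + ?t (lam_T A - lam_w (?K B))"
      by (simp only: leading_eq lin_simps Kt lam_T_theta tt tw) simp
    finally show ?thesis using closed by simp
  qed
  \<comment> \<open>A and B are free of theta^1, so d/dtheta^1 extracts the second closedness
    equation.\<close>
  have hD: "?h (lam_w (?K A) + ?t (lam_T A - lam_w (?K B))) = lam_T A - lam_w (?K B)"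
    by (simp add: lin_simps hw hK ht hT hA hB)
  have TA: "lam_T A = lam_w (?K B)"
    using hD[unfolded D] by (simp only: lin_simps) simp
  have "lam_w (?K A) = 0"
    using D by (simp only: TA lin_simps diff_self add_0_right)
  then have KA: "?K A = 0" by (rule lam_w_inject)
  \<comment> \<open>Chosen so that w K C0 = E A: by \<open>TA\<close>, T A = w K B, and \<nabla> A
    is K applied to \<nabla> of the homotopy of A, divided by \<open>\<nu>\<close>.\<close>
  define C0 where "C0 = B - (1 / \<nu>) *\<^sub>R lam_grad (?k A)"
  have "C0 \<in> lam_sector (p - 1) (d - 1) f"
    unfolding C0_def by (intro lam_sector_diff B lam_sector_scaleR lam_sector_grad lam_sector_koszul_h A)
  then obtain C where C: "C \<in> lam_sector (p - 1) (d - 1) f" "lam_E C = C0"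
    using lam_E_surjective[of C0 "p - 1" "d - 1" f] pd by auto
  have "lam_E A = lam_T A - lam_w (lam_grad A)" by (simp add: lam_T_eq)
  also have "lam_grad A = (1 / \<nu>) *\<^sub>R ?K (lam_grad (?k A))"
  proof -
    have "\<nu> *\<^sub>R lam_grad A = ?K (lam_grad (?k A))"
      using arg_cong[OF homotopy[OF KA A n], of lam_grad] by (simp only: lam_grad_koszul lin_simps)
    from this[symmetric] show ?thesis using \<nu> by simp
  qed
  also have "lam_T A - lam_w ((1 / \<nu>) *\<^sub>R ?K (lam_grad (?k A))) = lam_w (?K C0)"
    by (simp add: TA C0_def lin_simps)
  also have "\<dots> = lam_E (lam_w (?K C))"
    by (simp add: lam_E_w_koszul C)
  finally have "lam_E (A - lam_w (?K C)) = 0" by (simp add: lin_simps)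
  then have AC: "A = lam_w (?K C)"
    using lam_E_injective[OF _ pd, of "A - lam_w (?K C)" f] A C
    by (auto intro!: lam_sector_diff lam_sector_w lam_sector_koszul_d)
  \<comment> \<open>The theta^1-coefficient still to be produced once C has produced A. It is
    K-closed up to the injective factor w, because w K T C = T A.\<close>
  define B' where "B' = B - lam_T C"
  have B': "B' \<in> lam_sector (p - 1) (d - 1) f"
    unfolding B'_def by (intro lam_sector_diff B lam_sector_T C)
  have "lam_w (?K B') = lam_T A - lam_T (lam_w (?K C))"
    by (simp add: B'_def lin_simps TA lam_T_w_koszul)
  then have KB': "lam_w (?K B') = 0" by (simp add: AC)
  obtain Q1 where Q1: "Q1 \<in> lam_sector (p - 1) (d - 1) f" "lam_E Q1 = B'"
    using lam_E_surjective[OF B'] pd by auto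
  have "lam_E (lam_w (?K Q1)) = 0"
    by (simp add: lam_E_w_koszul Q1 KB')
  then have "lam_w (?K Q1) = 0"
    using lam_E_injective[OF _ pd, of "lam_w (?K Q1)" f] Q1
    by (auto intro!: lam_sector_w lam_sector_koszul_d)
  then have KQ1: "?K Q1 = 0" by (rule lam_w_inject)
  \<comment> \<open>The homotopy formula for the K-closed Q1, differentiated by \<nabla>, which
    commutes with K; hence K Q2 = \<nabla> Q1.\<close>
  define Q2 where "Q2 = (1 / \<nu>) *\<^sub>R lam_grad (?k Q1)"
  have Q2: "?t Q2 \<in> lam_sector (p - 1) (d - 1) f"
    unfolding Q2_def
    by (intro lam_sector_theta lam_sector_scaleR lam_sector_grad lam_sector_koszul_h Q1)
  have "\<nu> *\<^sub>R ?K Q2 = ?K (lam_grad (?k Q1))"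
    using \<nu> by (simp add: Q2_def lin_simps)
  also have "\<dots> = \<nu> *\<^sub>R lam_grad Q1"
    using arg_cong[OF homotopy[OF KQ1 Q1(1)], of lam_grad] n by (simp only: lam_grad_koszul lin_simps)
  finally have KQ2: "?K Q2 = lam_grad Q1" using \<nu> by simp
  have "lam_leading n (C + Q1 + ?t Q2) = lam_w (?K C) + ?t (lam_T C + lam_T Q1 - lam_w (?K Q2))"
    by (simp add: leading_eq lin_simps Kt lam_T_theta tt tw KQ1)
  also have "\<dots> = A + ?t (lam_T C + B')"
    unfolding KQ2 lam_T_eq[of Q1] Q1(2) AC[symmetric] by simp
  also have "\<dots> = P"
    by (simp add: B'_def A_def)
  finally show ?thesis
    using that[of "C + Q1 + ?t Q2"] C Q1 Q2 by (auto intro: lam_sector_add)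
qed

section \<open>Vanishing above the diagonal\<close>

lemma lambda_bidegree_partD:
  assumes "P \<in> lambda_bidegree_part p d"
  shows "graded (\<lambda>_. 0) (\<lambda>_. 1) {p} (coeff P k)" "graded int int {d} (coeff P k)"
    "finite_degree (coeff P k)"
proof -
  show *: "graded (\<lambda>_. 0) (\<lambda>_. 1) {p} (coeff P k)" "graded int int {d} (coeff P k)"
    using assms by (auto simp: lambda_bidegree_part_def bidegree_part_iff)
  from *(2) have "graded int int {..<d + 1} (coeff P k)" by (rule graded_mono) auto
  then show "finite_degree (coeff P k)" by (rule graded_finite_degree)
qed

lemma lambda_bidegree_part_diff:
  "P \<in> lambda_bidegree_part p d \<Longrightarrow> Q \<in> lambda_bidegree_part p d \<Longrightarrow> P - Q \<in> lambda_bidegree_part p d"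
  by (simp add: lambda_bidegree_part_def bidegree_part_iff graded_diff)

lemma lambda_bidegree_part_add:
  "P \<in> lambda_bidegree_part p d \<Longrightarrow> Q \<in> lambda_bidegree_part p d \<Longrightarrow> P + Q \<in> lambda_bidegree_part p d"
  by (simp add: lambda_bidegree_part_def bidegree_part_iff graded_add)

lemma lambda_bidegree_part_0: "0 \<in> lambda_bidegree_part p d"
  by (simp add: lambda_bidegree_part_def bidegree_part_iff)

lemma D_lambda_add:
  "P \<in> lambda_bidegree_part p d \<Longrightarrow> Q \<in> lambda_bidegree_part p d \<Longrightarrow>
    D_lambda (P + Q) = D_lambda P + D_lambda Q"
  by (rule poly_eqI) (simp add: coeff_D_lambda D2_linear D1_linear lambda_bidegree_partD split: nat.split)

lemma D_lambda_diff:
  "(\<And>k. finite_degree (coeff P k)) \<Longrightarrow> (\<And>k. finite_degree (coeff Q k)) \<Longrightarrow>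
    D_lambda (P - Q) = D_lambda P - D_lambda Q"
  by (rule poly_eqI) (simp add: coeff_D_lambda D2_linear D1_linear split: nat.split)

lemma bidegree_part_diff:
  "F \<in> bidegree_part p d \<Longrightarrow> G \<in> bidegree_part p d \<Longrightarrow> F - G \<in> bidegree_part p d"
  by (simp add: bidegree_part_iff graded_diff)

lemma D2_bidegree:
  assumes "F \<in> bidegree_part p d"
  shows "D2 F \<in> bidegree_part (p + 1) (d + 1)"
proof -
  have p: "graded (\<lambda>_. 0) (\<lambda>_. 1) {p} F" and d: "graded int int {d} F"
    using assms by (auto simp: bidegree_part_iff)
  have F: "graded int int {..<int (nat (d + 1))} F"
    using d by (rule graded_mono) auto
  have jt: "graded (\<lambda>_. 0) (\<lambda>_. 1) {1} (jet_u j * theta k)" "graded int int {int (j + k)} (jet_u j * theta k)"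
    and tt: "graded (\<lambda>_. 0) (\<lambda>_. 1) {2} (theta j * theta k)" "graded int int {int (j + k)} (theta j * theta k)"
    for j k
    by (rule graded_jet_times[OF graded_theta[where V = "{1}"]]
        graded_jet_times[OF graded_theta[where V = "{int k}"]]
        graded_theta_times[OF graded_theta[where V = "{1}"]]
        graded_theta_times[OF graded_theta[where V = "{int k}"]]; simp)+
  have deg: "graded int int {int s + 1} (jet_u j * theta (Suc s - j))"
    "graded int int {int s + 1} (theta j * theta (Suc s - j))" if "j \<le> Suc s" for s j
    using jt(2)[of j "Suc s - j"] tt(2)[of j "Suc s - j"] that by (simp_all add: of_nat_diff add.commute)
  have u: "graded (\<lambda>_. 0) (\<lambda>_. 1) {1} (D2_u s)" "graded int int {int s + 1} (D2_u s)" for s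
    unfolding D2_u_eq by (intro graded_sum graded_scaleR jt(1) deg; simp)+
  have t: "graded (\<lambda>_. 0) (\<lambda>_. 1) {2} (D2_theta s)" "graded int int {int s + 1} (D2_theta s)" for s
    unfolding D2_theta_eq by (intro graded_sum graded_scaleR tt(1) deg; simp)+
  have "graded (\<lambda>_. 0) (\<lambda>_. 1) {p + 1} (D2_u s * pd_u s F)" "graded int int {d + 1} (D2_u s * pd_u s F)"
    "graded (\<lambda>_. 0) (\<lambda>_. 1) {p + 1} (D2_theta s * pd_theta s F)"
    "graded int int {d + 1} (D2_theta s * pd_theta s F)" for s
    by (rule graded_times[OF u(1) graded_pd_u[OF p, where V' = "{p}"]]
        graded_times[OF u(2) graded_pd_u[OF d, where V' = "{d - int s}"]]
        graded_times[OF t(1) graded_pd_theta[OF p, where V' = "{p - 1}"]]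
        graded_times[OF t(2) graded_pd_theta[OF d, where V' = "{d - int s}"]]; simp)+
  then show ?thesis
    by (auto simp: D2_eq_sum[OF F] bidegree_part_iff intro!: graded_sum graded_add)
qed

lemma D1_bidegree:
  assumes "F \<in> bidegree_part p d"
  shows "D1 F \<in> bidegree_part (p + 1) (d + 1)"
proof -
  have p: "graded (\<lambda>_. 0) (\<lambda>_. 1) {p} F" and d: "graded int int {d} F"
    using assms by (auto simp: bidegree_part_iff)
  have F: "graded int int {..<int (nat (d + 1))} F"
    using d by (rule graded_mono) auto
  have "graded (\<lambda>_. 0) (\<lambda>_. 1) {p + 1} (theta (Suc s) * pd_u s F)"
    "graded int int {d + 1} (theta (Suc s) * pd_u s F)" for s
    by (rule graded_theta_times[OF graded_pd_u[OF p, where V' = "{p}"]]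
        graded_theta_times[OF graded_pd_u[OF d, where V' = "{d - int s}"]]; simp)+
  then show ?thesis
    by (auto simp: D1_eq_sum[OF F] bidegree_part_iff intro!: graded_sum)
qed

lemma D_lambda_bidegree:
  assumes "P \<in> lambda_bidegree_part p d"
  shows "D_lambda P \<in> lambda_bidegree_part (p + 1) (d + 1)"
  unfolding lambda_bidegree_part_def
proof (rule CollectI, rule allI)
  fix k
  have P: "coeff P i \<in> bidegree_part p d" for i
    using assms by (simp add: lambda_bidegree_part_def)
  show "coeff (D_lambda P) k \<in> bidegree_part (p + 1) (d + 1)"
    by (cases k) (auto simp: coeff_D_lambda intro!: bidegree_part_diff D1_bidegree D2_bidegree P)
qed

lemma linear_lam_leading: "linear (lam_leading n)"
  unfolding lam_leading_def
  using linear_compose[OF linear_map_poly[OF linear_koszul_d] linear_lam_w]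
    linear_compose[OF linear_lam_T linear_map_poly[OF linear_mult_left]]
  by (intro linear_compose_add) (simp_all add: o_def)

text \<open>D_1 belongs entirely to the leading part, so each coefficient of the remainder is the
  remainder of D_2.\<close>

lemma lam_leading_remainder:
  assumes P: "\<And>k. graded leading_u leading_theta {f..} (coeff P k)"
    "\<And>k. graded int int {d} (coeff P k)" and n: "d < int n" "0 < n"
  shows "graded leading_u leading_theta {f + 1..} (coeff (D_lambda P - lam_leading n P) k)"
proof -
  have *: "graded int int {..<int n} (coeff P k)" for k
    using P(2) by (rule graded_mono) (use n in auto)
  have "coeff (D_lambda P - lam_leading n P) k = D2 (coeff P k) - D2_leading n (coeff P k)"
    by (simp add: coeff_D_lambda lam_leading_def lam_T_def coeff_lam_simps D2_leading_def
        D1_leading[OF * n(2)] linear_base_simps distrib_left right_diff_distrib split: nat.split)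
  then show ?thesis using D2_remainder[OF * n(2) P(1)] by simp
qed

lemma graded_koszul_d_leading:
  assumes "graded leading_u leading_theta V F"
  shows "graded leading_u leading_theta V (koszul_d n F)"
  unfolding koszul_d_def
proof (rule graded_sum)
  fix s assume "s \<in> {1..<n}"
  then have "graded leading_u leading_theta ((\<lambda>x. x - 2) ` V) (pd_u s F)"
    by (intro graded_pd_u[OF assms]) (auto simp: leading_u_def)
  with \<open>s \<in> {1..<n}\<close> show "graded leading_u leading_theta V (theta (Suc s) * pd_u s F)"
    by (elim graded_theta_times) (auto simp: leading_theta_def)
qed

lemma graded_lam_leading:
  assumes P: "\<And>k. graded leading_u leading_theta V (coeff P k)"
  shows "graded leading_u leading_theta V (coeff (lam_leading n P) k)"
proof -
  have u: "graded leading_u leading_theta V F \<Longrightarrow> graded leading_u leading_theta V (jet_u 0 * F)"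
    and t: "graded leading_u leading_theta V F \<Longrightarrow> graded leading_u leading_theta V (theta 1 * F)"
    and du: "graded leading_u leading_theta V F \<Longrightarrow> graded leading_u leading_theta V (pd_u 0 F)" for F
    by (auto simp: leading_u_def leading_theta_def intro: graded_jet_times graded_theta_times graded_pd_u)
  show ?thesis
    using P by (cases k) (auto simp: lam_leading_def lam_T_def coeff_lam_simps euler_def
        intro!: graded_add graded_diff u t[simplified] du graded_koszul_d_leading graded_scaleR graded_weight_op)
qed

lift_definition leading_part :: "int \<Rightarrow> super_series \<Rightarrow> super_series"
  is "\<lambda>f F m S. if weight leading_u leading_theta m S = f then F m S else 0"
  by simp

lemma linear_leading_part: "linear (leading_part f)"
  by (rule linearI) (auto intro!: ss_eqI simp: leading_part.rep_eq)

lemma weight_leading_nonneg: "0 \<le> weight leading_u leading_theta m S"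
  unfolding weight_def
  by (intro add_nonneg_nonneg sum_mset_nonneg_int sum_nonneg) (auto simp: leading_u_def leading_theta_def)

text \<open>A crude bound of the weight in terms of the bidegree; it ends the successive removal of
  lowest parts.\<close>

lemma weight_leading_le:
  "finite S \<Longrightarrow> weight leading_u leading_theta m S \<le> 2 * (weight int int m S + weight (\<lambda>_. 0) (\<lambda>_. 1) m S)"
proof -
  assume "finite S"
  have "(\<Sum>i\<in>#m. leading_u i) \<le> 2 * (\<Sum>i\<in>#m. int i)"
    by (induction m) (auto simp: leading_u_def)
  moreover have "(\<Sum>s\<in>S. leading_theta s) \<le> (\<Sum>s\<in>S. 2 * (int s + 1))"
    by (rule sum_mono) (auto simp: leading_theta_def)
  ultimately show ?thesis
    by (simp add: weight_def sum_distrib_left sum.distrib distrib_left)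
qed

text \<open>\<open>N\<close> measures how far the weights of P may reach down from the bound 2 (p +
  d). The part of lowest weight is closed, hence exact, for the leading differential; subtracting
  the full differential of its primitive raises the lowest weight.\<close>

lemma coboundary_above_diagonal:
  assumes "p < d"
    and "P \<in> lambda_bidegree_part p d" "D_lambda P = 0"
    and "\<And>k. graded leading_u leading_theta {2 * (p + d) + 1 - int N..} (coeff P k)"
  shows "\<exists>Q \<in> lambda_bidegree_part (p - 1) (d - 1). D_lambda Q = P"
  using assms(2-)
proof (induction N arbitrary: P)
  case 0
  have "coeff P k = 0" for k
  proof (rule super_series_eqI)
    fix m :: "nat multiset" and S :: "nat set"
    assume S: "finite S"
    show "ss_coeff (coeff P k) m S = ss_coeff 0 m S"
    proof (rule ccontr)
      assume "\<not> ?thesis"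
      then have nz: "ss_coeff (coeff P k) m S \<noteq> 0" by simp
      from lambda_bidegree_partD[OF 0(1), of k] 0(3)[of k] nz
      have "weight int int m S = d" "weight (\<lambda>_. 0) (\<lambda>_. 1) m S = p"
        "2 * (p + d) + 1 \<le> weight leading_u leading_theta m S"
        by (auto dest!: gradedD)
      with weight_leading_le[OF S, of m] show False by simp
    qed
  qed
  then have "P = 0" by (auto intro: poly_eqI)
  then show ?case
    by (intro bexI[of _ 0]) (simp_all add: lambda_bidegree_part_0 D_lambda_def)
next
  case (Suc N)
  define f where "f = 2 * (p + d) + 1 - int (Suc N)"
  define n where "n = nat (d + 1)"
  have n: "d < int n" "0 < n" if "0 \<le> d" using that by (auto simp: n_def)
  note Pk = lambda_bidegree_partD[OF Suc.prems(1)]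
  have Pf: "graded leading_u leading_theta {f..} (coeff P k)" for k
    using Suc.prems(3)[of k] by (simp only: f_def)
  define P0 where "P0 = map_poly (leading_part f) P"
  have P0k: "coeff P0 k = leading_part f (coeff P k)" for k
    by (simp add: P0_def coeff_map_linear[OF linear_leading_part])
  have P0: "P0 \<in> lam_sector p d f"
    using Pk by (auto simp: lam_sector_def sector_def P0k graded_def leading_part.rep_eq)
  have rest: "graded leading_u leading_theta {f + 1..} (coeff (P - P0) k)" for k
    unfolding graded_def
  proof (intro allI impI)
    fix m S assume "ss_coeff (coeff (P - P0) k) m S \<noteq> 0"
    then have nz: "ss_coeff (coeff P k) m S \<noteq> 0" and ne: "weight leading_u leading_theta m S \<noteq> f"
      by (auto simp: P0k leading_part.rep_eq split: if_splits)
    from gradedD[OF Pf nz] ne show "weight leading_u leading_theta m S \<in> {f + 1..}" by simp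
  qed
  show ?case
  proof (cases "0 \<le> d")
    \<comment> \<open>Negative standard degree contains only 0; it is separated because the
      truncation \<open>n\<close> would be 0.\<close>
    case False
    have "coeff P k = 0" for k
    proof (rule super_series_eqI)
      fix m :: "nat multiset" and S :: "nat set"
      have "0 \<le> weight int int m S" by (simp only: weight_int of_nat_0_le_iff)
      with False Pk(2)[of k] show "ss_coeff (coeff P k) m S = ss_coeff 0 m S"
        by (auto dest: gradedD)
    qed
    then have "P = 0" by (auto intro: poly_eqI)
    then show ?thesis
      by (intro bexI[of _ 0]) (simp_all add: lambda_bidegree_part_0 D_lambda_def)
  next
    case True
    note n = n[OF True]
    \<comment> \<open>This has weight exactly f, while closedness of P expresses it through terms of
      weight at least f + 1.\<close>
    have "lam_leading n P0 = 0"
    proof (rule poly_eqI)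
      fix k
      have eq: "coeff (lam_leading n P0) k =
          - coeff (D_lambda P - lam_leading n P) k - coeff (lam_leading n (P - P0)) k"
        by (simp add: Suc.prems(2) linear_diff[OF linear_lam_leading])
      have "graded leading_u leading_theta {f + 1..} (coeff (lam_leading n P0) k)"
        unfolding eq
        by (rule graded_diff[OF graded_uminus[OF lam_leading_remainder[OF Pf Pk(2) n]] graded_lam_leading[OF rest]])
      moreover have "graded leading_u leading_theta {f} (coeff (lam_leading n P0) k)"
        using P0 by (intro graded_lam_leading) (auto simp: lam_sector_def sector_def)
      ultimately show "coeff (lam_leading n P0) k = coeff 0 k"
        by (auto dest: graded_disjoint)
    qed
    with leading_acyclic[OF P0 assms(1) n(1)] obtain Q where
      Q: "Q \<in> lam_sector (p - 1) (d - 1) f" "lam_leading n Q = P0" by blast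
    have Qb: "Q \<in> lambda_bidegree_part (p - 1) (d - 1)"
      using Q(1) by (auto simp: lam_sector_def sector_def lambda_bidegree_part_def bidegree_part_iff)
    note Qk = lambda_bidegree_partD[OF Qb]
    have Qf: "graded leading_u leading_theta {f..} (coeff Q k)" for k
      using Q(1) by (auto simp: lam_sector_def sector_def intro: graded_mono)
    have DQ: "D_lambda Q \<in> lambda_bidegree_part p d"
      using D_lambda_bidegree[OF Qb] by simp
    have "P - D_lambda Q \<in> lambda_bidegree_part p d"
      by (rule lambda_bidegree_part_diff[OF Suc.prems(1) DQ])
    moreover have "D_lambda (P - D_lambda Q) = 0"
      using Pk(3) Qk(3) lambda_bidegree_partD(3)[OF DQ] Suc.prems(2)
      by (simp add: D_lambda_diff D_lambda_D_lambda)
    moreover have "graded leading_u leading_theta {2 * (p + d) + 1 - int N..} (coeff (P - D_lambda Q) k)" for k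
    proof -
      have eq: "coeff (P - D_lambda Q) k = coeff (P - P0) k - coeff (D_lambda Q - lam_leading n Q) k"
        by (simp add: Q(2))
      have "graded leading_u leading_theta {f + 1..} (coeff (P - D_lambda Q) k)"
        unfolding eq
        by (rule graded_diff[OF rest lam_leading_remainder[OF Qf Qk(2)]]) (use n in auto)
      moreover have "f + 1 = 2 * (p + d) + 1 - int N" by (simp add: f_def)
      ultimately show ?thesis by (simp only:)
    qed
    ultimately obtain Q' where Q': "Q' \<in> lambda_bidegree_part (p - 1) (d - 1)" "D_lambda Q' = P - D_lambda Q"
      using Suc.IH by blast
    with Qb show ?thesis
      by (intro bexI[of _ "Q + Q'"]) (auto simp: D_lambda_add intro: lambda_bidegree_part_add)
  qed
qed

lemma cocycles_above_diagonal:
  assumes "p < d"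
  shows "cocycles p d \<subseteq> coboundaries p d"
proof
  fix P assume "P \<in> cocycles p d"
  then have P: "P \<in> lambda_bidegree_part p d" "D_lambda P = 0" by (auto simp: cocycles_def)
  \<comment> \<open>This choice of \<open>N\<close> brings the lower bound to 0 or less, and every
    weight is nonnegative.\<close>
  have "graded leading_u leading_theta {2 * (p + d) + 1 - int (nat (2 * (p + d) + 1))..} (coeff P k)" for k
    unfolding graded_def using order.trans[OF _ weight_leading_nonneg] by auto
  from coboundary_above_diagonal[OF assms P this] show "P \<in> coboundaries p d"
    by (auto simp: coboundaries_def)
qed

section \<open>Bidegrees on and below the diagonal\<close>

lemma sum_mset_0_or_1:
  assumes "(0 :: nat) \<notin># m"
  shows "\<Sum>\<^sub># m = 0 \<Longrightarrow> m = {#}" "\<Sum>\<^sub># m = 1 \<Longrightarrow> m = {#1#}"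
proof -
  have *: "m = {#}" if "\<Sum>\<^sub># m = 0" "0 \<notin># m" for m :: "nat multiset"
    using that by (cases m) auto
  with assms show "m = {#}" if "\<Sum>\<^sub># m = 0" using that by blast
  show "m = {#1#}" if "\<Sum>\<^sub># m = 1"
  proof (cases m)
    case (add x m')
    with assms that have "x + \<Sum>\<^sub># m' = 1" "x \<noteq> 0" "0 \<notin># m'" by auto
    then have "x = 1" "\<Sum>\<^sub># m' = 0" "0 \<notin># m'" by linarith+
    with add *[of m'] show ?thesis by auto
  qed (use that in auto)
qed

text \<open>d - p is the sum of the indices in m plus the sum of s - 1 over S. Only theta^0
  contributes negatively, by -1, so all other factors together contribute at most 1.\<close>

lemma monomials_on_or_below_diagonal:
  assumes m: "0 \<notin># m" and S: "finite S" and le: "\<Sum>\<^sub># m + \<Sum>S \<le> card S"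
  shows "(m, S) \<in> {({#}, {}), ({#}, {1}), ({#1#}, {0}), ({#1#}, {0, 1}), ({#}, {0, 2}), ({#}, {0, 1, 2}),
    ({#}, {0}), ({#}, {0, 1})}"
proof -
  have nn: "0 \<le> (\<Sum>s\<in>S - {0}. int s - 1)"
    by (rule sum_nonneg) auto
  have sum: "int (\<Sum>\<^sub># m) + (\<Sum>s\<in>S. int s - 1) \<le> 0"
  proof -
    from le have "int (\<Sum>\<^sub># m) + int (\<Sum>S) \<le> int (card S)" by linarith
    then show ?thesis by (simp add: sum_subtractf)
  qed
  have split: "(\<Sum>s\<in>S. int s - 1) = (\<Sum>s\<in>S - {0}. int s - 1) - (if 0 \<in> S then 1 else 0)"
    using S by (auto simp: sum.remove[of S 0])
  have "s \<le> 2" if "s \<in> S" for s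
  proof (rule ccontr)
    assume "\<not> s \<le> 2"
    with that S have "int s - 1 \<le> (\<Sum>s\<in>S - {0}. int s - 1)"
      by (intro member_le_sum) auto
    moreover have "(\<Sum>s\<in>S - {0}. int s - 1) - 1 \<le> (\<Sum>s\<in>S. int s - 1)"
      unfolding split by simp
    moreover have "2 \<le> int s - 1"
      using \<open>\<not> s \<le> 2\<close> by simp
    moreover have "0 \<le> int (\<Sum>\<^sub># m)"
      by (rule of_nat_0_le_iff)
    ultimately show False using sum by linarith
  qed
  then have "S \<subseteq> {0, 1, 2}" by force
  then have "S \<in> Pow {0, 1, 2}" by simp
  then have cases: "S = {} \<or> S = {0} \<or> S = {1} \<or> S = {2} \<or> S = {0, 1} \<or> S = {0, 2} \<or> S = {1, 2} \<or> S = {0, 1, 2}"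
    by (simp add: Pow_insert insert_commute)
  have m01: "m = {#} \<or> m = {#1#}" if "\<Sum>\<^sub># m \<le> 1"
    using that sum_mset_0_or_1[OF m] by linarith
  have m0: "m = {#}" if "\<Sum>\<^sub># m = 0"
    using that sum_mset_0_or_1[OF m] by simp
  from cases le show ?thesis
    using m01 m0 by (elim disjE) auto
qed

section \<open>The differential on the low monomials with coefficients in smooth polynomials\<close>

definition emb :: "super_series \<Rightarrow> smooth poly \<Rightarrow> super_series poly"
  where "emb b a = map_poly (\<lambda>f. ss_const f * b) a"

lemma ss_const_0 [simp]: "ss_const 0 = 0"
  by (rule super_series_eqI) (simp add: ss_const.rep_eq)

lemma ss_const_add: "ss_const (f + g) = ss_const f + ss_const g"
  by (rule super_series_eqI) (simp add: ss_const.rep_eq)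

lemma ss_const_scaleR: "ss_const (r *\<^sub>R f) = r *\<^sub>R ss_const f"
  by (rule super_series_eqI) (simp add: ss_const.rep_eq)

lemma linear_ss_const: "linear ss_const"
  by (rule linearI) (simp_all add: ss_const_add ss_const_scaleR)

lemma ss_const_mult: "ss_const f * ss_const g = ss_const (f * g)"
  by (rule super_series_eqI) (simp add: ss_const.rep_eq coeff_const_times)

lemma ss_const_mult_left: "ss_const f * (ss_const g * F) = ss_const (f * g) * F"
  by (simp add: ss_const_mult flip: mult.assoc)

lemma coeff_emb: "coeff (emb b a) k = ss_const (coeff a k) * b"
  by (simp add: emb_def coeff_map_poly)

lemma emb_0 [simp]: "emb b 0 = 0"
  by (simp add: emb_def)

definition lin_w :: "smooth poly"
  where "lin_w = [:smooth_coord, -1:]"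

abbreviation du :: "smooth poly \<Rightarrow> smooth poly"
  where "du \<equiv> map_poly smooth_deriv"

lemma coeff_lin_w: "coeff (lin_w * a) k = smooth_coord * coeff a k - (case k of 0 \<Rightarrow> 0 | Suc j \<Rightarrow> coeff a j)"
  by (simp add: lin_w_def coeff_pCons split: nat.split)

lemma coeff_du: "coeff (du a) k = smooth_deriv (coeff a k)"
  by (simp add: coeff_map_poly smooth_deriv_0)

lemma coeff_D_lambda_emb:
  assumes "finite_degree b"
  shows "coeff (D_lambda (emb b a)) k =
    ss_const (coeff (du a) k) * (D2_u 0 * b) + ss_const (coeff a k) * D2 b -
    (case k of 0 \<Rightarrow> 0 | Suc j \<Rightarrow> ss_const (coeff (du a) j) * (theta 1 * b) + ss_const (coeff a j) * D1 b)"
  using assms by (simp add: coeff_D_lambda coeff_emb D2_const_times D1_const_times coeff_du split: nat.split)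

lemma D1_theta: "D1 (theta t) = 0"
  using D1_theta_times[of 1 t] by (simp add: finite_degree_gens D1_def)

lemma theta_mult_eqs:
  "theta 1 * theta 0 = - (theta 0 * theta 1)" "theta 1 * theta 1 = 0" "theta 0 * theta 0 = 0"
  "theta 2 * theta 0 = - (theta 0 * theta 2)" "theta 2 * theta 1 = - (theta 1 * theta 2)"
  using theta_anticommute[of 1 0 1] theta_anticommute[of 2 0 1] theta_anticommute[of 2 1 1]
    theta_square[of 1 1] theta_square[of 0 1] by simp_all

lemma D2_u_0: "D2_u 0 = jet_u 0 * theta 1 + (1/2) *\<^sub>R (jet_u 1 * theta 0)"
  by (simp add: D2_u_def)

lemma D2_u_1: "D2_u 1 = jet_u 0 * theta 2 + (3/2) *\<^sub>R (jet_u 1 * theta 1) + (1/2) *\<^sub>R (jet_u 2 * theta 0)"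
  by (simp add: D2_u_eq D2_u_coeff_def numeral_2_eq_2)

lemma D2_theta_0: "D2_theta 0 = (1/2) *\<^sub>R (theta 0 * theta 1)"
  by (simp add: D2_theta_def)

lemma D2_theta_1: "D2_theta 1 = (1/2) *\<^sub>R (theta 0 * theta 2)"
  using theta_mult_eqs(2) by (simp add: D2_theta_eq numeral_2_eq_2)

lemma D2_theta_2: "D2_theta 2 = (1/2) *\<^sub>R (theta 0 * theta 3) + (1/2) *\<^sub>R (theta 1 * theta 2)"
proof -
  have "theta 1 * theta 2 + (1/2) *\<^sub>R (theta 2 * theta 1) = (1/2) *\<^sub>R (theta 1 * theta 2)"
  proof -
    have "theta 1 * theta 2 + (1/2) *\<^sub>R (theta 2 * theta 1) = (1 - 1/2) *\<^sub>R (theta 1 * theta 2)"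
      unfolding theta_mult_eqs scaleR_diff_left by simp
    then show ?thesis by simp
  qed
  then show ?thesis
    by (simp add: D2_theta_eq numeral_2_eq_2 numeral_3_eq_3 add.assoc)
qed

text \<open>This and the next five formulas describe the complex for d at most p. The two remaining
  monomials theta^0 theta^1 and theta^0 theta^1 theta^2 are closed because their target bidegrees
  are zero.\<close>

lemma D_lambda_emb_1: "D_lambda (emb 1 a) = emb (theta 1) (lin_w * du a) + emb (jet_u 1 * theta 0) ((1/2) *\<^sub>R du a)"
proof (rule poly_eqI)
  fix k
  have "D2 1 = 0" "D1 1 = 0" by (simp_all add: D2_alt D1_def)
  then show "coeff (D_lambda (emb 1 a)) k =
      coeff (emb (theta 1) (lin_w * du a) + emb (jet_u 1 * theta 0) ((1/2) *\<^sub>R du a)) k"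
    by (simp add: coeff_D_lambda_emb finite_degree_gens coeff_emb coeff_lin_w coeff_scaleR_poly
        D2_u_0 jet_0 ss_const_mult_left linear_diff[OF linear_ss_const] ss_const_add ss_const_scaleR algebra_simps
        split: nat.split)
qed

lemma D_lambda_emb_theta_0:
  "D_lambda (emb (theta 0) a) = emb (theta 0 * theta 1) ((1/2) *\<^sub>R a - lin_w * du a)"
proof (rule poly_eqI)
  fix k
  have "D2_u 0 * theta 0 = - (ss_const smooth_coord * (theta 0 * theta 1))"
    by (simp add: D2_u_0 distrib_right mult.assoc theta_mult_eqs[simplified] jet_0)
  then show "coeff (D_lambda (emb (theta 0) a)) k =
      coeff (emb (theta 0 * theta 1) ((1/2) *\<^sub>R a - lin_w * du a)) k"
    by (simp add: coeff_D_lambda_emb finite_degree_gens coeff_emb coeff_lin_w coeff_scaleR_poly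
        D2_gens D1_theta D2_theta_0 theta_mult_eqs[simplified]
        ss_const_mult_left linear_diff[OF linear_ss_const] ss_const_add ss_const_scaleR algebra_simps
        split: nat.split)
qed

lemma D_lambda_emb_theta_1:
  "D_lambda (emb (theta 1) a) = emb (theta 0 * theta 2) ((1/2) *\<^sub>R a)
    + emb (jet_u 1 * (theta 0 * theta 1)) ((1/2) *\<^sub>R du a)"
proof (rule poly_eqI)
  fix k
  have "D2_u 0 * theta 1 = (1/2) *\<^sub>R (jet_u 1 * (theta 0 * theta 1))"
    by (simp add: D2_u_0 distrib_right mult.assoc theta_mult_eqs[simplified] jet_0)
  then show "coeff (D_lambda (emb (theta 1) a)) k = coeff (emb (theta 0 * theta 2) ((1/2) *\<^sub>R a)
    + emb (jet_u 1 * (theta 0 * theta 1)) ((1/2) *\<^sub>R du a)) k"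
    using D2_theta_1
    by (simp add: coeff_D_lambda_emb finite_degree_gens coeff_emb coeff_scaleR_poly
        D2_gens D1_theta theta_mult_eqs[simplified]
        ss_const_mult_left linear_diff[OF linear_ss_const] ss_const_add ss_const_scaleR algebra_simps
        split: nat.split)
qed

lemma D_lambda_emb_jet_1_theta_0:
  "D_lambda (emb (jet_u 1 * theta 0) a) = emb (theta 0 * theta 2) (- (lin_w * a))
    + emb (jet_u 1 * (theta 0 * theta 1)) (- a - lin_w * du a)"
proof (rule poly_eqI)
  fix k
  have 1: "D2_u 0 * (jet_u 1 * theta 0) = - (ss_const smooth_coord * (jet_u 1 * (theta 0 * theta 1)))"
    unfolding D2_u_jet by (simp add: D2_u_0 distrib_right mult.assoc theta_mult_eqs[simplified] jet_0 const_jet)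
  have 2: "D2 (jet_u 1 * theta 0) = - (ss_const smooth_coord * (theta 0 * theta 2)) - jet_u 1 * (theta 0 * theta 1)"
  proof -
    have "D2 (jet_u 1 * theta 0) = D2_u 1 * theta 0 + jet_u 1 * D2_theta 0"
      by (simp add: D2_jet_times finite_degree_gens D2_gens)
    \<comment> \<open>1/2 comes from \<open>D2_theta 0\<close>, and -3/2 from the term u^1 theta^1
      of \<open>D2_u 1\<close> after reordering theta^1 theta^0.\<close>
    also have "\<dots> = - (jet_u 0 * (theta 0 * theta 2)) + (1/2 - 3/2) *\<^sub>R (jet_u 1 * (theta 0 * theta 1))"
      unfolding D2_u_1 D2_theta_0 scaleR_diff_left
      by (simp add: distrib_right mult.assoc theta_mult_eqs[simplified])
    finally show ?thesis by (simp add: jet_0)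
  qed
  have 3: "D1 (jet_u 1 * theta 0) = - (theta 0 * theta 2)"
    by (simp add: D1_jet_times finite_degree_gens D1_theta theta_mult_eqs numeral_2_eq_2[symmetric])
  have 4: "theta 1 * (jet_u 1 * theta 0) = - (jet_u 1 * (theta 0 * theta 1))"
    by (simp add: jet_theta[symmetric] theta_mult_eqs[simplified] mult.assoc
        flip: jet_theta[of 1 1 "theta 0", simplified])
  show "coeff (D_lambda (emb (jet_u 1 * theta 0) a)) k = coeff (emb (theta 0 * theta 2) (- (lin_w * a))
    + emb (jet_u 1 * (theta 0 * theta 1)) (- a - lin_w * du a)) k"
    unfolding coeff_D_lambda_emb[OF finite_degree_times[OF finite_degree_gens(2) finite_degree_gens(1)]] 1 2 3 4
    by (simp add: coeff_emb coeff_lin_w split: nat.split)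
      (simp add: ss_const_mult_left linear_diff[OF linear_ss_const] linear_neg[OF linear_ss_const]
         linear_add[OF linear_ss_const] algebra_simps)
qed

lemma theta_012: "theta 1 * (theta 0 * theta 2) = - (theta 0 * (theta 1 * theta 2))"
  "theta 2 * (theta 0 * theta 1) = theta 0 * (theta 1 * theta 2)"
  "theta 0 * (theta 0 * F) = 0" "theta 1 * (theta 0 * theta 1) = 0"
  using theta_anticommute[of 1 0] theta_anticommute[of 2 0 "theta 1"] theta_mult_eqs theta_square[of 0]
  by simp_all

lemma D_lambda_emb_theta_0_theta_2:
  "D_lambda (emb (theta 0 * theta 2) a) = emb (theta 0 * (theta 1 * theta 2)) (- (lin_w * du a))"
proof (rule poly_eqI)
  fix k
  have 1: "D2_u 0 * (theta 0 * theta 2) = - (ss_const smooth_coord * (theta 0 * (theta 1 * theta 2)))"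
    by (simp add: D2_u_0 distrib_right mult.assoc theta_012[simplified] jet_0)
  \<comment> \<open>Differentiating theta^0 and theta^2 gives theta^0 theta^1 theta^2 / 2 twice with
    opposite signs; the term theta^0 theta^3 of \<open>D2_theta 2\<close> dies against
    theta^0.\<close>
  have 2: "D2 (theta 0 * theta 2) = 0"
    by (simp add: D2_theta_mult D2_gens finite_degree_gens D2_theta_0 D2_theta_2 distrib_left mult.assoc
        theta_012[simplified])
  have 3: "D1 (theta 0 * theta 2) = 0"
    by (simp add: D1_theta_times finite_degree_gens D1_theta)
  show "coeff (D_lambda (emb (theta 0 * theta 2) a)) k = coeff (emb (theta 0 * (theta 1 * theta 2)) (- (lin_w * du a))) k"
    unfolding coeff_D_lambda_emb[OF finite_degree_times[OF finite_degree_gens(1) finite_degree_gens(1)]] 1 2 3 theta_012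
    by (simp add: coeff_emb coeff_lin_w split: nat.split)
      (simp add: ss_const_mult_left linear_diff[OF linear_ss_const] linear_neg[OF linear_ss_const]
         linear_add[OF linear_ss_const] algebra_simps)
qed

lemma D_lambda_emb_jet_1_theta_0_theta_1:
  "D_lambda (emb (jet_u 1 * (theta 0 * theta 1)) a) = emb (theta 0 * (theta 1 * theta 2)) (lin_w * a)"
proof (rule poly_eqI)
  fix k
  have 1: "D2_u 0 * (jet_u 1 * (theta 0 * theta 1)) = 0"
    unfolding D2_u_jet by (simp add: D2_u_0 distrib_right mult.assoc theta_012[simplified])
  have 2: "D2 (jet_u 1 * (theta 0 * theta 1)) = ss_const smooth_coord * (theta 0 * (theta 1 * theta 2))"
  proof -
    have "D2 (theta 0 * theta 1) = 0"
      using D2_D2_theta[of 0] by (simp add: D2_theta_0 D2_linear finite_degree_intros)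
    then have "D2 (jet_u 1 * (theta 0 * theta 1)) = D2_u 1 * (theta 0 * theta 1)"
      by (simp add: D2_jet_times finite_degree_intros)
    also have "\<dots> = ss_const smooth_coord * (theta 0 * (theta 1 * theta 2))"
      unfolding D2_u_1 by (simp add: distrib_right mult.assoc theta_012[simplified] jet_0)
    finally show ?thesis .
  qed
  have 3: "D1 (jet_u 1 * (theta 0 * theta 1)) = theta 0 * (theta 1 * theta 2)"
    by (simp add: D1_jet_times D1_theta_times finite_degree_intros D1_theta theta_012[simplified] numeral_2_eq_2[symmetric])
  have 4: "theta 1 * (jet_u 1 * (theta 0 * theta 1)) = 0"
    by (simp add: theta_012[simplified] flip: jet_theta)
  show "coeff (D_lambda (emb (jet_u 1 * (theta 0 * theta 1)) a)) k = coeff (emb (theta 0 * (theta 1 * theta 2)) (lin_w * a)) k"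
    unfolding coeff_D_lambda_emb[OF finite_degree_times[OF finite_degree_gens(2) finite_degree_times[OF finite_degree_gens(1) finite_degree_gens(1)]]] 1 2 3 4
    by (simp add: coeff_emb coeff_lin_w split: nat.split)
      (simp add: ss_const_mult_left linear_diff[OF linear_ss_const] linear_neg[OF linear_ss_const]
         linear_add[OF linear_ss_const] algebra_simps)
qed

section \<open>Coordinates on the low bidegrees\<close>

definition is_monomial :: "super_series \<Rightarrow> nat multiset \<Rightarrow> nat set \<Rightarrow> bool"
  where "is_monomial b m S \<longleftrightarrow> (\<forall>m' S'. ss_coeff b m' S' = (if m' = m \<and> S' = S then 1 else 0))"

lemma is_monomial_1: "is_monomial 1 {#} {}"
  by (simp add: is_monomial_def one_super_series.rep_eq)

text \<open>Prepending a smaller index creates no inversion, so the sign is 1.\<close>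

lemma is_monomial_theta:
  assumes "is_monomial b m S" "\<And>s. s \<in> S \<Longrightarrow> t < s"
  shows "is_monomial (theta t * b) m (insert t S)"
proof -
  have empty: "{(i, j). i \<in> {t} \<and> j \<in> S \<and> j < i} = {}" using assms(2) by force
  have "shuffle_sign {t} S = 1" unfolding shuffle_sign_def empty by simp
  moreover have "t \<notin> S" using assms(2) by auto
  ultimately show ?thesis
    using assms(1) by (auto simp: is_monomial_def coeff_theta_times insert_absorb)
qed

lemma is_monomial_jet: "is_monomial b m S \<Longrightarrow> 0 < t \<Longrightarrow> is_monomial (jet_u t * b) (add_mset t m) S"
  by (auto simp: is_monomial_def coeff_jet_times dest!: multi_member_split)

lemma basis_monomials:
  "is_monomial (theta 0) {#} {0}" "is_monomial (theta 1) {#} {1}"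
  "is_monomial (theta 0 * theta 1) {#} {0, 1}" "is_monomial (jet_u 1 * theta 0) {#1#} {0}"
  "is_monomial (theta 0 * theta 2) {#} {0, 2}" "is_monomial (jet_u 1 * (theta 0 * theta 1)) {#1#} {0, 1}"
  "is_monomial (theta 0 * (theta 1 * theta 2)) {#} {0, 1, 2}"
proof -
  have t: "is_monomial (theta t) {#} {t}" for t
    using is_monomial_theta[OF is_monomial_1, of t] by simp
  have tt: "is_monomial (theta s * theta t) {#} {s, t}" if "s < t" for s t
    by (rule is_monomial_theta[OF t]) (use that in simp)
  have ttt: "is_monomial (theta 0 * (theta 1 * theta 2)) {#} {0, 1, 2}"
    by (rule is_monomial_theta[OF tt]) auto
  have jt: "is_monomial (jet_u 1 * theta 0) {#1#} {0}"
    by (rule is_monomial_jet[OF t]) simp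
  have jtt: "is_monomial (jet_u 1 * (theta 0 * theta 1)) {#1#} {0, 1}"
    by (rule is_monomial_jet[OF tt]; simp)
  show "is_monomial (theta 0) {#} {0}" "is_monomial (theta 1) {#} {1}" by (rule t)+
  show "is_monomial (theta 0 * theta 1) {#} {0, 1}" "is_monomial (theta 0 * theta 2) {#} {0, 2}"
    by (rule tt; simp)+
  show "is_monomial (jet_u 1 * theta 0) {#1#} {0}" by (rule jt)
  show "is_monomial (jet_u 1 * (theta 0 * theta 1)) {#1#} {0, 1}" by (rule jtt)
  show "is_monomial (theta 0 * (theta 1 * theta 2)) {#} {0, 1, 2}" by (rule ttt)
qed

definition component :: "nat multiset \<Rightarrow> nat set \<Rightarrow> super_series poly \<Rightarrow> smooth poly"
  where "component m S = map_poly (\<lambda>F. ss_coeff F m S)"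

lemma coeff_component: "coeff (component m S P) k = ss_coeff (coeff P k) m S"
  by (simp add: component_def coeff_map_poly)

lemma component_add: "component m S (P + Q) = component m S P + component m S Q"
  by (rule poly_eqI) (simp add: coeff_component)

lemma component_0: "component m S 0 = 0"
  by (simp add: component_def)

lemma component_emb: "is_monomial b m S \<Longrightarrow> component m' S' (emb b a) = (if m' = m \<and> S' = S then a else 0)"
  by (rule poly_eqI) (simp add: coeff_component coeff_emb coeff_const_times is_monomial_def)

lemma emb_inject: "is_monomial b m S \<Longrightarrow> emb b a = emb b a' \<longleftrightarrow> a = a'"
  using component_emb[of b m S m S] by metis

lemma emb_add: "emb b (a + a') = emb b a + emb b a'"
  by (rule poly_eqI) (simp add: coeff_emb ss_const_add distrib_right)

lemma emb_diff: "emb b (a - a') = emb b a - emb b a'"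
  by (rule poly_eqI) (simp add: coeff_emb linear_diff[OF linear_ss_const] left_diff_distrib)

lemma emb_lambda_bidegree:
  assumes b: "is_monomial b m S" and "p = int (card S)" "d = int (\<Sum>\<^sub># m + \<Sum>S)"
  shows "emb b a \<in> lambda_bidegree_part p d"
  using assms
  by (auto simp: lambda_bidegree_part_def bidegree_part_def coeff_emb coeff_const_times is_monomial_def split: if_splits)

lemma support_on_or_below_diagonal:
  assumes P: "P \<in> lambda_bidegree_part p d" and "d \<le> p" and nz: "ss_coeff (coeff P k) m S \<noteq> 0"
  shows "(m, S, p, d) \<in> {({#}, {}, 0, 0), ({#}, {1}, 1, 1), ({#1#}, {0}, 1, 1), ({#1#}, {0, 1}, 2, 2),
    ({#}, {0, 2}, 2, 2), ({#}, {0, 1, 2}, 3, 3), ({#}, {0}, 1, 0), ({#}, {0, 1}, 2, 1)}"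
proof -
  have m: "0 \<notin># m" "finite S"
    using nz coeff_unsupported by blast+
  have pd: "p = int (card S)" "d = int (\<Sum>\<^sub># m + \<Sum>S)"
    using P nz unfolding lambda_bidegree_part_def bidegree_part_def by blast+
  with \<open>d \<le> p\<close> have "\<Sum>\<^sub># m + \<Sum>S \<le> card S" by linarith
  from monomials_on_or_below_diagonal[OF m this] show ?thesis
    unfolding pd by (elim insertE emptyE; clarsimp)
qed

lemma lambda_bidegree_part_trivial:
  assumes P: "P \<in> lambda_bidegree_part p d" and "d \<le> p"
    and "(p, d) \<notin> {(0, 0), (1, 0), (1, 1), (2, 1), (2, 2), (3, 3)}"
  shows "P = 0"
proof (rule poly_eqI, rule super_series_eqI)
  fix k m S
  show "ss_coeff (coeff P k) m S = ss_coeff (coeff 0 k) m S"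
    using support_on_or_below_diagonal[OF P \<open>d \<le> p\<close>, of k m S] assms(3) by auto
qed

lemma emb_component:
  assumes b: "is_monomial b m S"
    and supp: "\<And>k m' S'. ss_coeff (coeff P k) m' S' \<noteq> 0 \<Longrightarrow> (m', S') = (m, S)"
  shows "P = emb b (component m S P)"
proof (rule poly_eqI, rule super_series_eqI)
  fix k m' S'
  show "ss_coeff (coeff P k) m' S' = ss_coeff (coeff (emb b (component m S P)) k) m' S'"
  proof (cases "(m', S') = (m, S)")
    case True
    then show ?thesis using b by (simp add: coeff_emb coeff_component coeff_const_times is_monomial_def)
  next
    case False
    with supp have "ss_coeff (coeff P k) m' S' = 0" by blast
    moreover have "ss_coeff b m' S' = 0" using b False by (auto simp: is_monomial_def)
    ultimately show ?thesis by (simp add: coeff_emb coeff_component coeff_const_times)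
  qed
qed

lemma emb_component2:
  assumes b: "is_monomial b m S" "is_monomial b' n T" "(m, S) \<noteq> (n, T)"
    and supp: "\<And>k m' S'. ss_coeff (coeff P k) m' S' \<noteq> 0 \<Longrightarrow> (m', S') = (m, S) \<or> (m', S') = (n, T)"
  shows "P = emb b (component m S P) + emb b' (component n T P)"
proof (rule poly_eqI, rule super_series_eqI)
  fix k m' S'
  show "ss_coeff (coeff P k) m' S' =
      ss_coeff (coeff (emb b (component m S P) + emb b' (component n T P)) k) m' S'"
  proof -
    consider "(m', S') = (m, S)" | "(m', S') = (n, T)" | "(m', S') \<noteq> (m, S)" "(m', S') \<noteq> (n, T)"
      by blast
    then show ?thesis
    proof cases
      case 3
      with supp have "ss_coeff (coeff P k) m' S' = 0" by blast
      moreover have "ss_coeff b m' S' = 0" "ss_coeff b' m' S' = 0"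
        using b 3 by (auto simp: is_monomial_def)
      ultimately show ?thesis by (simp add: coeff_emb coeff_component coeff_const_times)
    next
      case 1
      then have "ss_coeff b m' S' = 1" "ss_coeff b' m' S' = 0"
        using b by (auto simp: is_monomial_def)
      with 1 show ?thesis by (simp add: coeff_emb coeff_component coeff_const_times)
    next
      case 2
      then have "ss_coeff b m' S' = 0" "ss_coeff b' m' S' = 1"
        using b by (auto simp: is_monomial_def)
      with 2 show ?thesis by (simp add: coeff_emb coeff_component coeff_const_times)
    qed
  qed
qed

lemma lambda_bidegree_part_eq:
  "lambda_bidegree_part 0 0 = range (emb 1)" (is ?A)
  "lambda_bidegree_part 1 0 = range (emb (theta 0))" (is ?B)
  "lambda_bidegree_part 2 1 = range (emb (theta 0 * theta 1))" (is ?C)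
  "lambda_bidegree_part 3 3 = range (emb (theta 0 * (theta 1 * theta 2)))" (is ?D)
  "lambda_bidegree_part 1 1 = {emb (theta 1) a + emb (jet_u 1 * theta 0) b | a b. True}" (is ?E)
  "lambda_bidegree_part 2 2 =
    {emb (theta 0 * theta 2) a + emb (jet_u 1 * (theta 0 * theta 1)) b | a b. True}" (is ?F)
proof -
  note bm = is_monomial_1 basis_monomials
  show ?A
  proof (intro equalityI subsetI)
    fix P assume P: "P \<in> lambda_bidegree_part 0 0"
    have "P = emb 1 (component {#} {} P)"
      by (rule emb_component[OF bm(1)], drule support_on_or_below_diagonal[OF P, rotated]) auto
    then show "P \<in> range (emb 1)" by (rule range_eqI)
  qed (clarify, rule emb_lambda_bidegree[OF bm(1)]; simp)
  show ?B
  proof (intro equalityI subsetI)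
    fix P assume P: "P \<in> lambda_bidegree_part 1 0"
    have "P = emb (theta 0) (component {#} {0} P)"
      by (rule emb_component[OF bm(2)], drule support_on_or_below_diagonal[OF P, rotated]) auto
    then show "P \<in> range (emb (theta 0))" by (rule range_eqI)
  qed (clarify, rule emb_lambda_bidegree[OF bm(2)]; simp)
  show ?C
  proof (intro equalityI subsetI)
    fix P assume P: "P \<in> lambda_bidegree_part 2 1"
    have "P = emb (theta 0 * theta 1) (component {#} {0, 1} P)"
      by (rule emb_component[OF bm(4)], drule support_on_or_below_diagonal[OF P, rotated]) auto
    then show "P \<in> range (emb (theta 0 * theta 1))" by (rule range_eqI)
  qed (clarify, rule emb_lambda_bidegree[OF bm(4)]; simp)
  show ?D
  proof (intro equalityI subsetI)
    fix P assume P: "P \<in> lambda_bidegree_part 3 3"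
    have "P = emb (theta 0 * (theta 1 * theta 2)) (component {#} {0, 1, 2} P)"
      by (rule emb_component[OF bm(8)], drule support_on_or_below_diagonal[OF P, rotated]) auto
    then show "P \<in> range (emb (theta 0 * (theta 1 * theta 2)))" by (rule range_eqI)
  qed (clarify, rule emb_lambda_bidegree[OF bm(8)]; simp)
  show ?E
  proof (intro equalityI subsetI)
    fix P assume P: "P \<in> lambda_bidegree_part 1 1"
    have "P = emb (theta 1) (component {#} {1} P) + emb (jet_u 1 * theta 0) (component {#1#} {0} P)"
      by (rule emb_component2[OF bm(3,5)], simp, drule support_on_or_below_diagonal[OF P, rotated]) auto
    then show "P \<in> {emb (theta 1) a + emb (jet_u 1 * theta 0) b | a b. True}" by - (intro CollectI exI conjI, assumption, rule TrueI)
  next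
    fix P assume "P \<in> {emb (theta 1) a + emb (jet_u 1 * theta 0) b | a b. True}"
    then obtain a b where eq: "P = emb (theta 1) a + emb (jet_u 1 * theta 0) b" by blast
    show "P \<in> lambda_bidegree_part 1 1"
      unfolding eq by (intro lambda_bidegree_part_add)
        (rule emb_lambda_bidegree[OF bm(3)] emb_lambda_bidegree[OF bm(5)]; simp)+
  qed
  show ?F
  proof (intro equalityI subsetI)
    fix P assume P: "P \<in> lambda_bidegree_part 2 2"
    have "P = emb (theta 0 * theta 2) (component {#} {0, 2} P)
        + emb (jet_u 1 * (theta 0 * theta 1)) (component {#1#} {0, 1} P)"
      by (rule emb_component2[OF bm(6,7)], simp, drule support_on_or_below_diagonal[OF P, rotated]) auto
    then show "P \<in> {emb (theta 0 * theta 2) a + emb (jet_u 1 * (theta 0 * theta 1)) b | a b. True}" by - (intro CollectI exI conjI, assumption, rule TrueI)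
  next
    fix P assume "P \<in> {emb (theta 0 * theta 2) a + emb (jet_u 1 * (theta 0 * theta 1)) b | a b. True}"
    then obtain a b where eq: "P = emb (theta 0 * theta 2) a + emb (jet_u 1 * (theta 0 * theta 1)) b" by blast
    show "P \<in> lambda_bidegree_part 2 2"
      unfolding eq by (intro lambda_bidegree_part_add)
        (rule emb_lambda_bidegree[OF bm(6)] emb_lambda_bidegree[OF bm(7)]; simp)+
  qed
qed

section \<open>Antiderivatives and polynomial functions\<close>

text \<open>Continuity yields an antiderivative on the whole line, and it is smooth because its
  derivative is.\<close>

lemma smooth_antiderivative: "\<exists>g. smooth_deriv g = f"
proof -
  have "isCont (apply_smooth f) x" for x
    by (rule DERIV_isCont[OF DERIV_apply_smooth])
  then obtain F where F: "(F has_real_derivative apply_smooth f x) (at x)" for x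
    using einterval_antiderivative[of "-\<infinity>" "\<infinity>" "apply_smooth f"]
    by (auto simp: has_real_derivative_iff_has_vector_derivative)
  then have "deriv F = apply_smooth f"
    by (auto intro: DERIV_imp_deriv)
  then have "(deriv ^^ n) F differentiable (at x)" for n x
    using smooth_real_apply[of f] F
    by (cases n) (auto simp: smooth_real_def funpow_Suc_right real_differentiable_def simp del: funpow.simps)
  then have "smooth_real F" by (simp add: smooth_real_def)
  with F show ?thesis
    by (intro exI[of _ "Smooth F"] smooth_deriv_unique) (simp add: Smooth_inverse)
qed

lemma apply_smooth_of_real: "apply_smooth (of_real c) x = c"
  by (simp add: of_real_def scaleR_smooth.rep_eq one_smooth.rep_eq)

lemma smooth_deriv_eq_0:
  assumes "smooth_deriv f = 0"
  shows "f = of_real (apply_smooth f 0)"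
proof (rule smooth_eqI)
  fix x
  have "DERIV (apply_smooth f) x :> 0" for x
    using DERIV_apply_smooth[of f x] by (simp add: assms zero_smooth.rep_eq)
  then show "apply_smooth f x = apply_smooth (of_real (apply_smooth f 0)) x"
    using DERIV_isconst_all[of "apply_smooth f" x 0] by (simp add: apply_smooth_of_real)
qed

lemma smooth_deriv_of_real [simp]: "smooth_deriv (of_real c) = 0"
  by (simp add: of_real_def smooth_deriv_scaleR)

lemma subspace_polynomial_functions: "subspace polynomial_functions"
proof (rule subspaceI)
  show "0 \<in> polynomial_functions"
    by (auto simp: polynomial_functions_def zero_smooth.rep_eq fun_eq_iff intro: exI[of _ 0])
  show "f + g \<in> polynomial_functions" if "f \<in> polynomial_functions" "g \<in> polynomial_functions" for f g
  proof -
    from that obtain p q where "apply_smooth f = poly p" "apply_smooth g = poly q"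
      by (auto simp: polynomial_functions_def)
    then have "apply_smooth (f + g) = poly (p + q)" by (simp add: plus_smooth.rep_eq fun_eq_iff)
    then show ?thesis by (auto simp: polynomial_functions_def)
  qed
  show "c *\<^sub>R f \<in> polynomial_functions" if "f \<in> polynomial_functions" for c f
  proof -
    from that obtain p where "apply_smooth f = poly p"
      by (auto simp: polynomial_functions_def)
    then have "apply_smooth (c *\<^sub>R f) = poly (smult c p)" by (simp add: scaleR_smooth.rep_eq fun_eq_iff)
    then show ?thesis by (auto simp: polynomial_functions_def)
  qed
qed

lemma polynomial_functions_coord_mult:
  assumes "f \<in> polynomial_functions"
  shows "smooth_coord * f \<in> polynomial_functions"
proof -
  from assms obtain p where "apply_smooth f = poly p"
    by (auto simp: polynomial_functions_def)
  then have "apply_smooth (smooth_coord * f) = poly (pCons 0 p)"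
    by (simp add: times_smooth.rep_eq smooth_coord.rep_eq fun_eq_iff)
  then show ?thesis by (auto simp: polynomial_functions_def)
qed

lemma polynomial_functions_deriv_iff: "smooth_deriv f \<in> polynomial_functions \<longleftrightarrow> f \<in> polynomial_functions"
proof
  assume "f \<in> polynomial_functions"
  then obtain p where p: "apply_smooth f = poly p"
    by (auto simp: polynomial_functions_def)
  have "apply_smooth (smooth_deriv f) x = poly (pderiv p) x" for x
    using DERIV_unique[OF DERIV_apply_smooth[of f x, unfolded p] poly_DERIV] .
  then show "smooth_deriv f \<in> polynomial_functions"
    by (auto simp: polynomial_functions_def fun_eq_iff)
next
  assume "smooth_deriv f \<in> polynomial_functions"
  then obtain q where q: "apply_smooth (smooth_deriv f) = poly q"
    by (auto simp: polynomial_functions_def)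
  \<comment> \<open>The formal antiderivative of q, from which f differs by a constant.\<close>
  define p where "p = (\<Sum>i\<le>degree q. monom (coeff q i / real (Suc i)) (Suc i))"
  have "pderiv p = q"
  proof -
    have "pderiv p = (\<Sum>i\<le>degree q. pderiv (monom (coeff q i / real (Suc i)) (Suc i)))"
      unfolding p_def using higher_pderiv_sum[of 1 "\<lambda>i. monom (coeff q i / real (Suc i)) (Suc i)"]
      by (simp only: One_nat_def funpow.simps comp_id)
    also have "\<dots> = (\<Sum>i\<le>degree q. monom (coeff q i) i)"
      by (rule sum.cong) (auto simp: pderiv_monom simp del: of_nat_Suc)
    finally show ?thesis by (simp only: poly_as_sum_of_monoms)
  qed
  have "((\<lambda>x. apply_smooth f x - poly p x) has_real_derivative 0) (at x)" for x
    using DERIV_diff[OF DERIV_apply_smooth[of f x] poly_DERIV[of p x]]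
    unfolding q \<open>pderiv p = q\<close> diff_self .
  then have "\<forall>x. ((\<lambda>x. apply_smooth f x - poly p x) has_real_derivative 0) (at x)" by blast
  note const = DERIV_isconst_all[OF this]
  obtain c where "apply_smooth f 0 - poly p 0 = c" by blast
  with const[of _ 0] have "apply_smooth f x = poly (p + [:c:]) x" for x
    by (simp add: diff_eq_eq add.commute)
  then show "f \<in> polynomial_functions"
    unfolding polynomial_functions_def by blast
qed

lemma apply_smooth_coord_power: "apply_smooth (smooth_coord ^ i) x = x ^ i"
proof (induction i)
  case 0
  show ?case by (simp add: one_smooth.rep_eq)
next
  case (Suc i)
  then show ?case by (simp only: power_Suc times_smooth.rep_eq smooth_coord.rep_eq)
qed

lemma polynomial_function_expansion:
  assumes "f \<in> polynomial_functions"
  shows "\<exists>q. f = (\<Sum>i\<le>degree q. coeff q i *\<^sub>R smooth_coord ^ i)"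
proof -
  from assms obtain q where q: "apply_smooth f = poly q"
    by (auto simp: polynomial_functions_def)
  have "apply_smooth (\<Sum>i\<in>I. coeff q i *\<^sub>R smooth_coord ^ i) x = (\<Sum>i\<in>I. coeff q i * x ^ i)" for I x
    by (induction I rule: infinite_finite_induct)
      (simp_all add: zero_smooth.rep_eq plus_smooth.rep_eq scaleR_smooth.rep_eq apply_smooth_coord_power)
  then have "f = (\<Sum>i\<le>degree q. coeff q i *\<^sub>R smooth_coord ^ i)"
    by (intro smooth_eqI) (simp add: q poly_altdef)
  then show ?thesis by blast
qed

section \<open>The differential from theta^0 to theta^0 theta^1: its kernel and cokernel\<close>

definition twisted :: "smooth poly \<Rightarrow> smooth poly"
  where "twisted g = (1/2) *\<^sub>R g - lin_w * du g"

lemma coeff_twisted: "coeff (twisted g) k =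
  (1/2) *\<^sub>R coeff g k - smooth_coord * smooth_deriv (coeff g k) +
    (case k of 0 \<Rightarrow> 0 | Suc j \<Rightarrow> smooth_deriv (coeff g j))"
  by (simp add: twisted_def coeff_lin_w coeff_scaleR_poly coeff_du split: nat.split)

lemma linear_twisted: "linear twisted"
  by (rule linearI; rule poly_eqI)
    (auto simp: coeff_twisted coeff_scaleR_poly smooth_deriv_add smooth_deriv_scaleR algebra_simps split: nat.split)

lemma polynomial_functions_euler:
  "h \<in> polynomial_functions \<Longrightarrow> (1/2) *\<^sub>R h - smooth_coord * smooth_deriv h \<in> polynomial_functions"
  using subspace_polynomial_functions polynomial_functions_deriv_iff[of h]
  by (intro subspace_diff subspace_scale polynomial_functions_coord_mult) auto

text \<open>The coefficient of \<lambda>^(n+1) expresses the derivative of g_n through g_(n+1).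
  Starting above the degree, where g vanishes, downward induction makes every g_k
  polynomial.\<close>

lemma twisted_coeff_polynomial:
  assumes "\<And>n. coeff (twisted g) (Suc n) = 0"
  shows "coeff g k \<in> polynomial_functions"
proof (cases "k \<le> Suc (degree g)")
  case True
  then show ?thesis
  proof (rule inc_induct)
    show "coeff g (Suc (degree g)) \<in> polynomial_functions"
      by (simp add: coeff_eq_0 subspace_0[OF subspace_polynomial_functions])
    fix n assume n: "coeff g (Suc n) \<in> polynomial_functions"
    have "smooth_deriv (coeff g n) = - ((1/2) *\<^sub>R coeff g (Suc n) - smooth_coord * smooth_deriv (coeff g (Suc n)))"
      unfolding eq_neg_iff_add_eq_0 using assms[of n] by (simp add: coeff_twisted add.commute)
    also have "\<dots> \<in> polynomial_functions"
      by (rule subspace_neg[OF subspace_polynomial_functions polynomial_functions_euler[OF n]])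
    finally show "coeff g n \<in> polynomial_functions"
      by (simp add: polynomial_functions_deriv_iff)
  qed
next
  case False
  then show ?thesis by (simp add: coeff_eq_0 subspace_0[OF subspace_polynomial_functions])
qed

lemma twisted_eq_const_polynomial:
  assumes "[:f:] = twisted g"
  shows "f \<in> polynomial_functions"
proof -
  have "coeff g 0 \<in> polynomial_functions"
    by (rule twisted_coeff_polynomial) (simp flip: assms)
  moreover have "f = (1/2) *\<^sub>R coeff g 0 - smooth_coord * smooth_deriv (coeff g 0)"
    using arg_cong[OF assms, of "\<lambda>p. coeff p 0"] by (simp add: coeff_twisted)
  ultimately show ?thesis using polynomial_functions_euler by simp
qed

text \<open>Comparing coefficients of u^k gives (1/2 - k) p_k = 0, and 1/2 is not an
  integer.\<close>

lemma polynomial_function_euler_eq_0: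
  assumes h: "h \<in> polynomial_functions" and eq: "(1/2) *\<^sub>R h = smooth_coord * smooth_deriv h"
  shows "h = 0"
proof -
  obtain p where p: "apply_smooth h = poly p"
    using h by (auto simp: polynomial_functions_def)
  have "apply_smooth (smooth_deriv h) x = poly (pderiv p) x" for x
    using DERIV_unique[OF DERIV_apply_smooth[of h x, unfolded p] poly_DERIV] .
  then have "poly (smult (1/2) p) x = poly (pCons 0 (pderiv p)) x" for x
    using arg_cong[OF eq, of "\<lambda>f. apply_smooth f x"]
    by (simp add: scaleR_smooth.rep_eq times_smooth.rep_eq smooth_coord.rep_eq p)
  then have peq: "smult (1/2) p = pCons 0 (pderiv p)"
    by (simp add: poly_eq_poly_eq_iff[symmetric] fun_eq_iff)
  have "coeff p k = 0" for k
    using arg_cong[OF peq, of "\<lambda>q. coeff q k"]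
  proof (cases k)
    case (Suc j)
    then have "(1/2 - real (Suc j)) * coeff p k = 0"
      using arg_cong[OF peq, of "\<lambda>q. coeff q k"] by (simp add: coeff_pderiv algebra_simps)
    moreover have "1/2 - real (Suc j) \<noteq> 0" by linarith
    ultimately show ?thesis using mult_eq_0_iff by blast
  qed simp
  then have "p = 0" by (auto intro: poly_eqI)
  then show ?thesis by (intro smooth_eqI) (simp add: p zero_smooth.rep_eq)
qed

text \<open>All coefficients are polynomial by the downward induction. Going upwards, once a_k = 0
  the coefficient of \<lambda>^(k+1) reads h/2 = u h' for h = a_(k+1).\<close>

lemma twisted_injective:
  assumes "twisted a = 0"
  shows "a = 0"
proof (rule poly_eqI)
  have pf: "coeff a k \<in> polynomial_functions" for k
    by (rule twisted_coeff_polynomial) (simp add: assms)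
  fix k
  have "coeff a k = 0"
  proof (induction k)
    case 0
    show ?case
      using arg_cong[OF assms, of "\<lambda>p. coeff p 0"]
      by (intro polynomial_function_euler_eq_0 pf) (simp add: coeff_twisted)
  next
    case (Suc k)
    then show ?case
      using arg_cong[OF assms, of "\<lambda>p. coeff p (Suc k)"]
      by (intro polynomial_function_euler_eq_0 pf) (simp add: coeff_twisted smooth_deriv_0)
  qed
  then show "coeff a k = coeff 0 k" by simp
qed

lemma smooth_deriv_coord_power: "smooth_deriv (smooth_coord ^ Suc n) = real (Suc n) *\<^sub>R smooth_coord ^ n"
  by (rule smooth_deriv_unique)
    (auto simp: apply_smooth_coord_power[abs_def] apply_smooth_coord_power scaleR_smooth.rep_eq
      simp del: power_Suc intro!: derivative_eq_intros)

text \<open>\<open>twisted\<close> maps u^(n+1) to (1/2 - (n+1)) u^(n+1) + (n+1) \<lambda> u^n and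
  commutes with multiplication by \<lambda>. As 1/2 - (n+1) is nonzero, the powers are reached
  inductively.\<close>

lemma twisted_range_coord_power: "[:smooth_coord ^ n:] \<in> range twisted"
proof (induction n)
  case 0
  have "[:1:] = twisted [:2 *\<^sub>R 1:]"
    by (rule poly_eqI) (simp add: coeff_twisted coeff_pCons smooth_deriv_scaleR smooth_deriv_0 split: nat.split)
  then show ?case by auto
next
  case (Suc n)
  have sub: "subspace (range twisted)"
    using linear_subspace_image[OF linear_twisted subspace_UNIV] .
  obtain h where h: "[:smooth_coord ^ n:] = twisted h" using Suc by blast
  have "pCons 0 (twisted h) = twisted (pCons 0 h)"
    by (rule poly_eqI) (simp add: coeff_twisted coeff_pCons smooth_deriv_0 split: nat.split)
  then have shift: "pCons 0 [:smooth_coord ^ n:] \<in> range twisted" by (simp add: h)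
  have "twisted [:smooth_coord ^ Suc n:] = (1/2 - real (Suc n)) *\<^sub>R [:smooth_coord ^ Suc n:]
      + real (Suc n) *\<^sub>R pCons 0 [:smooth_coord ^ n:]"
    by (rule poly_eqI)
      (simp add: coeff_twisted coeff_pCons coeff_scaleR_poly smooth_deriv_coord_power smooth_deriv_0
        scaleR_diff_left scaleR_left_distrib del: power_Suc split: nat.split, simp add: smooth_deriv_0 algebra_simps)
  then have "(1/2 - real (Suc n)) *\<^sub>R [:smooth_coord ^ Suc n:] =
      twisted [:smooth_coord ^ Suc n:] - real (Suc n) *\<^sub>R pCons 0 [:smooth_coord ^ n:]"
    by simp
  also have "\<dots> \<in> range twisted"
    by (intro subspace_diff[OF sub] subspace_scale[OF sub] shift) simp
  finally have *: "(1/2 - real (Suc n)) *\<^sub>R [:smooth_coord ^ Suc n:] \<in> range twisted" .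
  have "1/2 - real (Suc n) \<noteq> 0" by linarith
  then show ?case
    using subspace_scale[OF sub *, of "inverse (1/2 - real (Suc n))"] by simp
qed

lemma twisted_range_polynomial:
  assumes "f \<in> polynomial_functions"
  shows "[:f:] \<in> range twisted"
proof -
  obtain q where q: "f = (\<Sum>i\<le>degree q. coeff q i *\<^sub>R smooth_coord ^ i)"
    using polynomial_function_expansion[OF assms] by blast
  have sub: "subspace (range twisted)"
    using linear_subspace_image[OF linear_twisted subspace_UNIV] .
  have "[:f:] = (\<Sum>i\<le>degree q. coeff q i *\<^sub>R [:smooth_coord ^ i:])"
    by (rule poly_eqI) (simp add: q coeff_sum coeff_pCons coeff_scaleR_poly split: nat.split)
  then show ?thesis
    by (simp add: subspace_sum[OF sub] subspace_scale[OF sub] twisted_range_coord_power)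
qed

text \<open>The coefficient of \<lambda>^(n+1) in \<open>twisted\<close> of G \<lambda>^n is G', so
  an antiderivative of the top coefficient removes it, down to \<lambda>-degree 0.\<close>

lemma twisted_reduction: "\<exists>g f. a - twisted g = [:f:]"
proof -
  have "\<exists>g f. a - twisted g = [:f:]" if "\<And>k. n < k \<Longrightarrow> coeff a k = 0" for n
    using that
  proof (induction n arbitrary: a)
    case 0
    have "a - twisted 0 = [:coeff a 0:]"
      by (rule poly_eqI) (use 0 in \<open>auto simp: linear_0[OF linear_twisted] coeff_pCons split: nat.split\<close>)
    then show ?case by blast
  next
    case (Suc n)
    obtain G where G: "smooth_deriv G = coeff a (Suc n)" using smooth_antiderivative by blast
    have "coeff (a - twisted (monom G n)) k = 0" if "n < k" for k
      using Suc.prems[of k] that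
      by (cases k) (auto simp: coeff_twisted G smooth_deriv_0)
    from Suc.IH[OF this] obtain g f where "a - twisted (monom G n) - twisted g = [:f:]" by blast
    then have "a - twisted (monom G n + g) = [:f:]"
      by (simp add: linear_add[OF linear_twisted] algebra_simps)
    then show ?case by blast
  qed
  from this[of "degree a"] show ?thesis by (simp add: coeff_eq_0)
qed

section \<open>Cosets\<close>

lemma coset_eq_iff:
  fixes W :: "'a::real_vector set"
  assumes W: "subspace W"
  shows "a +o W = b +o W \<longleftrightarrow> a - b \<in> W"
proof
  assume "a +o W = b +o W"
  moreover have "a \<in> a +o W"
    using subspace_0[OF W] by (auto simp: elt_set_plus_def)
  ultimately obtain w where "a = b + w" "w \<in> W" by (auto simp: elt_set_plus_def)
  then show "a - b \<in> W" by simp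
next
  assume ab: "a - b \<in> W"
  have "x - b \<in> W \<longleftrightarrow> x - a \<in> W" for x
    using subspace_add[OF W ab, of "x - a"] subspace_diff[OF W _ ab, of "x - b"] by auto
  moreover have "x \<in> c +o W \<longleftrightarrow> x - c \<in> W" for x c
    by (auto simp: elt_set_plus_def intro: bexI[of _ "x - c"])
  ultimately show "a +o W = b +o W" by blast
qed

lemma coset_add:
  fixes W :: "'a::real_vector set"
  assumes W: "subspace W"
  shows "(a +o W) + (b +o W) = (a + b) +o W"
proof -
  have "W + W = W"
    using subspace_0[OF W] subspace_add[OF W] by (force simp: set_plus_def)
  then show ?thesis by (simp add: set_plus_rearrange)
qed

lemma coset_scaleR:
  fixes W :: "'a::real_vector set"
  assumes W: "subspace W"
  shows "coset_scaleR W r (a +o W) = (r *\<^sub>R a) +o W"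
proof (rule set_eqI)
  fix x
  have "x \<in> coset_scaleR W r (a +o W) \<longleftrightarrow> (\<exists>v\<in>W. \<exists>w\<in>W. x = r *\<^sub>R (a + v) + w)"
    by (auto simp: coset_scaleR_def set_plus_def elt_set_plus_def)
  also have "\<dots> \<longleftrightarrow> (\<exists>w\<in>W. x = r *\<^sub>R a + w)"
  proof
    assume "\<exists>v\<in>W. \<exists>w\<in>W. x = r *\<^sub>R (a + v) + w"
    then obtain v w where "v \<in> W" "w \<in> W" "x = r *\<^sub>R (a + v) + w" by blast
    then show "\<exists>w\<in>W. x = r *\<^sub>R a + w"
      using subspace_add[OF W subspace_scale[OF W]]
      by (intro bexI[of _ "r *\<^sub>R v + w"]) (auto simp: scaleR_add_right)
  next
    assume "\<exists>w\<in>W. x = r *\<^sub>R a + w"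
    then show "\<exists>v\<in>W. \<exists>w\<in>W. x = r *\<^sub>R (a + v) + w"
      using subspace_0[OF W] by (metis add_0_right)
  qed
  finally show "x \<in> coset_scaleR W r (a +o W) \<longleftrightarrow> x \<in> (r *\<^sub>R a) +o W"
    by (auto simp: elt_set_plus_def)
qed

text \<open>The map on cosets is well defined because \<open>\<phi>\<close> sends W into the
  coboundaries, and injective because nothing else goes there.\<close>

lemma represents_cohomologyI:
  fixes \<phi> :: "'a::real_vector \<Rightarrow> super_series poly"
  assumes W: "subspace W" and B: "subspace (coboundaries p d)" and \<phi>: "linear \<phi>"
    and cocycle: "\<And>v. \<phi> v \<in> cocycles p d"
    and surj: "\<And>z. z \<in> cocycles p d \<Longrightarrow> \<exists>v. z - \<phi> v \<in> coboundaries p d"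
    and kernel: "\<And>v. \<phi> v \<in> coboundaries p d \<longleftrightarrow> v \<in> W"
  shows "represents_cohomology p d UNIV W \<phi>"
proof -
  let ?B = "coboundaries p d"
  define \<Phi> where "\<Phi> X = (\<phi> (SOME v. v \<in> X)) +o ?B" for X
  have \<Phi>: "\<Phi> (v +o W) = \<phi> v +o ?B" for v
  proof -
    have "v \<in> v +o W" using subspace_0[OF W] by (auto simp: elt_set_plus_def)
    then have "(SOME v'. v' \<in> v +o W) \<in> v +o W" by (rule someI)
    then obtain w where "w \<in> W" "(SOME v'. v' \<in> v +o W) = v + w" by (auto simp: elt_set_plus_def)
    then show ?thesis
      by (simp add: \<Phi>_def coset_eq_iff[OF B] linear_add[OF \<phi>] kernel)
  qed
  have "bij_betw \<Phi> (quotient_space UNIV W) (cohomology p d)"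
    unfolding bij_betw_def
  proof
    show "inj_on \<Phi> (quotient_space UNIV W)"
      by (auto simp: inj_on_def quotient_space_def \<Phi> coset_eq_iff[OF B] coset_eq_iff[OF W]
          linear_diff[OF \<phi>, symmetric] kernel)
    show "\<Phi> ` quotient_space UNIV W = cohomology p d"
    proof (intro equalityI subsetI)
      fix X assume "X \<in> \<Phi> ` quotient_space UNIV W"
      then show "X \<in> cohomology p d"
        using cocycle by (auto simp: quotient_space_def cohomology_def \<Phi>)
    next
      fix X assume "X \<in> cohomology p d"
      then obtain z where z: "z \<in> cocycles p d" "X = z +o ?B"
        by (auto simp: cohomology_def quotient_space_def)
      then obtain v where "z - \<phi> v \<in> ?B" using surj by blast
      then have "X = \<Phi> (v +o W)" by (simp add: z \<Phi> coset_eq_iff[OF B])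
      then show "X \<in> \<Phi> ` quotient_space UNIV W" by (auto simp: quotient_space_def)
    qed
  qed
  then show ?thesis
    unfolding represents_cohomology_def
    by (intro exI[of _ \<Phi>])
      (auto simp: quotient_space_def \<Phi> coset_add[OF W] coset_add[OF B] coset_scaleR[OF W]
        coset_scaleR[OF B] linear_add[OF \<phi>] linear_scale[OF \<phi>])
qed

lemma lambda_bidegree_part_scaleR: "P \<in> lambda_bidegree_part p d \<Longrightarrow> r *\<^sub>R P \<in> lambda_bidegree_part p d"
  by (simp add: lambda_bidegree_part_def bidegree_part_iff coeff_scaleR_poly graded_scaleR)

lemma D_lambda_scaleR: "P \<in> lambda_bidegree_part p d \<Longrightarrow> D_lambda (r *\<^sub>R P) = r *\<^sub>R D_lambda P"
  by (rule poly_eqI) (simp add: coeff_D_lambda coeff_scaleR_poly D2_linear D1_linear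
      lambda_bidegree_partD scaleR_diff_right split: nat.split)

lemma D_lambda_0: "D_lambda 0 = 0"
  by (simp add: D_lambda_def)

lemma subspace_coboundaries: "subspace (coboundaries p d)"
  unfolding coboundaries_def
proof (rule subspaceI)
  let ?A = "lambda_bidegree_part (p - 1) (d - 1)"
  show "0 \<in> D_lambda ` ?A"
    using lambda_bidegree_part_0 by (intro image_eqI[of _ _ 0]) (simp_all add: D_lambda_0)
  show "x + y \<in> D_lambda ` ?A" if "x \<in> D_lambda ` ?A" "y \<in> D_lambda ` ?A" for x y
    using that by (auto simp: D_lambda_add[symmetric] intro: lambda_bidegree_part_add)
  show "c *\<^sub>R x \<in> D_lambda ` ?A" if "x \<in> D_lambda ` ?A" for c x
    using that by (auto simp: D_lambda_scaleR[symmetric] intro: lambda_bidegree_part_scaleR)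
qed

section \<open>The cohomology\<close>

lemma cohomology_trivial:
  assumes "cocycles p d \<subseteq> coboundaries p d"
  shows "cohomology p d = {coboundaries p d}"
proof -
  note B = subspace_coboundaries[of p d]
  have "v +o coboundaries p d = coboundaries p d" if "v \<in> cocycles p d" for v
    using coset_eq_iff[OF B, of v 0] that assms by auto
  moreover have "0 \<in> cocycles p d"
    by (simp add: cocycles_def lambda_bidegree_part_0 D_lambda_0)
  ultimately show ?thesis
    unfolding cohomology_def quotient_space_def by auto
qed

lemma D_lambda_emb_2_2:
  "D_lambda (emb (theta 0 * theta 2) a + emb (jet_u 1 * (theta 0 * theta 1)) b) =
    emb (theta 0 * (theta 1 * theta 2)) (lin_w * (b - du a))"
proof -
  have "D_lambda (emb (theta 0 * theta 2) a + emb (jet_u 1 * (theta 0 * theta 1)) b) =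
      D_lambda (emb (theta 0 * theta 2) a) + D_lambda (emb (jet_u 1 * (theta 0 * theta 1)) b)"
    by (rule D_lambda_add[of _ 2 2]; rule emb_lambda_bidegree[OF basis_monomials(5)]
        emb_lambda_bidegree[OF basis_monomials(6)]; simp)
  then show ?thesis
    by (simp only: D_lambda_emb_theta_0_theta_2 D_lambda_emb_jet_1_theta_0_theta_1
        emb_add[symmetric] right_diff_distrib) simp
qed

lemma emb_image_iff: "is_monomial b m S \<Longrightarrow> emb b a \<in> emb b ` A \<longleftrightarrow> a \<in> A"
  by (rule inj_image_mem_iff) (simp add: inj_def emb_inject)

lemma coboundaries_eq:
  "coboundaries 0 0 = {0}"
  "coboundaries 2 1 = emb (theta 0 * theta 1) ` range twisted"
  "coboundaries 3 3 = emb (theta 0 * (theta 1 * theta 2)) ` range ((*) lin_w)"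
proof -
  have "lambda_bidegree_part (- 1) (- 1) = {0}"
    using lambda_bidegree_part_trivial[of _ "-1" "-1"] lambda_bidegree_part_0 by auto
  then show "coboundaries 0 0 = {0}"
    by (simp add: coboundaries_def D_lambda_0)
  show "coboundaries 2 1 = emb (theta 0 * theta 1) ` range twisted"
    unfolding coboundaries_def
    by (simp add: lambda_bidegree_part_eq image_image D_lambda_emb_theta_0 twisted_def)
  show "coboundaries 3 3 = emb (theta 0 * (theta 1 * theta 2)) ` range ((*) lin_w)"
  proof (intro equalityI subsetI)
    fix P assume "P \<in> coboundaries 3 3"
    then obtain a b where "P = D_lambda (emb (theta 0 * theta 2) a + emb (jet_u 1 * (theta 0 * theta 1)) b)"
      by (auto simp: coboundaries_def lambda_bidegree_part_eq(6))
    then show "P \<in> emb (theta 0 * (theta 1 * theta 2)) ` range ((*) lin_w)"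
      unfolding D_lambda_emb_2_2 by blast
  next
    fix P assume "P \<in> emb (theta 0 * (theta 1 * theta 2)) ` range ((*) lin_w)"
    then obtain c where "P = emb (theta 0 * (theta 1 * theta 2)) (lin_w * c)" by blast
    \<comment> \<open>Already the multiples of u^1 theta^0 theta^1 reach every multiple of
      w.\<close>
    then have "P = D_lambda (emb (theta 0 * theta 2) 0 + emb (jet_u 1 * (theta 0 * theta 1)) c)"
      unfolding D_lambda_emb_2_2 by simp
    moreover have "emb (theta 0 * theta 2) 0 + emb (jet_u 1 * (theta 0 * theta 1)) c \<in> lambda_bidegree_part 2 2"
      unfolding lambda_bidegree_part_eq(6) by blast
    ultimately show "P \<in> coboundaries 3 3" by (simp add: coboundaries_def)
  qed
qed

lemma cocycles_eq:
  "cocycles 0 0 = {emb 1 a | a. du a = 0}"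
  "cocycles 2 1 = range (emb (theta 0 * theta 1))"
  "cocycles 3 3 = range (emb (theta 0 * (theta 1 * theta 2)))"
proof -
  \<comment> \<open>The target bidegrees, (3, 2) here and (4, 4) below, contain no monomial.\<close>
  have "D_lambda P = 0" if "P \<in> lambda_bidegree_part 2 1" for P
    using lambda_bidegree_part_trivial[of _ 3 2] D_lambda_bidegree[OF that] by simp
  then show "cocycles 2 1 = range (emb (theta 0 * theta 1))"
    unfolding cocycles_def lambda_bidegree_part_eq(3)[symmetric] by blast
  have "D_lambda P = 0" if "P \<in> lambda_bidegree_part 3 3" for P
    using lambda_bidegree_part_trivial[of _ 4 4] D_lambda_bidegree[OF that] by simp
  then show "cocycles 3 3 = range (emb (theta 0 * (theta 1 * theta 2)))"
    unfolding cocycles_def lambda_bidegree_part_eq(4)[symmetric] by blast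
  have "D_lambda (emb 1 a) = 0 \<longleftrightarrow> du a = 0" for a
  proof
    assume "D_lambda (emb 1 a) = 0"
    then have "component {#1#} {0} (emb (theta 1) (lin_w * du a) + emb (jet_u 1 * theta 0) ((1/2) *\<^sub>R du a)) = 0"
      by (simp add: D_lambda_emb_1 component_0)
    then show "du a = 0"
      unfolding component_add component_emb[OF basis_monomials(2)] component_emb[OF basis_monomials(4)]
      by simp
  qed (simp add: D_lambda_emb_1)
  then show "cocycles 0 0 = {emb 1 a | a. du a = 0}"
    unfolding cocycles_def lambda_bidegree_part_eq(1) by auto
qed

lemma emb_const: "emb b [:f:] = [:ss_const f * b:]"
  by (rule poly_eqI) (simp add: coeff_emb coeff_pCons split: nat.split)

lemma linear_emb_const: "linear (\<lambda>f. [:ss_const f * b:])"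
  by (rule linearI; rule poly_eqI)
    (simp_all add: coeff_scaleR_poly coeff_pCons ss_const_add ss_const_scaleR distrib_right split: nat.split)

lemma lin_w_eq_0: "lin_w * a = 0 \<Longrightarrow> a = 0"
proof (rule ccontr)
  assume "lin_w * a = 0" "a \<noteq> 0"
  then have "coeff (lin_w * a) (Suc (degree a)) = 0" by simp
  then have "coeff a (degree a) = 0" unfolding coeff_lin_w by (simp add: coeff_eq_0)
  with \<open>a \<noteq> 0\<close> show False by simp
qed

text \<open>There are no nonzero coboundaries, and closedness makes each coefficient a constant
  function, which its value at 0 recovers.\<close>

lemma cohomology_0_0:
  "represents_cohomology 0 0 (UNIV :: real poly set) {0} (map_poly (\<lambda>r. ss_const (of_real r)))"
proof (rule represents_cohomologyI)
  let ?\<phi> = "map_poly (\<lambda>r. ss_const (of_real r)) :: real poly \<Rightarrow> _"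
  have "linear (\<lambda>r. ss_const (of_real r))"
    by (rule linearI) (simp_all add: of_real_def ss_const_add ss_const_scaleR scaleR_left_distrib)
  then show lin: "linear ?\<phi>" by (rule linear_map_poly)
  have \<phi>: "?\<phi> q = emb 1 (map_poly of_real q)" for q
    by (rule poly_eqI) (simp add: coeff_map_poly coeff_emb)
  show "?\<phi> q \<in> cocycles 0 0" for q
  proof -
    have "du (map_poly of_real q) = 0"
      by (rule poly_eqI) (simp add: coeff_du coeff_map_poly)
    then show ?thesis unfolding cocycles_eq \<phi> by blast
  qed
  show "\<exists>q. z - ?\<phi> q \<in> coboundaries 0 0" if z: "z \<in> cocycles 0 0" for z
  proof -
    from z obtain a where a: "z = emb 1 a" "du a = 0" unfolding cocycles_eq by blast
    have "a = map_poly of_real (map_poly (\<lambda>f. apply_smooth f 0) a)"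
    proof (rule poly_eqI)
      fix k
      have "smooth_deriv (coeff a k) = 0" by (simp add: a(2) flip: coeff_du)
      then show "coeff a k = coeff (map_poly of_real (map_poly (\<lambda>f. apply_smooth f 0) a)) k"
        by (simp add: coeff_map_poly zero_smooth.rep_eq smooth_deriv_eq_0[symmetric])
    qed
    then have "z = ?\<phi> (map_poly (\<lambda>f. apply_smooth f 0) a)" unfolding \<phi> a(1) by simp
    then show ?thesis unfolding coboundaries_eq by auto
  qed
  show "?\<phi> q \<in> coboundaries 0 0 \<longleftrightarrow> q \<in> {0}" for q
  proof -
    have "q = 0" if "emb 1 (map_poly of_real q :: smooth poly) = 0"
    proof (rule poly_eqI)
      fix k
      from that have "map_poly of_real q = (0 :: smooth poly)"
        using emb_inject[OF is_monomial_1, of "map_poly of_real q" 0] by simp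
      then have "coeff (map_poly of_real q :: smooth poly) k = 0" by simp
      then show "coeff q k = coeff 0 k"
        using apply_smooth_of_real[of "coeff q k" 0] by (simp add: coeff_map_poly)
    qed
    then show ?thesis unfolding coboundaries_eq \<phi> by auto
  qed
qed (simp_all add: subspace_coboundaries subspace_single_0)

text \<open>Every element is closed. Modulo the range of \<open>twisted\<close> it becomes free of
  \<lambda>, and the \<lambda>-free elements of that range are exactly the polynomial
  functions.\<close>

lemma cohomology_2_1:
  "represents_cohomology 2 1 (UNIV :: smooth set) polynomial_functions
    (\<lambda>f. [:ss_const f * theta 0 * theta 1:])"
  unfolding mult.assoc
proof (rule represents_cohomologyI)
  let ?b = "theta 0 * theta 1"
  show "[:ss_const f * ?b:] \<in> cocycles 2 1" for f
    unfolding cocycles_eq emb_const[symmetric] by blast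
  show "\<exists>f. z - [:ss_const f * ?b:] \<in> coboundaries 2 1" if "z \<in> cocycles 2 1" for z
  proof -
    from that obtain a where a: "z = emb ?b a" unfolding cocycles_eq by blast
    obtain g f where gf: "a - twisted g = [:f:]" using twisted_reduction by blast
    then have "a - [:f:] = twisted g" by (simp add: algebra_simps)
    then show ?thesis
      unfolding coboundaries_eq a emb_const[symmetric] emb_diff[symmetric] by auto
  qed
  show "[:ss_const f * ?b:] \<in> coboundaries 2 1 \<longleftrightarrow> f \<in> polynomial_functions" for f
    unfolding coboundaries_eq emb_const[symmetric] emb_image_iff[OF basis_monomials(3)]
    using twisted_eq_const_polynomial[of f] twisted_range_polynomial[of f] by blast
qed (simp_all add: subspace_coboundaries subspace_polynomial_functions linear_emb_const)

text \<open>The coboundaries are the multiples of u - \<lambda>, so evaluation at \<lambda> = u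
  identifies the quotient with the smooth functions.\<close>

lemma cohomology_3_3:
  "represents_cohomology 3 3 (UNIV :: smooth set) {0}
    (\<lambda>f. [:ss_const f * theta 0 * theta 1 * theta 2:])"
  unfolding mult.assoc
proof (rule represents_cohomologyI)
  let ?b = "theta 0 * (theta 1 * theta 2)"
  show "[:ss_const f * ?b:] \<in> cocycles 3 3" for f
    unfolding cocycles_eq emb_const[symmetric] by blast
  have w: "lin_w = - [:- smooth_coord, 1:]" by (simp add: lin_w_def)
  show "\<exists>f. z - [:ss_const f * ?b:] \<in> coboundaries 3 3" if "z \<in> cocycles 3 3" for z
  proof -
    from that obtain a where a: "z = emb ?b a" unfolding cocycles_eq by blast
    have "a - [:poly a smooth_coord:] = lin_w * (- synthetic_div a smooth_coord)"
      using synthetic_div_correct'[of smooth_coord a] unfolding w by (simp add: algebra_simps)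
    then show ?thesis
      unfolding coboundaries_eq a emb_const[symmetric] emb_diff[symmetric]
      by (intro exI[of _ "poly a smooth_coord"]) (simp only:, blast)
  qed
  have "f = 0" if "[:f:] = lin_w * c" for f c
    using arg_cong[OF that, of "\<lambda>q. poly q smooth_coord"] by (simp add: lin_w_def)
  then show "[:ss_const f * ?b:] \<in> coboundaries 3 3 \<longleftrightarrow> f \<in> {0}" for f
    unfolding coboundaries_eq emb_const[symmetric] emb_image_iff[OF basis_monomials(7)]
    by (auto intro!: image_eqI[of _ _ 0])
qed (simp_all add: subspace_coboundaries subspace_single_0 linear_emb_const)

lemma lin_w_scaleR: "lin_w * (r *\<^sub>R a) = r *\<^sub>R (lin_w * a)"
  by (rule poly_eqI)
    (simp add: coeff_lin_w coeff_scaleR_poly scaleR_diff_right split: nat.split)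

lemma du_scaleR: "du (r *\<^sub>R a) = r *\<^sub>R du a"
  by (rule linear_scale[OF linear_map_poly[OF linear_smooth_deriv]])

lemma du_surjective: "\<exists>b. du b = a"
proof (induction a)
  case 0
  show ?case by (rule exI[of _ 0]) simp
next
  case (pCons c a)
  then obtain b where "du b = a" by blast
  moreover obtain g where "smooth_deriv g = c" using smooth_antiderivative by blast
  ultimately have "du (pCons g b) = pCons c a" by (simp add: map_poly_pCons smooth_deriv_0)
  then show ?case by blast
qed

lemma cocycles_1_0: "cocycles 1 0 \<subseteq> coboundaries 1 0"
proof
  fix z assume "z \<in> cocycles 1 0"
  then obtain a where a: "z = emb (theta 0) a" "D_lambda z = 0"
    unfolding cocycles_def lambda_bidegree_part_eq by blast
  then have "emb (theta 0 * theta 1) (twisted a) = emb (theta 0 * theta 1) 0"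
    by (simp add: D_lambda_emb_theta_0[folded twisted_def])
  then have "twisted a = 0" by (simp only: emb_inject[OF basis_monomials(3)])
  then have "a = 0" by (rule twisted_injective)
  then have "z = 0" by (simp add: a(1))
  then show "z \<in> coboundaries 1 0" using subspace_0[OF subspace_coboundaries] by simp
qed

text \<open>The theta^0 theta^2 component of closedness forces f = 2 w g. With h' = 2 g, the
  differential w h' theta^1 + (h'/2) u^1 theta^0 of h is the given cocycle.\<close>

lemma cocycles_1_1: "cocycles 1 1 \<subseteq> coboundaries 1 1"
proof
  fix z assume z: "z \<in> cocycles 1 1"
  then obtain f g where fg: "z = emb (theta 1) f + emb (jet_u 1 * theta 0) g"
    unfolding cocycles_def lambda_bidegree_part_eq by blast
  have "emb (theta 1) f \<in> lambda_bidegree_part 1 1" "emb (jet_u 1 * theta 0) g \<in> lambda_bidegree_part 1 1"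
    by (rule emb_lambda_bidegree[OF basis_monomials(2)] emb_lambda_bidegree[OF basis_monomials(4)]; simp)+
  then have "D_lambda z = D_lambda (emb (theta 1) f) + D_lambda (emb (jet_u 1 * theta 0) g)"
    unfolding fg by (rule D_lambda_add)
  moreover have "D_lambda z = 0" using z by (simp add: cocycles_def)
  ultimately have "component {#} {0, 2} (D_lambda (emb (theta 1) f) + D_lambda (emb (jet_u 1 * theta 0) g)) = 0"
    by (simp add: component_0)
  then have "(1/2) *\<^sub>R f - lin_w * g = 0"
    unfolding D_lambda_emb_theta_1 D_lambda_emb_jet_1_theta_0 component_add
      component_emb[OF basis_monomials(5)] component_emb[OF basis_monomials(6)]
    by simp
  then have "(1/2) *\<^sub>R f = lin_w * g" by simp
  then have f: "f = lin_w * (2 *\<^sub>R g)"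
    unfolding lin_w_scaleR by (metis scaleR_scaleR scaleR_one nonzero_mult_div_cancel_left zero_neq_numeral times_divide_eq_right mult_1_right)
  obtain h where "du h = 2 *\<^sub>R g" using du_surjective by blast
  then have "z = D_lambda (emb 1 h)"
    unfolding D_lambda_emb_1 fg f by simp
  moreover have "emb 1 h \<in> lambda_bidegree_part 0 0"
    unfolding lambda_bidegree_part_eq(1) by blast
  ultimately show "z \<in> coboundaries 1 1" by (simp add: coboundaries_def)
qed

text \<open>Closedness says w (b - a') = 0, so b = a', which is exactly the shape of the
  differential of 2 a theta^1.\<close>

lemma cocycles_2_2: "cocycles 2 2 \<subseteq> coboundaries 2 2"
proof
  fix z assume z: "z \<in> cocycles 2 2"
  then obtain a b where ab: "z = emb (theta 0 * theta 2) a + emb (jet_u 1 * (theta 0 * theta 1)) b"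
    unfolding cocycles_def lambda_bidegree_part_eq by blast
  have "D_lambda z = 0" using z by (simp add: cocycles_def)
  then have "emb (theta 0 * (theta 1 * theta 2)) (lin_w * (b - du a)) = emb (theta 0 * (theta 1 * theta 2)) 0"
    unfolding ab D_lambda_emb_2_2 by simp
  then have "b = du a"
    using lin_w_eq_0[of "b - du a"] by (simp only: emb_inject[OF basis_monomials(7)]) simp
  then have "z = D_lambda (emb (theta 1) (2 *\<^sub>R a))"
    unfolding ab D_lambda_emb_theta_1 du_scaleR by simp
  moreover have "emb (theta 1) (2 *\<^sub>R a) \<in> lambda_bidegree_part 1 1"
    by (rule emb_lambda_bidegree[OF basis_monomials(2)]; simp)
  ultimately show "z \<in> coboundaries 2 2" by (simp add: coboundaries_def)
qed

theorem proposition4: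
  shows "represents_cohomology 0 0 (UNIV :: real poly set) {0}
           (map_poly (\<lambda>r. ss_const (of_real r))) \<and>
         represents_cohomology 2 1 (UNIV :: smooth set) polynomial_functions
           (\<lambda>f. [:ss_const f * theta 0 * theta 1:]) \<and>
         represents_cohomology 3 3 (UNIV :: smooth set) {0}
           (\<lambda>f. [:ss_const f * theta 0 * theta 1 * theta 2:]) \<and>
         (\<forall>p d. (p, d) \<notin> {(0, 0), (2, 1), (3, 3)} \<longrightarrow>
           cohomology p d = {coboundaries p d})"
proof -
  have "cocycles p d \<subseteq> coboundaries p d" if "(p, d) \<notin> {(0, 0), (2, 1), (3, 3)}" for p d
  proof -
    consider "p < d" | "p = 1" "d = 0" | "p = 1" "d = 1" | "p = 2" "d = 2"
      | "d \<le> p" "(p, d) \<notin> {(0, 0), (1, 0), (1, 1), (2, 1), (2, 2), (3, 3)}"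
      using \<open>(p, d) \<notin> _\<close> by fastforce
    then show ?thesis
    proof cases
      case 5
      then have "cocycles p d \<subseteq> {0}"
        using lambda_bidegree_part_trivial by (auto simp: cocycles_def)
      then show ?thesis using subspace_0[OF subspace_coboundaries] by auto
    qed (simp_all add: cocycles_above_diagonal cocycles_1_0 cocycles_1_1 cocycles_2_2)
  qed
  then show ?thesis
    using cohomology_0_0 cohomology_2_1 cohomology_3_3 cohomology_trivial by blast
qed

end
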